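(* Let $p$ be a prime, let $G$ be a finite group, let $N\lhd G$, $H\leq G$ and $M:=N\cap H$. Let $b'\in\operatorname{Bl}(M)$ be a $p$-block of $M$ that has a defect group $D$ with $\operatorname{C}_G(D)\subseteq H$. Let $b:=(b')^N$. Then the map from $\operatorname{Bl}(H\mid b')$ to $\operatorname{Bl}(G\mid b)$ given by $B'\mapsto (B')^G$ is well-defined and surjective.
   Context: All blocks are $p$-blocks with respect to a $p$-modular system $(\mathcal K,\mathcal O,k)$ ($\mathcal O$ a complete discrete valuation ring with quotient field $\mathcal K$ of characteristic $0$ and residue field $k$ of characteristic $p$, with $\mathcal K$ and $k$ splitting fields for all finite groups involved); $^*:\mathcal O\to k$ is the canonical map. $\operatorname{Bl}(G)$ is the set of $p$-blocks of $G$. For $N\lhd G$ and $b\in\operatorname{Bl}(N)$, $\operatorname{Bl}(G\mid b)$ is the set of blocks of $G$ covering $b$. For $X\subseteq G$, $X^+=\sum_{x\in X}x$. For $B\in\operatorname{Bl}(G)$, $\lambda_B:\operatorname{Z}(kG)\to k$ is its central character: $\lambda_B(K^+)=\left(|K|\chi(g)/\chi(1)\right)^*$ for a conjugacy class $K$ of $G$, $g\in K$, and any irreducible ordinary character $\chi$ in $B$. Induced blocks: for $H\leq G$ and $B'\in\operatorname{Bl}(H)$, let $\lambda_{B'}^G:\operatorname{Z}(kG)\to k$ be the linear map with $\lambda_{B'}^G(K^+)=\lambda_{B'}((K\cap H)^+)$ for every conjugacy class $K$ of $G$. If it is an algebra homomorphism, $(B')^G$ is said to be defined, and is the unique block of $G$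 with $\lambda_{(B')^G}=\lambda_{B'}^G$. *)

theory Defs
  imports "Jordan_Normal_Form.Matrix" "HOL-Algebra.Coset"
    "HOL-Computational_Algebra.Computational_Algebra"
begin

section \<open>$p$-modular systems\<close>

text \<open>
  The ring \<open>\<O>\<close> is given as the valuation ring, inside its quotient field \<open>'K\<close>, of a normalised
  discrete valuation \<open>v\<close>. The value \<open>v 0\<close>, morally infinite, is irrelevant: \<open>val_ge v n x\<close> says
  that the valuation of \<open>x\<close> is at least \<open>n\<close>.
\<close>

definition val_ge :: "('K::field \<Rightarrow> int) \<Rightarrow> int \<Rightarrow> 'K \<Rightarrow> bool" where
  "val_ge v n x \<longleftrightarrow> x = 0 \<or> n \<le> v x"

definition discrete_valuation :: "('K::field \<Rightarrow> int) \<Rightarrow> bool" where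
  "discrete_valuation v \<longleftrightarrow>
     (\<forall>x y. x \<noteq> 0 \<longrightarrow> y \<noteq> 0 \<longrightarrow> v (x * y) = v x + v y) \<and>
     (\<forall>x y. x \<noteq> 0 \<longrightarrow> y \<noteq> 0 \<longrightarrow> x + y \<noteq> 0 \<longrightarrow> min (v x) (v y) \<le> v (x + y)) \<and>
     v ` (UNIV - {0}) = UNIV"

definition valuation_ring :: "('K::field \<Rightarrow> int) \<Rightarrow> 'K set" where
  "valuation_ring v = {x. val_ge v 0 x}"

definition val_complete :: "('K::field \<Rightarrow> int) \<Rightarrow> bool" where
  "val_complete v \<longleftrightarrow>
     (\<forall>s :: nat \<Rightarrow> 'K. range s \<subseteq> valuation_ring v \<longrightarrow>
        (\<forall>c. \<exists>n0. \<forall>m\<ge>n0. \<forall>n\<ge>n0. val_ge v c (s m - s n)) \<longrightarrow>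
        (\<exists>l\<in>valuation_ring v. \<forall>c. \<exists>n0. \<forall>n\<ge>n0. val_ge v c (s n - l)))"

text \<open>
  The residue field is an arbitrary field \<open>'k\<close> together with a surjective ring homomorphism
  \<open>star\<close> from \<open>\<O>\<close> whose kernel is the maximal ideal; values of \<open>star\<close> outside \<open>\<O>\<close> carry no
  information. The characteristic of \<open>'K\<close> is \<open>0\<close> by its type class.
\<close>

definition p_modular_system ::
    "nat \<Rightarrow> ('K::field_char_0 \<Rightarrow> int) \<Rightarrow> ('K \<Rightarrow> 'k::field) \<Rightarrow> bool" where
  "p_modular_system p v star \<longleftrightarrow>
     discrete_valuation v \<and> val_complete v \<and>
     CHAR('k) = p \<and>
     star 1 = 1 \<and>
     (\<forall>x\<in>valuation_ring v. \<forall>y\<in>valuation_ring v.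
        star (x + y) = star x + star y \<and> star (x * y) = star x * star y) \<and>
     star ` valuation_ring v = UNIV \<and>
     {x \<in> valuation_ring v. star x = 0} = {x. val_ge v 1 x}"


section \<open>Representations and characters\<close>

definition representation ::
    "('g, 'm) monoid_scheme \<Rightarrow> nat \<Rightarrow> ('g \<Rightarrow> 'a::field mat) \<Rightarrow> bool" where
  "representation G n \<rho> \<longleftrightarrow>
     (\<forall>g\<in>carrier G. \<rho> g \<in> carrier_mat n n) \<and>
     \<rho> \<one>\<^bsub>G\<^esub> = 1\<^sub>m n \<and>
     (\<forall>g\<in>carrier G. \<forall>h\<in>carrier G. \<rho> (g \<otimes>\<^bsub>G\<^esub> h) = \<rho> g * \<rho> h)"

definition invariant_subspace ::
    "('g, 'm) monoid_scheme \<Rightarrow> nat \<Rightarrow> ('g \<Rightarrow> 'a::field mat) \<Rightarrow> 'a vec set \<Rightarrow> bool" where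
  "invariant_subspace G n \<rho> W \<longleftrightarrow>
     W \<subseteq> carrier_vec n \<and> 0\<^sub>v n \<in> W \<and>
     (\<forall>u\<in>W. \<forall>w\<in>W. u + w \<in> W) \<and>
     (\<forall>c. \<forall>w\<in>W. c \<cdot>\<^sub>v w \<in> W) \<and>
     (\<forall>g\<in>carrier G. \<forall>w\<in>W. \<rho> g *\<^sub>v w \<in> W)"

definition irreducible_representation ::
    "('g, 'm) monoid_scheme \<Rightarrow> nat \<Rightarrow> ('g \<Rightarrow> 'a::field mat) \<Rightarrow> bool" where
  "irreducible_representation G n \<rho> \<longleftrightarrow>
     representation G n \<rho> \<and> 0 < n \<and>
     (\<forall>W. invariant_subspace G n \<rho> W \<longrightarrow> W = {0\<^sub>v n} \<or> W = carrier_vec n)"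

text \<open>
  A field is a splitting field for \<open>G\<close> if all endomorphisms of simple modules are scalars.
\<close>

definition splitting_field :: "'a::field itself \<Rightarrow> ('g, 'm) monoid_scheme \<Rightarrow> bool" where
  "splitting_field T G \<longleftrightarrow>
     (\<forall>n (\<rho> :: 'g \<Rightarrow> 'a mat). irreducible_representation G n \<rho> \<longrightarrow>
        (\<forall>A\<in>carrier_mat n n. (\<forall>g\<in>carrier G. A * \<rho> g = \<rho> g * A) \<longrightarrow>
           (\<exists>c. A = c \<cdot>\<^sub>m 1\<^sub>m n)))"

text \<open>Characters are extended by \<open>0\<close> outside the group, so that \<open>Irr G\<close> is not inflated.\<close>

definition character_of ::
    "('g, 'm) monoid_scheme \<Rightarrow> nat \<Rightarrow> ('g \<Rightarrow> 'a::field mat) \<Rightarrow> 'g \<Rightarrow> 'a" where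
  "character_of G n \<rho> g = (if g \<in> carrier G then (\<Sum>i<n. \<rho> g $$ (i, i)) else 0)"

definition Irr :: "('g, 'm) monoid_scheme \<Rightarrow> ('g \<Rightarrow> 'K::field_char_0) set" where
  "Irr G = {character_of G n \<rho> | n \<rho>. irreducible_representation G n \<rho>}"


section \<open>Group algebras\<close>

text \<open>
  Elements of the group algebra are functions supported on the group. Hence, for \<open>H \<le> G\<close>, the
  algebra of \<open>H\<close> is literally contained in that of \<open>G\<close>.
\<close>

definition group_algebra :: "('g, 'm) monoid_scheme \<Rightarrow> ('g \<Rightarrow> 'a::field) set" where
  "group_algebra G = {a. \<forall>x. x \<notin> carrier G \<longrightarrow> a x = 0}"

definition ga_mult ::
    "('g, 'm) monoid_scheme \<Rightarrow> ('g \<Rightarrow> 'a::field) \<Rightarrow> ('g \<Rightarrow> 'a) \<Rightarrow> 'g \<Rightarrow> 'a" where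
  "ga_mult G a b x =
     (if x \<in> carrier G then (\<Sum>y\<in>carrier G. a y * b (inv\<^bsub>G\<^esub> y \<otimes>\<^bsub>G\<^esub> x)) else 0)"

definition sum_of :: "'g set \<Rightarrow> 'g \<Rightarrow> 'a::field" where
  "sum_of X = (\<lambda>x. if x \<in> X then 1 else 0)"

definition ga_center :: "('g, 'm) monoid_scheme \<Rightarrow> ('g \<Rightarrow> 'a::field) set" where
  "ga_center G = {z \<in> group_algebra G. \<forall>a\<in>group_algebra G. ga_mult G z a = ga_mult G a z}"

definition conj_class :: "('g, 'm) monoid_scheme \<Rightarrow> 'g \<Rightarrow> 'g set" where
  "conj_class G x = {g \<otimes>\<^bsub>G\<^esub> x \<otimes>\<^bsub>G\<^esub> inv\<^bsub>G\<^esub> g | g. g \<in> carrier G}"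

definition conj_classes :: "('g, 'm) monoid_scheme \<Rightarrow> 'g set set" where
  "conj_classes G = conj_class G ` carrier G"

definition centralizer :: "('g, 'm) monoid_scheme \<Rightarrow> 'g set \<Rightarrow> 'g set" where
  "centralizer G D = {g \<in> carrier G. \<forall>d\<in>D. g \<otimes>\<^bsub>G\<^esub> d = d \<otimes>\<^bsub>G\<^esub> g}"

text \<open>
  The class sums form a basis of the centre; \<open>class_ext G f\<close> is the linear map on the centre that
  sends the sum of each conjugacy class \<open>K\<close> to \<open>f K\<close>. Central elements are constant on classes,
  so the choice of representatives does not matter.
\<close>

definition class_ext ::
    "('g, 'm) monoid_scheme \<Rightarrow> ('g set \<Rightarrow> 'a::field) \<Rightarrow> ('g \<Rightarrow> 'a) \<Rightarrow> 'a" where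
  "class_ext G f z = (\<Sum>K\<in>conj_classes G. z (SOME x. x \<in> K) * f K)"

text \<open>Additivity and homogeneity are stated because \<open>f\<close> is only a function.\<close>

definition center_alg_hom :: "('g, 'm) monoid_scheme \<Rightarrow> (('g \<Rightarrow> 'a::field) \<Rightarrow> 'a) \<Rightarrow> bool" where
  "center_alg_hom G f \<longleftrightarrow>
     (\<forall>z\<in>ga_center G. \<forall>w\<in>ga_center G. f (\<lambda>x. z x + w x) = f z + f w) \<and>
     (\<forall>c. \<forall>z\<in>ga_center G. f (\<lambda>x. c * z x) = c * f z) \<and>
     (\<forall>z\<in>ga_center G. \<forall>w\<in>ga_center G. f (ga_mult G z w) = f z * f w) \<and>
     f (sum_of {\<one>\<^bsub>G\<^esub>}) = 1"


section \<open>Blocks\<close>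

definition central_idempotent :: "('g, 'm) monoid_scheme \<Rightarrow> ('g \<Rightarrow> 'a::field) \<Rightarrow> bool" where
  "central_idempotent G e \<longleftrightarrow> e \<in> ga_center G \<and> ga_mult G e e = e"

text \<open>
  A block of \<open>kG\<close> is represented by its block idempotent, a primitive idempotent of the centre
  of \<open>kG\<close>.
\<close>

definition blocks :: "('g, 'm) monoid_scheme \<Rightarrow> ('g \<Rightarrow> 'k::field) set" where
  "blocks G = {e. central_idempotent G e \<and> e \<noteq> (\<lambda>_. 0) \<and>
     (\<forall>f h. central_idempotent G f \<longrightarrow> central_idempotent G h \<longrightarrow>
        ga_mult G f h = (\<lambda>_. 0) \<longrightarrow> e = (\<lambda>x. f x + h x) \<longrightarrow>
        f = (\<lambda>_. 0) \<or> h = (\<lambda>_. 0))}"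

text \<open>
  \<open>modular_central_char G star \<chi>\<close> is the reduction modulo the maximal ideal of the central character
  \<open>\<omega>\<^sub>\<chi>\<close>. The irreducible character \<open>\<chi>\<close> belongs to the block \<open>e\<close> if \<open>\<omega>\<^sub>\<chi>\<close> takes the value \<open>1\<close>
  (rather than \<open>0\<close>) on the lift of \<open>e\<close> to \<open>\<O>G\<close>; this can be read off after reduction.
\<close>

definition modular_central_char ::
    "('g, 'm) monoid_scheme \<Rightarrow> ('K::field_char_0 \<Rightarrow> 'k::field) \<Rightarrow> ('g \<Rightarrow> 'K) \<Rightarrow> ('g \<Rightarrow> 'k) \<Rightarrow> 'k" where
  "modular_central_char G star \<chi> =
     class_ext G (\<lambda>K. star (of_nat (card K) * \<chi> (SOME g. g \<in> K) / \<chi> \<one>\<^bsub>G\<^esub>))"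

definition Irr_block ::
    "('g, 'm) monoid_scheme \<Rightarrow> ('K::field_char_0 \<Rightarrow> 'k::field) \<Rightarrow> ('g \<Rightarrow> 'k) \<Rightarrow> ('g \<Rightarrow> 'K) set" where
  "Irr_block G star B = {\<chi> \<in> Irr G. modular_central_char G star \<chi> B = 1}"

text \<open>The function \<open>\<lambda>\<^sub>B\<close>, computed from an arbitrary irreducible character in \<open>B\<close>.\<close>

definition block_char ::
    "('g, 'm) monoid_scheme \<Rightarrow> ('K::field_char_0 \<Rightarrow> 'k::field) \<Rightarrow> ('g \<Rightarrow> 'k) \<Rightarrow> ('g \<Rightarrow> 'k) \<Rightarrow> 'k" where
  "block_char G star B = modular_central_char G star (SOME \<chi>. \<chi> \<in> Irr_block G star B)"

text \<open>
  For a block \<open>b\<close> of a normal subgroup of \<open>G\<close>: the blocks \<open>B\<close> of \<open>G\<close> with \<open>B b \<noteq> 0\<close> in \<open>kG\<close>.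
\<close>

definition blocks_covering ::
    "('g, 'm) monoid_scheme \<Rightarrow> ('g \<Rightarrow> 'k::field) \<Rightarrow> ('g \<Rightarrow> 'k) set" where
  "blocks_covering G b = {B \<in> blocks G. ga_mult G B b \<noteq> (\<lambda>_. 0)}"


section \<open>Defect groups\<close>

definition ga_conj :: "('g, 'm) monoid_scheme \<Rightarrow> 'g \<Rightarrow> ('g \<Rightarrow> 'a::field) \<Rightarrow> 'g \<Rightarrow> 'a" where
  "ga_conj G t a = (\<lambda>x. if x \<in> carrier G then a (t \<otimes>\<^bsub>G\<^esub> x \<otimes>\<^bsub>G\<^esub> inv\<^bsub>G\<^esub> t) else 0)"

definition ga_fixed :: "('g, 'm) monoid_scheme \<Rightarrow> 'g set \<Rightarrow> ('g \<Rightarrow> 'a::field) set" where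
  "ga_fixed G D = {a \<in> group_algebra G. \<forall>d\<in>D. ga_conj G d a = a}"

text \<open>
  \<open>ga_conj G t a\<close> is \<open>t\<^sup>-\<^sup>1 a t\<close>, which for \<open>D\<close>-fixed \<open>a\<close> only depends on the right coset \<open>D t\<close>.
  So on \<open>ga_fixed G D\<close> the following is the relative trace map from \<open>D\<close> to \<open>G\<close>.
\<close>

definition rel_trace ::
    "('g, 'm) monoid_scheme \<Rightarrow> 'g set \<Rightarrow> ('g \<Rightarrow> 'a::field) \<Rightarrow> 'g \<Rightarrow> 'a" where
  "rel_trace G D a = (\<lambda>x. \<Sum>C\<in>rcosets\<^bsub>G\<^esub> D. ga_conj G (SOME t. t \<in> C) a x)"

definition rel_projective ::
    "('g, 'm) monoid_scheme \<Rightarrow> ('g \<Rightarrow> 'k::field) \<Rightarrow> 'g set \<Rightarrow> bool" where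
  "rel_projective G B D \<longleftrightarrow> B \<in> rel_trace G D ` ga_fixed G D"

text \<open>
  Defect groups are the minimal subgroups relative to which the block idempotent is a trace;
  such a subgroup is automatically a \<open>p\<close>-group.
\<close>

definition defect_group ::
    "('g, 'm) monoid_scheme \<Rightarrow> ('g \<Rightarrow> 'k::field) \<Rightarrow> 'g set \<Rightarrow> bool" where
  "defect_group G B D \<longleftrightarrow>
     subgroup D G \<and> rel_projective G B D \<and>
     (\<forall>Q. subgroup Q G \<longrightarrow> Q \<subset> D \<longrightarrow> \<not> rel_projective G B Q)"


section \<open>Block induction\<close>

definition induced_map ::
    "('g, 'm) monoid_scheme \<Rightarrow> ('K::field_char_0 \<Rightarrow> 'k::field) \<Rightarrow> 'g set \<Rightarrow> ('g \<Rightarrow> 'k) \<Rightarrow>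
     ('g \<Rightarrow> 'k) \<Rightarrow> 'k" where
  "induced_map G star H B' =
     class_ext G (\<lambda>K. block_char (G\<lparr>carrier := H\<rparr>) star B' (sum_of (K \<inter> H)))"

definition induced_block_defined ::
    "('g, 'm) monoid_scheme \<Rightarrow> ('K::field_char_0 \<Rightarrow> 'k::field) \<Rightarrow> 'g set \<Rightarrow> ('g \<Rightarrow> 'k) \<Rightarrow> bool" where
  "induced_block_defined G star H B' \<longleftrightarrow> center_alg_hom G (induced_map G star H B')"

definition induced_block ::
    "('g, 'm) monoid_scheme \<Rightarrow> ('K::field_char_0 \<Rightarrow> 'k::field) \<Rightarrow> 'g set \<Rightarrow> ('g \<Rightarrow> 'k) \<Rightarrow> 'g \<Rightarrow> 'k" where
  "induced_block G star H B' =
     (THE B. B \<in> blocks G \<and> (\<forall>z\<in>ga_center G. block_char G star B z = induced_map G star H B' z))"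

end

theory Submission
  imports Defs "HOL-Library.Function_Algebras"
begin

text \<open>
  A block of \<open>kG\<close> is the same thing as an algebra homomorphism \<open>Z(kG) \<rightarrow> k\<close> that comes from an
  ordinary character: every such homomorphism is \<open>1\<close> on exactly one block idempotent
  (\<open>ex_block_of_hom\<close>) and is determined by it, because \<open>B Z(kG)\<close> is a local ring
  (\<open>block_char_unique\<close>). Conversely every block idempotent \<open>B\<close> is \<open>1\<close> under some reduced central
  character (\<open>ex_character_in_block\<close>): otherwise a lift of \<open>B\<close> to \<open>Z(\<O>G)\<close> would act by
  scalars of the maximal ideal on all simple modules, a product of its translates by these
  scalars would be \<open>0\<close>, and reduction would make \<open>B\<close> nilpotent. Hence \<open>(B')\<^sup>G = B\<close> just means
  \<open>\<lambda>\<^sub>B = \<lambda>\<^bsub>B'\<^esub> \<circ> \<pi>\<^sub>H\<close>, where \<open>\<pi>\<^sub>H\<close> restricts functions on \<open>G\<close> to \<open>H\<close>, and the theorem concerns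
  the behaviour of \<open>\<pi>\<^sub>H\<close> with respect to products.

  For a block \<open>c\<close> of a normal subgroup \<open>X\<close> of \<open>S\<close>, consider the bilinear form
  \<open>(u, y) \<mapsto> \<lambda>\<^sub>c(\<pi>\<^sub>X(u y))\<close> on the algebra \<open>(kS)\<^sup>X\<close> of \<open>X\<close>-invariants. Its radical, \<open>trace_radical\<close>,
  is a right ideal, and the proof rests on two properties of it.

  \<^item> It contains no idempotent \<open>e\<close> with \<open>c e \<noteq> 0\<close> (\<open>radical_idempotent_zero\<close>). The algebra
  \<open>(kS)\<^sup>X\<close> is graded by the finite group \<open>S/X\<close>, the radical is a graded right ideal, and its component of
  degree \<open>1\<close> acts nilpotently on \<open>c\<close>. A long product of homogeneous factors revisits some degree
  again and again, and each return multiplies by an element of degree \<open>1\<close>.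

  \<^item> In the situation of the theorem, \<open>\<pi>\<^sub>H\<close> is multiplicative from \<open>(kG)\<^sup>N\<close> to \<open>(kH)\<^sup>M\<close> modulo
  the radical for \<open>b'\<close> (\<open>restriction_defect_in_radical\<close>). The error is a sum over the elements of
  \<open>G\<close> outside \<open>H\<close>, on which \<open>D\<close> acts by conjugation; as \<open>C\<^sub>G(D) \<subseteq> H\<close>, it has no fixed points
  there. Writing \<open>b'\<close> as a trace from \<open>D\<close>, each \<open>D\<close>-orbit contributes a trace from a proper subgroup
  of \<open>D\<close>, and \<open>\<lambda>\<^bsub>b'\<^esub>\<close> vanishes on such traces because \<open>D\<close> is minimal.

  If \<open>B'\<close> covers \<open>b'\<close>, then \<open>B' b' \<noteq> 0\<close> is an idempotent, so it is not in the radical, and \<open>\<lambda>\<^bsub>B'\<^esub>\<close>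
  vanishes on central elements of the radical (\<open>covering_block_vanishes_on_radical\<close>). Together with the
  second property this makes \<open>(B')\<^sup>G\<close> defined, and similarly \<open>b\<close>. Modulo the radical, \<open>\<pi>\<^sub>H(b)\<close> is a unit
  on \<open>b'\<close>, hence \<open>(B')\<^sup>G b \<noteq> 0\<close> (\<open>induced_block_covers\<close>). Finally let \<open>B\<close> cover \<open>b\<close>. If
  \<open>\<lambda>\<^bsub>B'\<^esub>(\<pi>\<^sub>H(B)) = 0\<close> for all \<open>B'\<close> covering \<open>b'\<close>, then \<open>\<pi>\<^sub>H(B)\<close> is nilpotent on \<open>b'\<close>, so it lies in
  the radical for \<open>b'\<close>, and \<open>B\<close> lies in the radical for \<open>b\<close>, contradicting \<open>B b \<noteq> 0\<close>
  (\<open>ex_covering_block\<close>). So \<open>\<lambda>\<^bsub>B'\<^esub>(\<pi>\<^sub>H(B)) = 1\<close> for some \<open>B'\<close>, and \<open>(B')\<^sup>G = B\<close>.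
\<close>

section \<open>Functions with values in a field\<close>

lemma sum_fun_apply: "(\<Sum>i\<in>I. f i) x = (\<Sum>i\<in>I. (f i x :: 'a::comm_monoid_add))"
  by (induction I rule: infinite_finite_induct) auto

definition smul :: "'a::field \<Rightarrow> ('g \<Rightarrow> 'a) \<Rightarrow> 'g \<Rightarrow> 'a" where
  "smul c a = (\<lambda>x. c * a x)"

definition restr :: "'g set \<Rightarrow> ('g \<Rightarrow> 'a::field) \<Rightarrow> 'g \<Rightarrow> 'a" where
  "restr S a = (\<lambda>x. if x \<in> S then a x else 0)"

definition supported :: "'g set \<Rightarrow> ('g \<Rightarrow> 'a::field) set" where
  "supported S = {a. \<forall>x. x \<notin> S \<longrightarrow> a x = 0}"

lemma smul_0 [simp]: "smul c 0 = 0" "smul 0 a = 0"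
  by (auto simp: smul_def fun_eq_iff)
lemma smul_1 [simp]: "smul 1 a = a"
  by (auto simp: smul_def fun_eq_iff)
lemma smul_smul [simp]: "smul c (smul d a) = smul (c * d) a"
  by (auto simp: smul_def fun_eq_iff)
lemma smul_add: "smul c (a + b) = smul c a + smul c b"
  by (auto simp: smul_def fun_eq_iff algebra_simps)
lemma smul_add_left: "smul (c + d) a = smul c a + smul d a"
  by (auto simp: smul_def fun_eq_iff algebra_simps)
lemma smul_sum: "smul c (\<Sum>i\<in>I. f i) = (\<Sum>i\<in>I. smul c (f i))"
  by (simp add: smul_def fun_eq_iff sum_fun_apply sum_distrib_left)

interpretation fun_space: vector_space "smul :: 'c::field \<Rightarrow> ('g \<Rightarrow> 'c) \<Rightarrow> 'g \<Rightarrow> 'c"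
  by unfold_locales (simp_all add: smul_add smul_add_left)

lemma subspace_supported: "fun_space.subspace (supported S)"
  by (auto simp: fun_space.subspace_def supported_def smul_def)

lemma restr_supported [simp]: "restr S a \<in> supported S"
  by (auto simp: supported_def restr_def)
lemma restr_id: "a \<in> supported S \<Longrightarrow> restr S a = a"
  by (auto simp: supported_def restr_def fun_eq_iff)
lemma restr_add: "restr S (a + b) = restr S a + restr S b"
  by (auto simp: restr_def fun_eq_iff)
lemma restr_diff: "restr S (a - b) = restr S a - restr S b"
  by (auto simp: restr_def fun_eq_iff)
lemma restr_smul: "restr S (smul c a) = smul c (restr S a)"
  by (auto simp: restr_def smul_def fun_eq_iff)
lemma restr_sum: "restr S (\<Sum>i\<in>I. f i) = (\<Sum>i\<in>I. restr S (f i))"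
  by (auto simp: restr_def fun_eq_iff sum_fun_apply)
lemma restr_restr: "restr S (restr T a) = restr (S \<inter> T) a"
  by (auto simp: restr_def fun_eq_iff)
lemma restr_0 [simp]: "restr S 0 = 0"
  by (auto simp: restr_def fun_eq_iff)
lemma supported_mono: "a \<in> supported S \<Longrightarrow> S \<subseteq> T \<Longrightarrow> a \<in> supported T"
  by (auto simp: supported_def)

lemma delta_sum:
  assumes "a \<in> supported S" "finite S"
  shows "a = (\<Sum>g\<in>S. smul (a g) (sum_of {g}))"
  using assms by (auto simp: fun_eq_iff sum_fun_apply smul_def sum_of_def supported_def
      if_distrib[of "\<lambda>t. _ * t"] sum.delta cong: if_cong)

lemma span_deltas:
  fixes S :: "'g set"
  assumes "finite S" shows "(supported S :: ('g \<Rightarrow> 'c::field) set) \<subseteq> fun_space.span ((\<lambda>g. sum_of {g}) ` S)"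
proof
  fix a :: "'g \<Rightarrow> 'c::field" assume a: "a \<in> supported S"
  have "a = (\<Sum>g\<in>S. smul (a g) (sum_of {g}))"
    by (rule delta_sum[OF a assms])
  moreover have "(\<Sum>g\<in>S. smul (a g) (sum_of {g})) \<in> fun_space.span ((\<lambda>g. sum_of {g}) ` S)"
    by (intro fun_space.span_sum fun_space.span_scale fun_space.span_base) auto
  ultimately show "a \<in> fun_space.span ((\<lambda>g. sum_of {g}) ` S)" by simp
qed

lemma finite_independent:
  assumes "finite S" "fun_space.independent B" "B \<subseteq> supported S"
  shows "finite B" "card B \<le> card S"
proof -
  have "finite B \<and> card B \<le> card ((\<lambda>g. sum_of {g} :: 'a \<Rightarrow> 'b) ` S)"
    using assms(2,3) span_deltas[OF assms(1)] by (intro fun_space.independent_span_bound finite_imageI assms(1)) auto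
  then show "finite B" "card B \<le> card S" using card_image_le[OF assms(1)] by (auto intro: le_trans)
qed

lemma dim_supported_le:
  assumes "finite S" "V \<subseteq> supported S" shows "fun_space.dim V \<le> card S"
proof -
  obtain B where "B \<subseteq> V" "fun_space.independent B" "card B = fun_space.dim V"
    using fun_space.basis_exists by metis
  then show ?thesis using finite_independent(2)[OF assms(1), of B] assms(2) by auto
qed

text \<open>
  Chains of subspaces of functions on a finite set become stationary. All finiteness arguments
  below pick a member of extremal dimension and apply this.
\<close>
lemma subspace_eq_if_dim_le:
  assumes fin: "finite S" and sub: "fun_space.subspace V"
    and VW: "V \<subseteq> W" and sup: "W \<subseteq> supported S" and dim: "fun_space.dim W \<le> fun_space.dim V"
  shows "V = W"
proof -
  obtain B where B: "B \<subseteq> V" "fun_space.independent B" "V \<subseteq> fun_space.span B" "card B = fun_space.dim V"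
    using fun_space.basis_exists by metis
  obtain C where C: "B \<subseteq> C" "C \<subseteq> W" "fun_space.independent C" "W \<subseteq> fun_space.span C"
    using fun_space.maximal_independent_subset_extend[of B W] B(1,2) VW by (metis subset_trans)
  have "finite C" using finite_independent(1)[OF fin C(3)] C sup by auto
  moreover have "card C = fun_space.dim W" using fun_space.basis_card_eq_dim[OF C(2,4,3)] .
  ultimately have "B = C" using card_seteq[of C B] C(1) B(4) dim by auto
  then have "W \<subseteq> fun_space.span B" using C by simp
  also have "\<dots> \<subseteq> V" using fun_space.span_minimal[OF B(1) sub] .
  finally show ?thesis using VW by auto
qed

section \<open>Convolution on a finite group\<close>

locale finite_group = group G for G (structure) +
  assumes finite_carrier [simp]: "finite (carrier G)"
begin

abbreviation conv :: "('a \<Rightarrow> 'c::field) \<Rightarrow> ('a \<Rightarrow> 'c) \<Rightarrow> 'a \<Rightarrow> 'c" (infixl "\<star>" 70) where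
  "a \<star> b \<equiv> ga_mult G a b"

abbreviation unit_ga :: "'a \<Rightarrow> 'c::field" ("\<epsilon>") where
  "\<epsilon> \<equiv> sum_of {\<one>}"

lemma inv_mult_cancel [simp]:
  "a \<in> carrier G \<Longrightarrow> x \<in> carrier G \<Longrightarrow> inv a \<otimes> (a \<otimes> x) = x"
  "a \<in> carrier G \<Longrightarrow> x \<in> carrier G \<Longrightarrow> a \<otimes> (inv a \<otimes> x) = x"
  by (simp_all add: m_assoc[symmetric])

lemma group_algebra_eq: "group_algebra G = supported (carrier G)"
  by (auto simp: group_algebra_def supported_def)

lemma conv_supported [simp]: "a \<star> b \<in> supported (carrier G)"
  by (auto simp: supported_def ga_mult_def)

lemma conv_apply: "x \<in> carrier G \<Longrightarrow> (a \<star> b) x = (\<Sum>y\<in>carrier G. a y * b (inv y \<otimes> x))"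
  by (simp add: ga_mult_def)

lemma conv_apply':
  assumes x: "x \<in> carrier G"
  shows "(a \<star> b) x = (\<Sum>y\<in>carrier G. a (x \<otimes> inv y) * b y)"
proof -
  have "(\<Sum>y\<in>carrier G. a y * b (inv y \<otimes> x)) = (\<Sum>y\<in>carrier G. a (x \<otimes> inv y) * b y)"
    by (rule sum.reindex_bij_witness[of _ "\<lambda>y. x \<otimes> inv y" "\<lambda>y. inv y \<otimes> x"])
       (use x in \<open>auto simp: inv_mult_group m_assoc[symmetric] intro: l_inv_ex\<close>,
        simp_all add: m_assoc)
  then show ?thesis by (simp add: conv_apply[OF x])
qed

text \<open>
  The convolution only reads values on the group, so this and the linearity laws hold for
  arbitrary functions. Only the unit laws require the support to lie in the group.
\<close>
lemma conv_assoc: "(a \<star> b) \<star> c = a \<star> (b \<star> c)"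
proof
  fix x
  show "((a \<star> b) \<star> c) x = (a \<star> (b \<star> c)) x"
  proof (cases "x \<in> carrier G")
    case True
    have "((a \<star> b) \<star> c) x = (\<Sum>z\<in>carrier G. \<Sum>y\<in>carrier G. a y * b (inv y \<otimes> z) * c (inv z \<otimes> x))"
      using True by (simp add: conv_apply sum_distrib_right)
    also have "\<dots> = (\<Sum>y\<in>carrier G. \<Sum>z\<in>carrier G. a y * b (inv y \<otimes> z) * c (inv z \<otimes> x))"
      by (rule sum.swap)
    also have "\<dots> = (\<Sum>y\<in>carrier G. \<Sum>w\<in>carrier G. a y * (b w * c (inv w \<otimes> (inv y \<otimes> x))))"
    proof (rule sum.cong[OF refl])
      fix y assume y: "y \<in> carrier G"
      show "(\<Sum>z\<in>carrier G. a y * b (inv y \<otimes> z) * c (inv z \<otimes> x)) =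
            (\<Sum>w\<in>carrier G. a y * (b w * c (inv w \<otimes> (inv y \<otimes> x))))"
        by (rule sum.reindex_bij_witness[of _ "\<lambda>w. y \<otimes> w" "\<lambda>z. inv y \<otimes> z"])
           (use y True in \<open>simp_all add: m_assoc[symmetric] inv_mult_group mult.assoc\<close>,
            simp_all add: m_assoc)
    qed
    also have "\<dots> = (a \<star> (b \<star> c)) x"
      using True by (simp add: conv_apply sum_distrib_left)
    finally show ?thesis .
  next
    case False then show ?thesis by (simp add: ga_mult_def)
  qed
qed

lemma conv_add_left: "(a + b) \<star> c = a \<star> c + b \<star> c"
  by (auto simp: ga_mult_def fun_eq_iff sum.distrib algebra_simps)
lemma conv_add_right: "c \<star> (a + b) = c \<star> a + c \<star> b"
  by (auto simp: ga_mult_def fun_eq_iff sum.distrib algebra_simps)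
lemma conv_diff_left: "(a - b) \<star> c = a \<star> c - b \<star> c"
  by (auto simp: ga_mult_def fun_eq_iff sum_subtractf algebra_simps)
lemma conv_diff_right: "c \<star> (a - b) = c \<star> a - c \<star> b"
  by (auto simp: ga_mult_def fun_eq_iff sum_subtractf algebra_simps)
lemma conv_smul_left [simp]: "smul d a \<star> c = smul d (a \<star> c)"
  by (auto simp: ga_mult_def fun_eq_iff smul_def sum_distrib_left algebra_simps)
lemma conv_smul_right [simp]: "c \<star> smul d a = smul d (c \<star> a)"
  by (auto simp: ga_mult_def fun_eq_iff smul_def sum_distrib_left algebra_simps)
lemma conv_0 [simp]: "0 \<star> c = 0" "c \<star> 0 = 0"
  by (auto simp: ga_mult_def fun_eq_iff)
lemma conv_sum_left: "(\<Sum>i\<in>I. f i) \<star> c = (\<Sum>i\<in>I. f i \<star> c)"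
  by (auto simp: ga_mult_def fun_eq_iff sum_fun_apply sum_distrib_right intro: sum.swap)
lemma conv_sum_right: "c \<star> (\<Sum>i\<in>I. f i) = (\<Sum>i\<in>I. c \<star> f i)"
  by (auto simp: ga_mult_def fun_eq_iff sum_fun_apply sum_distrib_left intro: sum.swap)

lemma subspace_conv_image:
  assumes V: "fun_space.subspace V" shows "fun_space.subspace ((\<star>) a ` V)"
  unfolding fun_space.subspace_def
proof (intro conjI ballI allI)
  show "0 \<in> (\<star>) a ` V" by (rule image_eqI[of _ _ 0]) (auto simp: fun_space.subspace_0[OF V])
  fix u w assume "u \<in> (\<star>) a ` V" "w \<in> (\<star>) a ` V"
  then show "u + w \<in> (\<star>) a ` V"
    by (auto simp: conv_add_right[symmetric] intro!: imageI fun_space.subspace_add[OF V])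
next
  fix c w assume "w \<in> (\<star>) a ` V"
  then show "smul c w \<in> (\<star>) a ` V"
    by (auto simp: conv_smul_right[symmetric] simp del: conv_smul_right intro!: imageI fun_space.subspace_scale[OF V])
qed

lemma delta_conv:
  assumes "g \<in> carrier G"
  shows "(sum_of {g} \<star> a) x = (if x \<in> carrier G then a (inv g \<otimes> x) else 0)"
  using assms by (auto simp: ga_mult_def sum_of_def if_distrib[of "\<lambda>t. t * _"] sum.delta cong: if_cong)

lemma conv_delta:
  assumes "g \<in> carrier G"
  shows "(a \<star> sum_of {g}) x = (if x \<in> carrier G then a (x \<otimes> inv g) else 0)"
  using assms conv_apply'[of x a "sum_of {g}"]
  by (cases "x \<in> carrier G") (auto simp: sum_of_def ga_mult_def if_distrib[of "\<lambda>t. _ * t"] sum.delta cong: if_cong)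

lemma delta_delta: "g \<in> carrier G \<Longrightarrow> h \<in> carrier G \<Longrightarrow> sum_of {g} \<star> sum_of {h} = sum_of {g \<otimes> h}"
  using inv_solve_left[of h g] by (simp add: fun_eq_iff delta_conv) (auto simp: sum_of_def m_assoc[symmetric])

lemma unit_conv: "\<epsilon> \<star> a = restr (carrier G) a"
  by (auto simp: fun_eq_iff delta_conv restr_def)
lemma conv_unit: "a \<star> \<epsilon> = restr (carrier G) a"
  by (auto simp: fun_eq_iff conv_delta restr_def)

lemma unit_conv' [simp]: "a \<in> supported (carrier G) \<Longrightarrow> \<epsilon> \<star> a = a"
  by (simp add: unit_conv restr_id)
lemma conv_unit' [simp]: "a \<in> supported (carrier G) \<Longrightarrow> a \<star> \<epsilon> = a"
  by (simp add: conv_unit restr_id)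

lemma unit_supported: "subgroup S G \<Longrightarrow> \<epsilon> \<in> supported S"
  by (auto simp: supported_def sum_of_def subgroup.one_closed)

lemma conv_expand:
  assumes "a \<in> supported S" "S \<subseteq> carrier G"
  shows "a \<star> b = (\<Sum>g\<in>S. smul (a g) (sum_of {g} \<star> b))"
proof -
  have "finite S" using assms(2) finite_carrier finite_subset by blast
  have "a \<star> b = (\<Sum>g\<in>S. smul (a g) (sum_of {g})) \<star> b"
    using delta_sum[OF assms(1) \<open>finite S\<close>] by simp
  then show ?thesis by (simp add: conv_sum_left)
qed

lemma conv_sub_supported:
  assumes S: "subgroup S G" and "a \<in> supported S" "b \<in> supported S"
  shows "a \<star> b \<in> supported S"
  unfolding supported_def
proof safe
  fix x assume x: "x \<notin> S"
  show "(a \<star> b) x = 0"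
  proof (cases "x \<in> carrier G")
    case True
    have "a y * b (inv y \<otimes> x) = 0" if y: "y \<in> carrier G" for y
    proof (cases "y \<in> S")
      case True
      then have "inv y \<otimes> x \<notin> S"
        using x S \<open>x \<in> carrier G\<close> y subgroup.m_closed[OF S, of y "inv y \<otimes> x"]
        by (auto simp: m_assoc[symmetric])
      then show ?thesis using assms by (simp add: supported_def)
    qed (use assms in \<open>simp add: supported_def\<close>)
    then show ?thesis unfolding conv_apply[OF True] by (intro sum.neutral) simp
  qed (simp add: ga_mult_def)
qed

section \<open>Invariants under conjugation\<close>

text \<open>
  The algebra \<open>(kS)\<^sup>X\<close>, also the centraliser of \<open>kX\<close> in \<open>kS\<close>. For \<open>X = S\<close> it is the centre of \<open>kS\<close>.
  Quantifying \<open>x\<close> over all of \<open>G\<close> lets invariants of different subgroups be compared directly.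
\<close>
definition invariants :: "'a set \<Rightarrow> 'a set \<Rightarrow> ('a \<Rightarrow> 'c::field) set" where
  "invariants S X = {a \<in> supported S. \<forall>n\<in>X. \<forall>x\<in>carrier G. a (n \<otimes> x \<otimes> inv n) = a x}"

lemma invariants_supported: "a \<in> invariants S X \<Longrightarrow> a \<in> supported S"
  by (simp add: invariants_def)

lemma subspace_invariants: "fun_space.subspace (invariants S X)"
  by (auto simp: fun_space.subspace_def invariants_def supported_def smul_def)

lemma invariants_0 [simp]: "0 \<in> invariants S X"
  and invariants_add: "a \<in> invariants S X \<Longrightarrow> b \<in> invariants S X \<Longrightarrow> a + b \<in> invariants S X"
  and invariants_smul: "a \<in> invariants S X \<Longrightarrow> smul c a \<in> invariants S X"
  using subspace_invariants[of S X] unfolding fun_space.subspace_def by blast+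

lemma invariants_diff: "a \<in> invariants S X \<Longrightarrow> b \<in> invariants S X \<Longrightarrow> a - b \<in> invariants S X"
  by (rule fun_space.subspace_diff[OF subspace_invariants])

lemma invariants_mono: "a \<in> invariants S X \<Longrightarrow> S \<subseteq> T \<Longrightarrow> Y \<subseteq> X \<Longrightarrow> a \<in> invariants T Y"
  by (auto simp: invariants_def supported_def)

lemma conj_closed: "g \<in> carrier G \<Longrightarrow> x \<in> carrier G \<Longrightarrow> g \<otimes> x \<otimes> inv g \<in> carrier G"
  by simp

lemma conj_cancel: "n \<in> carrier G \<Longrightarrow> x \<in> carrier G \<Longrightarrow> inv n \<otimes> (n \<otimes> x \<otimes> inv n) \<otimes> n = x"
  by (simp add: m_assoc)

lemma conj_cancel': "n \<in> carrier G \<Longrightarrow> x \<in> carrier G \<Longrightarrow> n \<otimes> (inv n \<otimes> x \<otimes> n) \<otimes> inv n = x"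
  by (simp add: m_assoc)

lemma conj_conv:
  assumes n: "n \<in> carrier G" and x: "x \<in> carrier G"
  shows "(a \<star> b) (n \<otimes> x \<otimes> inv n) =
    ((\<lambda>x. a (n \<otimes> x \<otimes> inv n)) \<star> (\<lambda>x. b (n \<otimes> x \<otimes> inv n))) x"
proof -
  have "(a \<star> b) (n \<otimes> x \<otimes> inv n) = (\<Sum>y\<in>carrier G. a y * b (inv y \<otimes> (n \<otimes> x \<otimes> inv n)))"
    using n x by (simp add: conv_apply)
  also have "\<dots> = (\<Sum>y\<in>carrier G. a (n \<otimes> y \<otimes> inv n) * b (n \<otimes> (inv y \<otimes> x) \<otimes> inv n))"
  proof (rule sum.reindex_bij_witness[of _ "\<lambda>y. n \<otimes> y \<otimes> inv n" "\<lambda>y. inv n \<otimes> y \<otimes> n"])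
    fix y assume y: "y \<in> carrier G"
    show "n \<otimes> (inv n \<otimes> y \<otimes> n) \<otimes> inv n = y" using n y by (rule conj_cancel')
    show "inv n \<otimes> (n \<otimes> y \<otimes> inv n) \<otimes> n = y" using n y by (rule conj_cancel)
    have "n \<otimes> (inv (inv n \<otimes> y \<otimes> n) \<otimes> x) \<otimes> inv n = inv y \<otimes> (n \<otimes> x \<otimes> inv n)"
      using n x y by (simp add: inv_mult_group m_assoc)
    then show "a (n \<otimes> (inv n \<otimes> y \<otimes> n) \<otimes> inv n) * b (n \<otimes> (inv (inv n \<otimes> y \<otimes> n) \<otimes> x) \<otimes> inv n) =
         a y * b (inv y \<otimes> (n \<otimes> x \<otimes> inv n))" using conj_cancel'[OF n y] by simp
  qed (use n in auto)
  also have "\<dots> = ((\<lambda>x. a (n \<otimes> x \<otimes> inv n)) \<star> (\<lambda>x. b (n \<otimes> x \<otimes> inv n))) x"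
    using x by (simp add: conv_apply)
  finally show ?thesis .
qed

lemma invariants_conv:
  assumes S: "subgroup S G" and X: "X \<subseteq> carrier G"
    and a: "a \<in> invariants S X" and b: "b \<in> invariants S X"
  shows "a \<star> b \<in> invariants S X"
proof -
  have "(a \<star> b) (n \<otimes> x \<otimes> inv n) = (a \<star> b) x" if n: "n \<in> X" and x: "x \<in> carrier G" for n x
  proof -
    have nG: "n \<in> carrier G" using X n by auto
    have "(a \<star> b) (n \<otimes> x \<otimes> inv n) = (\<Sum>y\<in>carrier G. a (n \<otimes> y \<otimes> inv n) * b (n \<otimes> (inv y \<otimes> x) \<otimes> inv n))"
      unfolding conj_conv[OF nG x] using x by (simp add: conv_apply)
    also have "\<dots> = (\<Sum>y\<in>carrier G. a y * b (inv y \<otimes> x))"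
      using a b n x by (intro sum.cong) (auto simp: invariants_def)
    finally show ?thesis using x by (simp add: conv_apply)
  qed
  moreover have "a \<star> b \<in> supported S" using conv_sub_supported[OF S] a b by (auto simp: invariants_def)
  ultimately show ?thesis by (simp add: invariants_def)
qed

lemma invariants_unit:
  assumes "subgroup S G" "X \<subseteq> carrier G" shows "\<epsilon> \<in> invariants S X"
proof -
  have "(n \<otimes> x \<otimes> inv n = \<one>) = (x = \<one>)" if "n \<in> carrier G" "x \<in> carrier G" for n x
    using that by (metis conj_cancel conj_closed inv_closed l_inv r_inv r_one m_closed m_assoc)
  then show ?thesis using assms unit_supported[OF assms(1)]
    by (auto simp: invariants_def sum_of_def)
qed

lemma invariants_commute:
  assumes X: "X \<subseteq> carrier G" and S: "S \<subseteq> carrier G" and a: "a \<in> invariants S X" and m: "m \<in> supported X"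
  shows "a \<star> m = m \<star> a"
proof
  fix x show "(a \<star> m) x = (m \<star> a) x"
  proof (cases "x \<in> carrier G")
    case True
    have "a (x \<otimes> inv y) * m y = m y * a (inv y \<otimes> x)" if y: "y \<in> carrier G" for y
    proof (cases "y \<in> X")
      case yX: True
      have "a (y \<otimes> (inv y \<otimes> x) \<otimes> inv y) = a (inv y \<otimes> x)"
        using a yX m_closed[OF inv_closed[OF y] True] unfolding invariants_def by blast
      moreover have "y \<otimes> (inv y \<otimes> x) \<otimes> inv y = x \<otimes> inv y" using True y by (simp add: m_assoc[symmetric])
      ultimately show ?thesis by (simp add: mult.commute)
    qed (use m in \<open>simp add: supported_def\<close>)
    then show ?thesis unfolding conv_apply'[OF True, of a m] conv_apply[OF True, of m a] by (intro sum.cong) auto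
  qed (simp add: ga_mult_def)
qed

lemma invariants_if_commute:
  assumes a: "a \<in> supported (carrier G)" and X: "X \<subseteq> carrier G"
    and comm: "\<And>n. n \<in> X \<Longrightarrow> a \<star> sum_of {n} = sum_of {n} \<star> a"
  shows "a \<in> invariants (carrier G) X"
proof -
  have "a (n \<otimes> x \<otimes> inv n) = a x" if "n \<in> X" "x \<in> carrier G" for n x
  proof -
    have n: "n \<in> carrier G" using X that by auto
    have "(a \<star> sum_of {n}) (n \<otimes> x) = (sum_of {n} \<star> a) (n \<otimes> x)" using comm that by simp
    then show ?thesis using n that by (simp add: conv_delta delta_conv m_assoc[symmetric])
  qed
  then show ?thesis using a by (simp add: invariants_def)
qed

lemma ga_center_eq: "ga_center G = invariants (carrier G) (carrier G)"
proof (intro equalityI subsetI)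
  fix a :: "'a \<Rightarrow> 'c" assume "a \<in> ga_center G"
  then show "a \<in> invariants (carrier G) (carrier G)"
    by (intro invariants_if_commute) (auto simp: ga_center_def group_algebra_eq supported_def sum_of_def)
next
  fix a :: "'a \<Rightarrow> 'c" assume "a \<in> invariants (carrier G) (carrier G)"
  then show "a \<in> ga_center G"
    using invariants_commute[of "carrier G" "carrier G" a]
    by (auto simp: ga_center_def group_algebra_eq invariants_supported)
qed

lemma center_add: "a \<in> ga_center G \<Longrightarrow> b \<in> ga_center G \<Longrightarrow> a + b \<in> ga_center G"
  and center_diff: "a \<in> ga_center G \<Longrightarrow> b \<in> ga_center G \<Longrightarrow> a - b \<in> ga_center G"
  and center_smul: "a \<in> ga_center G \<Longrightarrow> smul c a \<in> ga_center G"
  and center_0 [simp]: "0 \<in> ga_center G"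
  and center_unit [simp]: "\<epsilon> \<in> ga_center G"
  and center_conv: "a \<in> ga_center G \<Longrightarrow> b \<in> ga_center G \<Longrightarrow> a \<star> b \<in> ga_center G"
  and center_supported: "a \<in> ga_center G \<Longrightarrow> a \<in> supported (carrier G)"
  and subspace_center: "fun_space.subspace (ga_center G)"
  unfolding ga_center_eq
  by (auto intro: invariants_add invariants_diff invariants_smul invariants_unit invariants_conv
      subgroup_self invariants_supported subspace_invariants)

lemma center_commute: "z \<in> ga_center G \<Longrightarrow> z \<star> a = a \<star> z"
proof -
  assume z: "z \<in> ga_center G"
  have "a \<star> z = restr (carrier G) a \<star> z" "z \<star> a = z \<star> restr (carrier G) a"
    by (auto simp: ga_mult_def restr_def fun_eq_iff intro!: sum.cong)
  then show ?thesis using z by (simp add: ga_center_def group_algebra_eq)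
qed

primrec ga_pow :: "('a \<Rightarrow> 'c::field) \<Rightarrow> nat \<Rightarrow> 'a \<Rightarrow> 'c" where
  "ga_pow a 0 = \<epsilon>"
| "ga_pow a (Suc n) = ga_pow a n \<star> a"

lemma ga_pow_add: "ga_pow a (m + n) = ga_pow a m \<star> ga_pow a n"
  by (induction n) (auto simp: conv_assoc[symmetric] conv_unit restr_id unit_supported[OF subgroup_self],
      cases m, auto simp: restr_id unit_supported[OF subgroup_self])

lemma ga_pow_invariants: "subgroup S G \<Longrightarrow> X \<subseteq> carrier G \<Longrightarrow> a \<in> invariants S X \<Longrightarrow> ga_pow a n \<in> invariants S X"
  by (induction n) (auto intro: invariants_unit invariants_conv)

lemma ga_pow_center: "a \<in> ga_center G \<Longrightarrow> ga_pow a n \<in> ga_center G"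
  by (induction n) (auto intro: center_conv)

end

lemma zero_fun_eq: "(\<lambda>_. 0) = 0"
  by (simp add: zero_fun_def)

section \<open>Blocks and homomorphisms of the centre\<close>

context finite_group
begin

lemma hom_add: "center_alg_hom G \<phi> \<Longrightarrow> z \<in> ga_center G \<Longrightarrow> w \<in> ga_center G \<Longrightarrow> \<phi> (z + w) = \<phi> z + \<phi> w"
  by (simp add: center_alg_hom_def plus_fun_def)
lemma hom_smul: "center_alg_hom G \<phi> \<Longrightarrow> z \<in> ga_center G \<Longrightarrow> \<phi> (smul c z) = c * \<phi> z"
  by (simp add: center_alg_hom_def smul_def)
lemma hom_mult: "center_alg_hom G \<phi> \<Longrightarrow> z \<in> ga_center G \<Longrightarrow> w \<in> ga_center G \<Longrightarrow> \<phi> (z \<star> w) = \<phi> z * \<phi> w"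
  by (simp add: center_alg_hom_def)
lemma hom_unit: "center_alg_hom G \<phi> \<Longrightarrow> \<phi> \<epsilon> = 1"
  by (simp add: center_alg_hom_def)
lemma hom_0: "center_alg_hom G \<phi> \<Longrightarrow> \<phi> 0 = 0"
  using hom_smul[of \<phi> 0 0] by simp
lemma hom_diff: "center_alg_hom G \<phi> \<Longrightarrow> z \<in> ga_center G \<Longrightarrow> w \<in> ga_center G \<Longrightarrow> \<phi> (z - w) = \<phi> z - \<phi> w"
  using hom_add[of \<phi> "z - w" w] by (simp add: center_diff)
lemma hom_sum: "center_alg_hom G \<phi> \<Longrightarrow> (\<And>i. i \<in> I \<Longrightarrow> f i \<in> ga_center G) \<Longrightarrow> \<phi> (\<Sum>i\<in>I. f i) = (\<Sum>i\<in>I. \<phi> (f i))"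
proof (induction I rule: infinite_finite_induct)
  case (insert x F)
  then have "(\<Sum>i\<in>F. f i) \<in> ga_center G" by (intro fun_space.subspace_sum[OF subspace_center]) auto
  then have "\<phi> (f x + (\<Sum>i\<in>F. f i)) = \<phi> (f x) + (\<Sum>i\<in>F. \<phi> (f i))" using insert by (subst hom_add) auto
  then show ?case unfolding sum.insert[OF insert(1,2)] .
qed (simp_all add: hom_0)
lemma hom_pow: "center_alg_hom G \<phi> \<Longrightarrow> z \<in> ga_center G \<Longrightarrow> \<phi> (ga_pow z n) = \<phi> z ^ n"
  by (induction n) (simp_all add: hom_unit hom_mult ga_pow_center)
lemma hom_idem:
  assumes "center_alg_hom G \<phi>" "e \<in> ga_center G" "e \<star> e = e"
  shows "\<phi> e = 0 \<or> \<phi> e = 1"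
proof -
  have "\<phi> e * \<phi> e = \<phi> e" using hom_mult[OF assms(1,2,2)] assms(3) by simp
  then show ?thesis by (metis mult_cancel_right2)
qed

text \<open>
  The ideals generated by the powers of \<open>z\<close> decrease, so one of them is generated by all higher
  powers as well. A positive exponent makes the result informative, since the power with exponent
  \<open>0\<close> is the unit.
\<close>
lemma fitting:
  assumes z: "z \<in> ga_center G"
  shows "\<exists>n>0. \<exists>y\<in>ga_center G. ga_pow z n = ga_pow z n \<star> ga_pow z n \<star> y"
proof -
  define V where "V n = (\<star>) (ga_pow z n) ` ga_center G" for n
  obtain n where n: "\<And>m. fun_space.dim (V n) \<le> fun_space.dim (V m)"
    using ex_has_least_nat[of "\<lambda>_. True" 0 "\<lambda>n. fun_space.dim (V n)"] by auto
  have sub: "fun_space.subspace (V m)" for m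
    unfolding V_def by (rule subspace_conv_image[OF subspace_center])
  have eq: "V (n + m) = V n" for m
  proof -
    have "V (n + m) \<subseteq> V n"
      unfolding V_def by (auto simp: ga_pow_add conv_assoc intro!: imageI center_conv ga_pow_center z)
    moreover have "V n \<subseteq> supported (carrier G)" by (auto simp: V_def)
    ultimately show ?thesis
      by (intro subspace_eq_if_dim_le[of "carrier G"] sub n) auto
  qed
  have "ga_pow z (Suc n) \<in> V (Suc n)"
    unfolding V_def by (rule image_eqI[of _ _ \<epsilon>]) (auto simp: center_supported ga_pow_center z simp del: ga_pow.simps)
  moreover have "V (Suc n) = V (Suc n + Suc n)" using eq[of 1] eq[of "n + 2"] by simp
  ultimately have "ga_pow z (Suc n) \<in> V (Suc n + Suc n)" by simp
  then have "\<exists>y\<in>ga_center G. ga_pow z (Suc n) = ga_pow z (Suc n) \<star> ga_pow z (Suc n) \<star> y"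
    unfolding V_def ga_pow_add[of z "Suc n" "Suc n"] by blast
  then show ?thesis by blast
qed

text \<open>
  The idempotent \<open>f\<close> separates the part of the centre on which \<open>z\<close> is invertible (cut out by \<open>f\<close>) from
  the part on which it is nilpotent.
\<close>
lemma fitting_idempotent:
  assumes z: "z \<in> ga_center G"
  obtains n y f where "n > 0" "y \<in> ga_center G" "f = ga_pow z n \<star> y" "f \<in> ga_center G" "f \<star> f = f" "ga_pow z n \<star> f = ga_pow z n"
proof -
  from fitting[OF z] obtain n y where y: "n > 0" "y \<in> ga_center G" "ga_pow z n = ga_pow z n \<star> ga_pow z n \<star> y" by auto
  define f where "f = ga_pow z n \<star> y"
  have zn: "ga_pow z n \<in> ga_center G" by (rule ga_pow_center[OF z])
  have "ga_pow z n \<star> f = ga_pow z n" using y(3) by (simp add: f_def conv_assoc)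
  moreover have "f \<star> f = f"
  proof -
    have "f \<star> f = ga_pow z n \<star> (y \<star> f)" by (simp add: f_def conv_assoc)
    also have "y \<star> f = f \<star> y" using y by (simp add: center_commute)
    also have "ga_pow z n \<star> (f \<star> y) = (ga_pow z n \<star> f) \<star> y" by (simp add: conv_assoc)
    also have "\<dots> = f" by (simp only: \<open>ga_pow z n \<star> f = ga_pow z n\<close> f_def[symmetric])
    finally show ?thesis .
  qed
  ultimately show ?thesis using that[OF y(1,2) f_def] zn y by (auto simp: f_def intro: center_conv)
qed

lemma blockD:
  assumes "B \<in> blocks G"
  shows "B \<in> ga_center G" "B \<star> B = B" "B \<noteq> 0"
    and "\<And>f. f \<in> ga_center G \<Longrightarrow> f \<star> f = f \<Longrightarrow> f \<star> B = f \<Longrightarrow> f = 0 \<or> f = B"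
proof -
  show B: "B \<in> ga_center G" "B \<star> B = B" "B \<noteq> 0"
    using assms by (auto simp: blocks_def central_idempotent_def zero_fun_eq)
  fix f assume f: "f \<in> ga_center G" "f \<star> f = f" "f \<star> B = f"
  have "B \<star> f = f" using f B center_commute by metis
  then have "(B - f) \<star> (B - f) = B - f" "f \<star> (B - f) = 0"
    by (simp_all add: conv_diff_left conv_diff_right B f)
  moreover have "B = (\<lambda>x. f x + (B - f) x)" by auto
  ultimately have "f = 0 \<or> B - f = 0"
    using assms f center_diff[OF B(1) f(1)] unfolding blocks_def central_idempotent_def zero_fun_eq by blast
  then show "f = 0 \<or> f = B" by auto
qed

text \<open>
  \<open>B Z(kG)\<close> is local: by primitivity, the Fitting idempotent of \<open>z\<close> multiplies \<open>B\<close> to \<open>0\<close> or to \<open>B\<close>.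
\<close>
lemma block_nilpotent_or_unit:
  assumes B: "B \<in> blocks G" and z: "z \<in> ga_center G"
  shows "(\<exists>n. ga_pow z n \<star> B = 0) \<or> (\<exists>y\<in>ga_center G. z \<star> y = B)"
proof -
  from fitting_idempotent[OF z] obtain n y f where n: "n > 0" and f: "y \<in> ga_center G" "f = ga_pow z n \<star> y"
    "f \<in> ga_center G" "f \<star> f = f" "ga_pow z n \<star> f = ga_pow z n" by blast
  note B' = blockD(1-3)[OF B]
  have comm: "f \<star> B = B \<star> f" using center_commute f by blast
  have "f \<star> B \<star> (f \<star> B) = f \<star> B" by (metis comm conv_assoc f(4) B'(2))
  moreover have "f \<star> B \<star> B = f \<star> B" by (simp add: conv_assoc B')
  ultimately have "f \<star> B = 0 \<or> f \<star> B = B"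
    using blockD(4)[OF B, of "f \<star> B"] f B' center_conv by blast
  then show ?thesis
  proof
    assume "f \<star> B = 0"
    then have "ga_pow z n \<star> B = 0" using f(5) by (metis conv_assoc conv_0(2))
    then show ?thesis by blast
  next
    assume fB: "f \<star> B = B"
    show ?thesis
    proof (cases n)
      case 0 then show ?thesis using n by simp
    next
      case (Suc m)
      have "z \<star> (ga_pow z m \<star> y \<star> B) = B"
      proof -
        have "z \<star> (ga_pow z m \<star> y \<star> B) = (z \<star> ga_pow z m) \<star> y \<star> B" by (simp add: conv_assoc)
        also have "z \<star> ga_pow z m = ga_pow z n" using Suc center_commute[OF z, of "ga_pow z m"] by simp
        finally show ?thesis using f fB by simp
      qed
      then show ?thesis using z f B' by (blast intro: center_conv ga_pow_center)
    qed
  qed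
qed

lemma block_kernel_nilpotent:
  assumes B: "B \<in> blocks G" and \<phi>: "center_alg_hom G \<phi>" "\<phi> B = 1" and z: "z \<in> ga_center G" "\<phi> z = 0"
  shows "\<exists>n. ga_pow z n \<star> B = 0"
proof -
  have False if y: "y \<in> ga_center G" "z \<star> y = B" for y
    using hom_mult[OF \<phi>(1) z(1) y(1)] y z \<phi> by simp
  then show ?thesis using block_nilpotent_or_unit[OF B z(1)] by blast
qed

lemma block_unit:
  assumes B: "B \<in> blocks G" and \<phi>: "center_alg_hom G \<phi>" "\<phi> B = 1" and z: "z \<in> ga_center G" "\<phi> z \<noteq> 0"
  shows "\<exists>y\<in>ga_center G. z \<star> y = B"
proof -
  have False if "ga_pow z n \<star> B = 0" for n
    using hom_mult[OF \<phi>(1) ga_pow_center[OF z(1)] blockD(1)[OF B], of n] hom_pow[OF \<phi>(1) z(1)] that z \<phi>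
    by (simp add: hom_0)
  then show ?thesis using block_nilpotent_or_unit[OF B z(1)] by blast
qed

lemma block_char_unique:
  assumes B: "B \<in> blocks G" and \<phi>: "center_alg_hom G \<phi>" "\<phi> B = 1" and \<psi>: "center_alg_hom G \<psi>" "\<psi> B = 1"
    and z: "z \<in> ga_center G"
  shows "\<phi> z = \<psi> z"
proof -
  define u where "u = z - smul (\<phi> z) \<epsilon>"
  have u: "u \<in> ga_center G" by (auto simp: u_def intro!: center_diff center_smul z)
  have "\<nu> u = \<nu> z - \<phi> z" if "center_alg_hom G \<nu>" for \<nu>
    using that by (simp add: u_def hom_diff center_smul z hom_smul hom_unit)
  from this[OF \<phi>(1)] this[OF \<psi>(1)] have lu: "\<phi> u = 0" and mu: "\<psi> u = \<psi> z - \<phi> z" by auto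
  have "\<psi> u = 0"
  proof (rule ccontr)
    assume "\<psi> u \<noteq> 0"
    from block_unit[OF B \<psi> u this] obtain y where y: "y \<in> ga_center G" "u \<star> y = B" by auto
    show False using hom_mult[OF \<phi>(1) u y(1)] y lu \<phi> by simp
  qed
  then show ?thesis using mu by simp
qed

text \<open>
  A descent to a primitive idempotent that keeps a property inherited by one of the two summands in
  each orthogonal decomposition. It is used with non-vanishing under a homomorphism and with
  non-vanishing of the product with a fixed element. An idempotent with smallest ideal will do.
\<close>
lemma primitive_refinement:
  fixes P :: "('a \<Rightarrow> 'c::field) \<Rightarrow> bool"
  assumes e: "e \<in> ga_center G" "e \<star> e = e" "P e"
    and P0: "\<not> P 0"
    and Padd: "\<And>f h. f \<in> ga_center G \<Longrightarrow> f \<star> f = f \<Longrightarrow> h \<in> ga_center G \<Longrightarrow> h \<star> h = h \<Longrightarrow> P (f + h) \<Longrightarrow> P f \<or> P h"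
  shows "\<exists>B\<in>blocks G. B \<star> e = B \<and> P B"
proof -
  define I where "I = {f \<in> ga_center G. f \<star> f = f \<and> f \<star> e = f \<and> P f}"
  define V where "V f = (\<star>) f ` ga_center G" for f :: "'a \<Rightarrow> 'c"
  have "e \<in> I" using e by (simp add: I_def)
  then obtain B where B: "B \<in> I" and min: "\<And>f. f \<in> I \<Longrightarrow> fun_space.dim (V B) \<le> fun_space.dim (V f)"
    using ex_has_least_nat[of "\<lambda>f. f \<in> I" e "\<lambda>f. fun_space.dim (V f)"] by blast
  have sub: "fun_space.subspace (V f)" for f
    unfolding V_def by (rule subspace_conv_image[OF subspace_center])
  note B' = B[unfolded I_def, simplified]
  have key: "f = B" if f: "f \<in> ga_center G" "f \<star> f = f" "f \<star> B = f" "P f" for f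
  proof -
    have "f \<star> e = f" using f B' by (metis conv_assoc)
    then have "f \<in> I" using f by (simp add: I_def)
    have Bf: "B \<star> f = f" using f B' center_commute by metis
    have "V f \<subseteq> V B"
    proof
      fix u assume "u \<in> V f"
      then obtain w where "w \<in> ga_center G" "u = f \<star> w" by (auto simp: V_def)
      then have "u = B \<star> (f \<star> w)" "f \<star> w \<in> ga_center G" using f Bf by (auto simp: conv_assoc[symmetric] intro: center_conv)
      then show "u \<in> V B" by (auto simp: V_def)
    qed
    then have "V f = V B"
      by (intro subspace_eq_if_dim_le[of "carrier G"] sub min \<open>f \<in> I\<close>) (auto simp: V_def)
    moreover have "B \<in> V B" unfolding V_def using B' by (intro image_eqI[of _ _ B]) auto
    ultimately obtain w where "B = f \<star> w" by (auto simp: V_def)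
    then have "f \<star> B = B" using f by (simp add: conv_assoc[symmetric])
    then show ?thesis using f by simp
  qed
  have "B \<noteq> 0" using B' P0 by auto
  moreover have "f = 0 \<or> h = 0"
    if fh: "central_idempotent G f" "central_idempotent G h" "f \<star> h = 0" "B = (\<lambda>x. f x + h x)" for f h
  proof -
    have f: "f \<in> ga_center G" "f \<star> f = f" and h: "h \<in> ga_center G" "h \<star> h = h"
      using fh by (auto simp: central_idempotent_def)
    have Beq: "B = f + h" using fh by (simp add: plus_fun_def)
    have hf: "h \<star> f = 0" using fh(3) center_commute[OF f(1), of h] by simp
    have "f \<star> B = f" "h \<star> B = h" using f h hf fh(3) by (simp_all add: Beq conv_add_right)
    moreover have "P f \<or> P h" using Padd[OF f h] B' Beq by simp
    ultimately have "f = B \<or> h = B" using key f h by blast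
    moreover have "B - f = h" "B - h = f" using Beq by simp_all
    ultimately show ?thesis by auto
  qed
  ultimately have "B \<in> blocks G" using B' by (auto simp: blocks_def central_idempotent_def zero_fun_eq)
  then show ?thesis using B' by auto
qed

lemma ex_block_of_hom:
  assumes \<phi>: "center_alg_hom G \<phi>"
  shows "\<exists>!B. B \<in> blocks G \<and> \<phi> B = 1"
proof -
  have "\<exists>B\<in>blocks G. B \<star> \<epsilon> = B \<and> \<phi> B \<noteq> 0"
    by (rule primitive_refinement) (auto simp: \<phi> hom_unit hom_0 hom_add center_supported)
  then obtain B where B: "B \<in> blocks G" "\<phi> B \<noteq> 0" by auto
  have lB: "\<phi> B = 1" using hom_idem[OF \<phi> blockD(1,2)[OF B(1)]] B by auto
  have "C = B" if C: "C \<in> blocks G" "\<phi> C = 1" for C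
  proof -
    note b = blockD(1-3)[OF B(1)] and c = blockD(1-3)[OF C(1)]
    have comm: "C \<star> B = B \<star> C" using b c center_commute by blast
    have ne: "C \<star> B \<noteq> 0" using hom_mult[OF \<phi> c(1) b(1)] lB C hom_0[OF \<phi>] by auto
    have cent: "C \<star> B \<in> ga_center G" using b c by (intro center_conv)
    have 1: "C \<star> B \<star> B = C \<star> B" by (simp add: conv_assoc b)
    have 2: "C \<star> B \<star> C = C \<star> B" by (metis comm conv_assoc c(2))
    have "C \<star> B \<star> (C \<star> B) = C \<star> B" using 1 2 by (metis conv_assoc)
    then have "C \<star> B = B" "C \<star> B = C"
      using blockD(4)[OF B(1) cent _ 1] blockD(4)[OF C(1) cent _ 2] ne by auto
    then show ?thesis by simp
  qed
  then show ?thesis using B lB by blast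
qed

end

section \<open>Valuation rings\<close>

lemma val_ge_mult:
  assumes "discrete_valuation v" "val_ge v m x" "val_ge v n y" shows "val_ge v (m + n) (x * y)"
  using assms by (auto simp: val_ge_def discrete_valuation_def)

lemma val_ge_add:
  assumes v: "discrete_valuation v" and x: "val_ge v m x" and y: "val_ge v m y" shows "val_ge v m (x + y)"
proof (cases "x = 0 \<or> y = 0 \<or> x + y = 0")
  case True then show ?thesis using x y by (auto simp: val_ge_def)
next
  case False
  then have "min (v x) (v y) \<le> v (x + y)" using v by (auto simp: discrete_valuation_def)
  then show ?thesis using False x y by (auto simp: val_ge_def)
qed

lemma val_ge_sum: "discrete_valuation v \<Longrightarrow> (\<And>i. i \<in> I \<Longrightarrow> val_ge v m (f i)) \<Longrightarrow> val_ge v m (\<Sum>i\<in>I. f i)"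
  by (induction I rule: infinite_finite_induct) (auto simp: val_ge_add, simp_all add: val_ge_def)

lemma val_one:
  assumes "discrete_valuation v" shows "v 1 = 0"
proof -
  have "v (1 * 1) = v 1 + v 1" using assms unfolding discrete_valuation_def by (metis one_neq_zero)
  then show ?thesis by simp
qed

lemma val_minus_one:
  assumes "discrete_valuation v" shows "v (- 1) = 0"
proof -
  have "v ((-1) * (-1)) = v (-1) + v (-1)" using assms unfolding discrete_valuation_def by (metis neg_equal_0_iff_equal one_neq_zero)
  then show ?thesis using val_one[OF assms] by simp
qed

context
  fixes v :: "'K::field_char_0 \<Rightarrow> int" and star :: "'K \<Rightarrow> 'k::field" and p :: nat
  assumes sys: "p_modular_system p v star"
begin

lemma dv: "discrete_valuation v" using sys by (simp add: p_modular_system_def)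

lemma vr_mult: "x \<in> valuation_ring v \<Longrightarrow> y \<in> valuation_ring v \<Longrightarrow> x * y \<in> valuation_ring v"
  using val_ge_mult[OF dv, of 0 x 0 y] by (simp add: valuation_ring_def)
lemma vr_add: "x \<in> valuation_ring v \<Longrightarrow> y \<in> valuation_ring v \<Longrightarrow> x + y \<in> valuation_ring v"
  using val_ge_add[OF dv, of 0 x y] by (simp add: valuation_ring_def)
lemma vr_0: "0 \<in> valuation_ring v" by (simp add: valuation_ring_def val_ge_def)
lemma vr_1: "1 \<in> valuation_ring v" using val_one[OF dv] by (simp add: valuation_ring_def val_ge_def)
lemma vr_minus: "x \<in> valuation_ring v \<Longrightarrow> - x \<in> valuation_ring v"
  using vr_mult[of "-1" x] val_minus_one[OF dv] by (simp add: valuation_ring_def val_ge_def)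
lemma vr_sum: "(\<And>i. i \<in> I \<Longrightarrow> f i \<in> valuation_ring v) \<Longrightarrow> (\<Sum>i\<in>I. f i) \<in> valuation_ring v"
  by (induction I rule: infinite_finite_induct) (auto simp: vr_0 vr_add)

lemma star_add: "x \<in> valuation_ring v \<Longrightarrow> y \<in> valuation_ring v \<Longrightarrow> star (x + y) = star x + star y"
  and star_mult: "x \<in> valuation_ring v \<Longrightarrow> y \<in> valuation_ring v \<Longrightarrow> star (x * y) = star x * star y"
  and star_1: "star 1 = 1"
  and star_surj: "\<exists>x\<in>valuation_ring v. star x = c"
proof -
  show "x \<in> valuation_ring v \<Longrightarrow> y \<in> valuation_ring v \<Longrightarrow> star (x + y) = star x + star y"
    "x \<in> valuation_ring v \<Longrightarrow> y \<in> valuation_ring v \<Longrightarrow> star (x * y) = star x * star y" "star 1 = 1"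
    using sys by (simp_all add: p_modular_system_def)
  have "c \<in> star ` valuation_ring v" using sys by (simp add: p_modular_system_def)
  then show "\<exists>x\<in>valuation_ring v. star x = c" by auto
qed
lemma star_0: "star 0 = 0"
proof -
  have "star 0 + 0 = star 0 + star 0" using star_add[OF vr_0 vr_0] by simp
  then show ?thesis by (simp only: add_left_cancel)
qed
lemma star_minus: "x \<in> valuation_ring v \<Longrightarrow> star (- x) = - star x"
  using star_add[of x "- x"] by (simp add: vr_minus star_0 eq_neg_iff_add_eq_0 add.commute)
lemma star_sum: "(\<And>i. i \<in> I \<Longrightarrow> f i \<in> valuation_ring v) \<Longrightarrow> star (\<Sum>i\<in>I. f i) = (\<Sum>i\<in>I. star (f i))"
proof (induction I rule: infinite_finite_induct)
  case (insert x F) then show ?case by (simp add: star_add vr_sum)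
qed (auto simp: star_0)


end

context finite_group
begin

section \<open>Conjugacy classes\<close>

lemma conj_class_self: "x \<in> carrier G \<Longrightarrow> x \<in> conj_class G x"
  unfolding conj_class_def by (auto intro!: exI[of _ \<one>])

lemma conj_class_subset: "x \<in> carrier G \<Longrightarrow> conj_class G x \<subseteq> carrier G"
  by (auto simp: conj_class_def)

lemma conj_class_eq:
  assumes x: "x \<in> carrier G" and y: "y \<in> conj_class G x" shows "conj_class G y = conj_class G x"
proof -
  obtain h where h: "h \<in> carrier G" "y = h \<otimes> x \<otimes> inv h" using y by (auto simp: conj_class_def)
  have 1: "g \<otimes> y \<otimes> inv g = (g \<otimes> h) \<otimes> x \<otimes> inv (g \<otimes> h)" if "g \<in> carrier G" for g
    using h x that by (simp add: m_assoc inv_mult_group)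
  have 2: "g \<otimes> x \<otimes> inv g = (g \<otimes> inv h) \<otimes> y \<otimes> inv (g \<otimes> inv h)" if "g \<in> carrier G" for g
    using h x that by (simp add: m_assoc inv_mult_group)
  have "g \<otimes> y \<otimes> inv g \<in> conj_class G x" "g \<otimes> x \<otimes> inv g \<in> conj_class G y" if g: "g \<in> carrier G" for g
    unfolding 1[OF g] 2[OF g] unfolding conj_class_def using g h(1) by blast+
  then show ?thesis unfolding conj_class_def by blast
qed

lemma conj_classesD:
  assumes "C \<in> conj_classes G" shows "C \<subseteq> carrier G" "(SOME x. x \<in> C) \<in> C" "finite C"
    and "\<And>x. x \<in> C \<Longrightarrow> C = conj_class G x"
proof -
  obtain x where x: "x \<in> carrier G" "C = conj_class G x" using assms by (auto simp: conj_classes_def)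
  show 1: "C \<subseteq> carrier G" using x conj_class_subset by simp
  show "(SOME x. x \<in> C) \<in> C" using conj_class_self x by (metis someI)
  show "finite C" using 1 finite_carrier finite_subset by blast
  show "\<And>x. x \<in> C \<Longrightarrow> C = conj_class G x" using conj_class_eq x by metis
qed

lemma finite_conj_classes: "finite (conj_classes G)"
  by (simp add: conj_classes_def)

lemma sum_conj_classes: "(\<Sum>x\<in>carrier G. f x) = (\<Sum>C\<in>conj_classes G. \<Sum>x\<in>C. f x)"
proof -
  have U: "carrier G = \<Union> (conj_classes G)"
    using conj_class_self conj_class_subset by (auto simp: conj_classes_def)
  have "A \<inter> B = {}" if "A \<in> conj_classes G" "B \<in> conj_classes G" "A \<noteq> B" for A B
  proof (rule ccontr)
    assume "A \<inter> B \<noteq> {}"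
    then obtain x where x: "x \<in> A" "x \<in> B" by blast
    have "A = B" by (rule trans[OF conj_classesD(4)[OF that(1) x(1)] conj_classesD(4)[OF that(2) x(2), symmetric]])
    then show False using that(3) by contradiction
  qed
  then show ?thesis unfolding U
    using conj_classesD(3) by (subst sum.Union_disjoint) auto
qed

definition class_fun :: "('a \<Rightarrow> 'c) \<Rightarrow> bool" where
  "class_fun f \<longleftrightarrow> (\<forall>g\<in>carrier G. \<forall>x\<in>carrier G. f (g \<otimes> x \<otimes> inv g) = f x)"

lemma class_fun_center: "z \<in> ga_center G \<Longrightarrow> class_fun z"
  by (auto simp: ga_center_eq invariants_def class_fun_def)

lemma class_fun_rep:
  assumes "class_fun f" "C \<in> conj_classes G" "x \<in> C"
  shows "f x = f (SOME x. x \<in> C)"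
proof -
  have s: "(SOME x. x \<in> C) \<in> C" "(SOME x. x \<in> C) \<in> carrier G" using conj_classesD(1,2)[OF assms(2)] by auto
  have "C = conj_class G (SOME x. x \<in> C)" using conj_classesD(4)[OF assms(2) s(1)] .
  then have "x \<in> conj_class G (SOME x. x \<in> C)" using assms(3) by blast
  then obtain g where "g \<in> carrier G" "x = g \<otimes> (SOME x. x \<in> C) \<otimes> inv g" by (auto simp: conj_class_def)
  then show ?thesis using assms(1) s by (auto simp: class_fun_def)
qed

lemma sum_of_class_center: "C \<in> conj_classes G \<Longrightarrow> (sum_of C :: 'a \<Rightarrow> 'c::field) \<in> ga_center G"
proof -
  assume C: "C \<in> conj_classes G"
  have *: "y \<in> C \<longleftrightarrow> C = conj_class G y" if "y \<in> carrier G" for y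
  proof
    assume eq: "C = conj_class G y"
    show "y \<in> C" by (subst eq) (rule conj_class_self[OF that])
  qed (rule conj_classesD(4)[OF C])
  have "(n \<otimes> x \<otimes> inv n \<in> C) = (x \<in> C)" if n: "n \<in> carrier G" and x: "x \<in> carrier G" for n x
  proof -
    have "n \<otimes> x \<otimes> inv n \<in> conj_class G x" unfolding conj_class_def using n by blast
    from conj_class_eq[OF x this] show ?thesis
      by (simp only: *[OF x] *[OF conj_closed[OF n x]])
  qed
  then have "sum_of C (n \<otimes> x \<otimes> inv n) = (sum_of C x :: 'c)" if "n \<in> carrier G" "x \<in> carrier G" for n x
    using that by (simp add: sum_of_def)
  moreover have "sum_of C \<in> supported (carrier G)" using conj_classesD(1)[OF C] by (auto simp: supported_def sum_of_def)
  ultimately show ?thesis by (simp add: ga_center_eq invariants_def)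
qed

lemma class_ext_add: "class_ext G f (z + w) = class_ext G f z + class_ext G f w"
  by (simp add: class_ext_def algebra_simps sum.distrib)
lemma class_ext_smul: "class_ext G f (smul c w) = c * class_ext G f w"
  by (simp add: class_ext_def smul_def sum_distrib_left algebra_simps)

section \<open>Central characters\<close>

text \<open>
  The central character \<open>\<omega>\<^sub>\<chi>\<close>; \<open>omega_class\<close> gives its values on class sums.
\<close>
definition omega :: "('a \<Rightarrow> 'K::field_char_0) \<Rightarrow> ('a \<Rightarrow> 'K) \<Rightarrow> 'K" where
  "omega \<chi> z = (\<Sum>g\<in>carrier G. z g * \<chi> g) / \<chi> \<one>"

definition omega_class :: "('a \<Rightarrow> 'K::field_char_0) \<Rightarrow> 'a set \<Rightarrow> 'K" where
  "omega_class \<chi> C = of_nat (card C) * \<chi> (SOME g. g \<in> C) / \<chi> \<one>"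

lemma omega_class_ext:
  assumes z: "class_fun z" and \<chi>: "class_fun \<chi>"
  shows "omega \<chi> z = (\<Sum>C\<in>conj_classes G. z (SOME x. x \<in> C) * omega_class \<chi> C)"
proof -
  have "(\<Sum>g\<in>carrier G. z g * \<chi> g) = (\<Sum>C\<in>conj_classes G. z (SOME x. x \<in> C) * (of_nat (card C) * \<chi> (SOME g. g \<in> C)))"
    unfolding sum_conj_classes
  proof (rule sum.cong[OF refl])
    fix C assume C: "C \<in> conj_classes G"
    have "(\<Sum>x\<in>C. z x * \<chi> x) = (\<Sum>x\<in>C. z (SOME x. x \<in> C) * \<chi> (SOME x. x \<in> C))"
      using class_fun_rep[OF z C] class_fun_rep[OF \<chi> C] by (intro sum.cong) auto
    then show "(\<Sum>x\<in>C. z x * \<chi> x) = z (SOME x. x \<in> C) * (of_nat (card C) * \<chi> (SOME g. g \<in> C))"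
      by simp
  qed
  then show ?thesis by (simp add: omega_def omega_class_def sum_divide_distrib mult.assoc)
qed

definition rep_ext :: "nat \<Rightarrow> ('a \<Rightarrow> 'K::field mat) \<Rightarrow> ('a \<Rightarrow> 'K) \<Rightarrow> 'K mat" where
  "rep_ext n \<rho> z = mat n n (\<lambda>(i,j). \<Sum>g\<in>carrier G. z g * \<rho> g $$ (i,j))"

lemma rep_entry_mult:
  assumes \<rho>: "representation G n \<rho>" and g: "g \<in> carrier G" "h \<in> carrier G" and ij: "i < n" "j < n"
  shows "\<rho> (g \<otimes> h) $$ (i,j) = (\<Sum>l<n. \<rho> g $$ (i,l) * \<rho> h $$ (l,j))"
proof -
  have "\<rho> (g \<otimes> h) = \<rho> g * \<rho> h" "\<rho> g \<in> carrier_mat n n" "\<rho> h \<in> carrier_mat n n"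
    using \<rho> g by (auto simp: representation_def)
  then show ?thesis using ij by (auto simp: scalar_prod_def lessThan_atLeast0)
qed

lemma rep_ext_delta:
  assumes \<rho>: "representation G n \<rho>" and g: "g \<in> carrier G"
  shows "rep_ext n \<rho> (sum_of {g}) = \<rho> g"
proof -
  have "\<rho> g \<in> carrier_mat n n" using \<rho> g by (auto simp: representation_def)
  moreover have "(\<Sum>x\<in>carrier G. sum_of {g} x * \<rho> x $$ (i,j)) = \<rho> g $$ (i,j)" for i j
  proof -
    have "(\<Sum>x\<in>carrier G. sum_of {g} x * \<rho> x $$ (i,j)) = (\<Sum>x\<in>carrier G. if x = g then \<rho> x $$ (i,j) else 0)"
      by (intro sum.cong) (auto simp: sum_of_def)
    then show ?thesis using g by simp
  qed
  ultimately show ?thesis by (intro eq_matI) (auto simp: rep_ext_def)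
qed

lemma rep_ext_conv:
  assumes \<rho>: "representation G n \<rho>"
  shows "rep_ext n \<rho> (a \<star> b) = rep_ext n \<rho> a * rep_ext n \<rho> b"
proof (rule eq_matI)
  fix i j assume ij: "i < dim_row (rep_ext n \<rho> a * rep_ext n \<rho> b)" "j < dim_col (rep_ext n \<rho> a * rep_ext n \<rho> b)"
  then have ij: "i < n" "j < n" by (auto simp: rep_ext_def)
  have "rep_ext n \<rho> (a \<star> b) $$ (i,j) = (\<Sum>x\<in>carrier G. \<Sum>y\<in>carrier G. a y * b (inv y \<otimes> x) * \<rho> x $$ (i,j))"
    using ij by (simp add: rep_ext_def conv_apply sum_distrib_right)
  also have "\<dots> = (\<Sum>y\<in>carrier G. \<Sum>x\<in>carrier G. a y * b (inv y \<otimes> x) * \<rho> x $$ (i,j))"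
    by (rule sum.swap)
  also have "\<dots> = (\<Sum>y\<in>carrier G. \<Sum>u\<in>carrier G. a y * b u * \<rho> (y \<otimes> u) $$ (i,j))"
  proof (rule sum.cong[OF refl])
    fix y assume y: "y \<in> carrier G"
    show "(\<Sum>x\<in>carrier G. a y * b (inv y \<otimes> x) * \<rho> x $$ (i,j)) = (\<Sum>u\<in>carrier G. a y * b u * \<rho> (y \<otimes> u) $$ (i,j))"
      by (rule sum.reindex_bij_witness[of _ "\<lambda>u. y \<otimes> u" "\<lambda>x. inv y \<otimes> x"])
        (use y in \<open>auto simp: m_assoc[symmetric]\<close>)
  qed
  also have "\<dots> = (\<Sum>y\<in>carrier G. \<Sum>u\<in>carrier G. \<Sum>l<n. (a y * \<rho> y $$ (i,l)) * (b u * \<rho> u $$ (l,j)))"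
    using ij by (intro sum.cong refl) (simp add: rep_entry_mult[OF \<rho>] sum_distrib_left algebra_simps)
  also have "\<dots> = (\<Sum>y\<in>carrier G. \<Sum>l<n. \<Sum>u\<in>carrier G. (a y * \<rho> y $$ (i,l)) * (b u * \<rho> u $$ (l,j)))"
    by (intro sum.cong refl sum.swap)
  also have "\<dots> = (\<Sum>l<n. \<Sum>y\<in>carrier G. \<Sum>u\<in>carrier G. (a y * \<rho> y $$ (i,l)) * (b u * \<rho> u $$ (l,j)))"
    by (rule sum.swap)
  also have "\<dots> = (\<Sum>l<n. (\<Sum>y\<in>carrier G. a y * \<rho> y $$ (i,l)) * (\<Sum>u\<in>carrier G. b u * \<rho> u $$ (l,j)))"
    by (simp add: sum_product)
  also have "\<dots> = (rep_ext n \<rho> a * rep_ext n \<rho> b) $$ (i,j)"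
    using ij by (simp add: rep_ext_def scalar_prod_def lessThan_atLeast0)
  finally show "rep_ext n \<rho> (a \<star> b) $$ (i,j) = (rep_ext n \<rho> a * rep_ext n \<rho> b) $$ (i,j)" .
qed (auto simp: rep_ext_def)

lemma character_one: "representation G n \<rho> \<Longrightarrow> character_of G n \<rho> \<one> = of_nat n"
  by (simp add: character_of_def representation_def)

text \<open>
  Schur's lemma, in the form of the splitting field hypothesis, makes the matrix a scalar, and comparing
  traces identifies the scalar; dividing by the degree uses characteristic \<open>0\<close>.
\<close>
lemma rep_ext_center:
  fixes \<rho> :: "'a \<Rightarrow> 'K::field_char_0 mat"
  assumes irr: "irreducible_representation G n \<rho>" and split: "splitting_field TYPE('K) G"
    and z: "z \<in> ga_center G"
  shows "rep_ext n \<rho> z = omega (character_of G n \<rho>) z \<cdot>\<^sub>m 1\<^sub>m n"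
proof -
  have \<rho>: "representation G n \<rho>" and n: "0 < n" using irr by (auto simp: irreducible_representation_def)
  have "rep_ext n \<rho> z * \<rho> g = \<rho> g * rep_ext n \<rho> z" if g: "g \<in> carrier G" for g
    using rep_ext_conv[OF \<rho>, of z "sum_of {g}"] rep_ext_conv[OF \<rho>, of "sum_of {g}" z] rep_ext_delta[OF \<rho> g] center_commute[OF z, of "sum_of {g}"]
    by simp
  moreover have "rep_ext n \<rho> z \<in> carrier_mat n n" by (simp add: rep_ext_def)
  ultimately obtain c where c: "rep_ext n \<rho> z = c \<cdot>\<^sub>m 1\<^sub>m n"
    using split irr unfolding splitting_field_def by blast
  have "(\<Sum>i<n. rep_ext n \<rho> z $$ (i,i)) = (\<Sum>g\<in>carrier G. z g * character_of G n \<rho> g)"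
    by (simp add: rep_ext_def character_of_def sum_distrib_left, rule sum.swap)
  then have "of_nat n * c = (\<Sum>g\<in>carrier G. z g * character_of G n \<rho> g)" unfolding c by simp
  then have "c = omega (character_of G n \<rho>) z"
    unfolding omega_def character_one[OF \<rho>] using n by (simp add: field_simps)
  then show ?thesis using c by simp
qed

lemma Irr_class_fun: "\<chi> \<in> Irr G \<Longrightarrow> class_fun \<chi>"
proof -
  assume "\<chi> \<in> Irr G"
  then obtain n \<rho> where \<rho>: "irreducible_representation G n \<rho>" "\<chi> = character_of G n \<rho>" by (auto simp: Irr_def)
  have r: "representation G n \<rho>" using \<rho> by (simp add: irreducible_representation_def)
  have tr: "\<chi> (g \<otimes> h) = \<chi> (h \<otimes> g)" if "g \<in> carrier G" "h \<in> carrier G" for g h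
  proof -
    have "\<chi> (g \<otimes> h) = (\<Sum>i<n. \<Sum>l<n. \<rho> g $$ (i,l) * \<rho> h $$ (l,i))"
      using that by (simp add: \<rho> character_of_def rep_entry_mult[OF r])
    also have "\<dots> = (\<Sum>l<n. \<Sum>i<n. \<rho> g $$ (i,l) * \<rho> h $$ (l,i))" by (rule sum.swap)
    also have "\<dots> = \<chi> (h \<otimes> g)"
      using that by (simp add: \<rho> character_of_def rep_entry_mult[OF r] mult.commute)
    finally show ?thesis .
  qed
  have "\<chi> (g \<otimes> x \<otimes> inv g) = \<chi> x" if "g \<in> carrier G" "x \<in> carrier G" for g x
    using tr[of "g \<otimes> x" "inv g"] that by (simp add: m_assoc[symmetric])
  then show ?thesis by (simp add: class_fun_def)
qed

lemma omega_unit_mult: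
  fixes \<chi> :: "'a \<Rightarrow> 'K::field_char_0"
  assumes split: "splitting_field TYPE('K) G" and \<chi>: "\<chi> \<in> Irr G"
  shows "omega \<chi> \<epsilon> = 1" "\<And>z w :: 'a \<Rightarrow> 'K. z \<in> ga_center G \<Longrightarrow> w \<in> ga_center G \<Longrightarrow> omega \<chi> (z \<star> w) = omega \<chi> z * omega \<chi> w"
proof -
  obtain n \<rho> where \<rho>: "irreducible_representation G n \<rho>" "\<chi> = character_of G n \<rho>" using \<chi> by (auto simp: Irr_def)
  have r: "representation G n \<rho>" and n: "0 < n" using \<rho> by (simp_all add: irreducible_representation_def)
  have e: "rep_ext n \<rho> z = omega \<chi> z \<cdot>\<^sub>m 1\<^sub>m n" if "z \<in> ga_center G" for z
    using rep_ext_center[OF \<rho>(1) split that] \<rho>(2) by simp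
  have "rep_ext n \<rho> \<epsilon> = 1\<^sub>m n" using rep_ext_delta[OF r, of \<one>] r by (simp add: representation_def)
  then have "omega \<chi> \<epsilon> \<cdot>\<^sub>m 1\<^sub>m n = 1\<^sub>m n" using e by simp
  then have "(omega \<chi> \<epsilon> \<cdot>\<^sub>m 1\<^sub>m n) $$ (0,0) = 1\<^sub>m n $$ (0,0)" by simp
  then show "omega \<chi> \<epsilon> = 1" using n by simp
  fix z w :: "'a \<Rightarrow> 'K" assume zw: "z \<in> ga_center G" "w \<in> ga_center G"
  have "omega \<chi> (z \<star> w) \<cdot>\<^sub>m 1\<^sub>m n = (omega \<chi> z \<cdot>\<^sub>m 1\<^sub>m n) * (omega \<chi> w \<cdot>\<^sub>m 1\<^sub>m n)"
    using rep_ext_conv[OF r, of z w] e[OF zw(1)] e[OF zw(2)] e[OF center_conv[OF zw]] by simp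
  also have "\<dots> = (omega \<chi> z * omega \<chi> w) \<cdot>\<^sub>m 1\<^sub>m n"
    by (subst mult_smult_assoc_mat[of _ n n _ n]) (auto intro!: eq_matI)
  finally have "(omega \<chi> (z \<star> w) \<cdot>\<^sub>m 1\<^sub>m n) $$ (0,0) = ((omega \<chi> z * omega \<chi> w) \<cdot>\<^sub>m 1\<^sub>m n) $$ (0,0)" by simp
  then show "omega \<chi> (z \<star> w) = omega \<chi> z * omega \<chi> w" using n by simp
qed

section \<open>Reduction modulo the maximal ideal\<close>

definition integral :: "('K::field_char_0 \<Rightarrow> int) \<Rightarrow> ('a \<Rightarrow> 'K) \<Rightarrow> bool" where
  "integral v a \<longleftrightarrow> (\<forall>x. a x \<in> valuation_ring v)"

context
  fixes v :: "'K::field_char_0 \<Rightarrow> int" and star :: "'K \<Rightarrow> 'k::field" and p :: nat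
  assumes sys: "p_modular_system p v star" and split: "splitting_field TYPE('K) G"
begin

lemma integral_conv: "integral v a \<Longrightarrow> integral v b \<Longrightarrow> integral v (a \<star> b)"
  by (auto simp: integral_def ga_mult_def vr_0[OF sys] intro!: vr_sum[OF sys] vr_mult[OF sys])

lemma integral_sum_of: "integral v (sum_of X)"
  by (auto simp: integral_def sum_of_def vr_0[OF sys] vr_1[OF sys])

lemma star_conv: "integral v a \<Longrightarrow> integral v b \<Longrightarrow> star \<circ> (a \<star> b) = (star \<circ> a) \<star> (star \<circ> b)"
proof
  fix x assume ab: "integral v a" "integral v b"
  then have m: "a y * b w \<in> valuation_ring v" for y w by (auto simp: integral_def intro!: vr_mult[OF sys])
  have "star (\<Sum>y\<in>carrier G. a y * b (inv y \<otimes> x)) = (\<Sum>y\<in>carrier G. star (a y * b (inv y \<otimes> x)))"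
    by (rule star_sum[OF sys]) (rule m)
  also have "\<dots> = (\<Sum>y\<in>carrier G. star (a y) * star (b (inv y \<otimes> x)))"
    using ab by (simp add: star_mult[OF sys] integral_def)
  finally show "(star \<circ> (a \<star> b)) x = ((star \<circ> a) \<star> (star \<circ> b)) x"
    by (simp add: ga_mult_def star_0[OF sys])
qed

text \<open>
  Otherwise let \<open>m < 0\<close> be the least valuation of a value of \<open>\<omega>\<^sub>\<chi>\<close> on class sums, attained at \<open>K\<^sup>+\<close>.
  Since \<open>K\<^sup>+ K\<^sup>+\<close> is an integral combination of class sums, the square of this value, whose
  valuation is \<open>2 m\<close>, would have valuation at least \<open>m\<close>.
\<close>
lemma omega_class_integral:
  assumes \<chi>: "\<chi> \<in> Irr G" and C: "C \<in> conj_classes G"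
  shows "omega_class \<chi> C \<in> valuation_ring v"
proof (rule ccontr)
  assume neg: "omega_class \<chi> C \<notin> valuation_ring v"
  define N where "N = {C \<in> conj_classes G. omega_class \<chi> C \<noteq> 0}"
  have "finite N" using finite_conj_classes by (simp add: N_def)
  moreover have CN: "C \<in> N" using neg C vr_0[OF sys] by (auto simp: N_def)
  ultimately obtain K where K: "K \<in> N" and min: "\<And>L. L \<in> N \<Longrightarrow> v (omega_class \<chi> K) \<le> v (omega_class \<chi> L)"
  proof -
    have "Min ((\<lambda>L. v (omega_class \<chi> L)) ` N) \<in> (\<lambda>L. v (omega_class \<chi> L)) ` N"
      using \<open>finite N\<close> CN by (intro Min_in) auto
    then obtain K where K: "K \<in> N" "Min ((\<lambda>L. v (omega_class \<chi> L)) ` N) = v (omega_class \<chi> K)" by auto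
    show thesis by (rule that[OF K(1)], unfold K(2)[symmetric], rule Min_le) (use \<open>finite N\<close> in auto)
  qed
  define m where "m = v (omega_class \<chi> K)"
  have "m \<le> v (omega_class \<chi> C)" unfolding m_def using min CN by blast
  then have m: "m < 0" using neg by (auto simp: valuation_ring_def val_ge_def)
  have ge: "val_ge v m (omega_class \<chi> L)" if "L \<in> conj_classes G" for L
    using min[of L] that by (auto simp: val_ge_def N_def m_def)
  have cf: "class_fun \<chi>" by (rule Irr_class_fun[OF \<chi>])
  have K': "K \<in> conj_classes G" using K by (simp add: N_def)
  have z: "sum_of K \<in> ga_center G" by (rule sum_of_class_center[OF K'])
  have "omega \<chi> (sum_of K) = (\<Sum>L\<in>conj_classes G. if L = K then omega_class \<chi> L else 0)"
    unfolding omega_class_ext[OF class_fun_center[OF z] cf]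
  proof (rule sum.cong[OF refl])
    fix L assume L: "L \<in> conj_classes G"
    have "(SOME x. x \<in> L) \<in> K \<longleftrightarrow> L = K"
    proof
      assume "(SOME x. x \<in> L) \<in> K"
      from conj_classesD(4)[OF K' this] conj_classesD(4)[OF L conj_classesD(2)[OF L]] show "L = K" by (rule trans[OF _ sym, rotated])
    qed (use conj_classesD(2)[OF L] in blast)
    then show "sum_of K (SOME x. x \<in> L) * omega_class \<chi> L = (if L = K then omega_class \<chi> L else 0)"
      by (auto simp: sum_of_def)
  qed
  then have oK: "omega \<chi> (sum_of K) = omega_class \<chi> K" using K' finite_conj_classes by simp
  have zz: "sum_of K \<star> sum_of K \<in> ga_center G" by (intro center_conv z)
  have int: "(sum_of K \<star> sum_of K) x \<in> valuation_ring v" for x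
    using integral_conv[OF integral_sum_of integral_sum_of] by (auto simp: integral_def)
  have "val_ge v m (omega \<chi> (sum_of K \<star> sum_of K))"
    unfolding omega_class_ext[OF class_fun_center[OF zz] cf]
  proof (rule val_ge_sum[OF dv[OF sys]])
    fix L assume L: "L \<in> conj_classes G"
    show "val_ge v m ((sum_of K \<star> sum_of K) (SOME x. x \<in> L) * omega_class \<chi> L)"
      using val_ge_mult[OF dv[OF sys] _ ge[OF L], of 0 "(sum_of K \<star> sum_of K) (SOME x. x \<in> L)"] int
      by (simp add: valuation_ring_def)
  qed
  then have "val_ge v m (omega_class \<chi> K * omega_class \<chi> K)"
    using omega_unit_mult(2)[OF split \<chi> z z] oK by simp
  moreover have "omega_class \<chi> K \<noteq> 0" using K by (simp add: N_def)
  ultimately have "m \<le> m + m" using dv[OF sys] by (auto simp: val_ge_def discrete_valuation_def m_def)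
  then show False using m by simp
qed

lemma omega_integral:
  assumes \<chi>: "\<chi> \<in> Irr G" and u: "u \<in> ga_center G" "integral v u"
  shows "omega \<chi> u \<in> valuation_ring v" "modular_central_char G star \<chi> (star \<circ> u) = star (omega \<chi> u)"
proof -
  have m: "u (SOME x. x \<in> C) * omega_class \<chi> C \<in> valuation_ring v" if "C \<in> conj_classes G" for C
    using u omega_class_integral[OF \<chi> that] by (auto simp: integral_def intro!: vr_mult[OF sys])
  show "omega \<chi> u \<in> valuation_ring v"
    unfolding omega_class_ext[OF class_fun_center[OF u(1)] Irr_class_fun[OF \<chi>]] by (intro vr_sum[OF sys] m)
  have "star (omega \<chi> u) = (\<Sum>C\<in>conj_classes G. star (u (SOME x. x \<in> C) * omega_class \<chi> C))"
    unfolding omega_class_ext[OF class_fun_center[OF u(1)] Irr_class_fun[OF \<chi>]] by (intro star_sum[OF sys] m)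
  also have "\<dots> = (\<Sum>C\<in>conj_classes G. star (u (SOME x. x \<in> C)) * star (omega_class \<chi> C))"
    using u omega_class_integral[OF \<chi>] by (intro sum.cong star_mult[OF sys]) (auto simp: integral_def)
  finally show "modular_central_char G star \<chi> (star \<circ> u) = star (omega \<chi> u)"
    by (simp add: modular_central_char_def class_ext_def omega_class_def)
qed

text \<open>
  Lifting values one by one through a section of \<open>star\<close> preserves being constant on conjugacy
  classes; the section must send \<open>0\<close> to \<open>0\<close> to preserve the support.
\<close>
lemma ex_lift:
  assumes z: "z \<in> ga_center G"
  shows "\<exists>u. u \<in> ga_center G \<and> integral v u \<and> star \<circ> u = z"
proof -
  define sec where "sec c = (if c = 0 then 0 else SOME x. x \<in> valuation_ring v \<and> star x = c)" for c
  have sec: "sec c \<in> valuation_ring v \<and> star (sec c) = c" for c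
  proof (cases "c = 0")
    case False
    have "\<exists>x. x \<in> valuation_ring v \<and> star x = c" using star_surj[OF sys, of c] by auto
    from someI_ex[OF this] False show ?thesis by (simp add: sec_def)
  qed (simp add: sec_def vr_0[OF sys] star_0[OF sys])
  have "sec \<circ> z \<in> ga_center G"
    using z by (auto simp: ga_center_eq invariants_def supported_def sec_def)
  then show ?thesis using sec by (intro exI[of _ "sec \<circ> z"]) (auto simp: integral_def)
qed

text \<open>
  Multiplicativity is inherited from \<open>\<omega>\<^sub>\<chi>\<close> by computing with lifts to \<open>Z(\<O>G)\<close>.
\<close>
lemma modular_central_char_hom:
  assumes \<chi>: "\<chi> \<in> Irr G"
  shows "center_alg_hom G (modular_central_char G star \<chi>)"
proof -
  let ?m = "modular_central_char G star \<chi>"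
  have "?m (z \<star> w) = ?m z * ?m w" if zw: "z \<in> ga_center G" "w \<in> ga_center G" for z w
  proof -
    obtain u where u: "u \<in> ga_center G" "integral v u" "star \<circ> u = z" using ex_lift[OF zw(1)] by auto
    obtain t where t: "t \<in> ga_center G" "integral v t" "star \<circ> t = w" using ex_lift[OF zw(2)] by auto
    have "?m (z \<star> w) = ?m (star \<circ> (u \<star> t))" using star_conv u t by simp
    also have "\<dots> = star (omega \<chi> u * omega \<chi> t)"
      using omega_integral(2)[OF \<chi> center_conv[OF u(1) t(1)] integral_conv[OF u(2) t(2)]] omega_unit_mult(2)[OF split \<chi> u(1) t(1)] by simp
    also have "\<dots> = ?m z * ?m w"
      using omega_integral[OF \<chi> u(1,2)] omega_integral[OF \<chi> t(1,2)] u t by (simp add: star_mult[OF sys])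
    finally show ?thesis .
  qed
  moreover have "?m \<epsilon> = 1"
  proof -
    have "star \<circ> \<epsilon> = \<epsilon>" by (auto simp: sum_of_def fun_eq_iff star_0[OF sys] star_1[OF sys])
    then show ?thesis using omega_integral(2)[OF \<chi> center_unit integral_sum_of] omega_unit_mult(1)[OF split \<chi>] star_1[OF sys] by simp
  qed
  moreover have "?m (z + w) = ?m z + ?m w" "?m (smul c z) = c * ?m z" for z w c
    unfolding modular_central_char_def by (rule class_ext_add class_ext_smul)+
  ultimately show ?thesis by (simp add: center_alg_hom_def plus_fun_def smul_def)
qed

end


section \<open>Minimal left ideals\<close>

definition left_ideal :: "('a \<Rightarrow> 'c::field) set \<Rightarrow> bool" where
  "left_ideal W \<longleftrightarrow> fun_space.subspace W \<and> W \<subseteq> supported (carrier G) \<and>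
     (\<forall>g\<in>carrier G. \<forall>w\<in>W. sum_of {g} \<star> w \<in> W)"

lemma ex_minimal_left_ideal:
  assumes W: "left_ideal W" "W \<noteq> {0}"
  obtains U where "left_ideal U" "U \<noteq> {0}" "U \<subseteq> W" "\<And>V. left_ideal V \<Longrightarrow> V \<subseteq> U \<Longrightarrow> V = {0} \<or> V = U"
proof -
  define P where "P U \<longleftrightarrow> left_ideal U \<and> U \<noteq> {0} \<and> U \<subseteq> W" for U
  obtain U where U: "P U" and min: "\<And>V. P V \<Longrightarrow> fun_space.dim U \<le> fun_space.dim V"
    using ex_has_least_nat[of P W fun_space.dim] W by (auto simp: P_def)
  have "V = {0} \<or> V = U" if V: "left_ideal V" "V \<subseteq> U" for V
  proof (rule disjCI)
    assume "V \<noteq> U"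
    show "V = {0}"
    proof (rule ccontr)
      assume "V \<noteq> {0}"
      then have "P V" using V U by (auto simp: P_def)
      have "V = U"
        by (rule subspace_eq_if_dim_le[OF finite_carrier _ V(2) _ min[OF \<open>P V\<close>]])
           (use U V in \<open>auto simp: P_def left_ideal_def\<close>)
      then show False using \<open>V \<noteq> U\<close> by simp
    qed
  qed
  then show ?thesis using U that by (auto simp: P_def)
qed

lemma subspace_coordinates:
  fixes W :: "('a \<Rightarrow> 'c::field) set"
  assumes W: "fun_space.subspace W" "W \<subseteq> supported (carrier G)"
  obtains n :: nat and b :: "nat \<Rightarrow> 'a \<Rightarrow> 'c" and crd where
    "\<And>i. i < n \<Longrightarrow> b i \<in> W"
    "\<And>w. w \<in> W \<Longrightarrow> (\<Sum>i<n. smul (crd w i) (b i)) = w"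
    "\<And>u. \<forall>j\<ge>n. u j = 0 \<Longrightarrow> crd (\<Sum>i<n. smul (u i) (b i)) = u"
proof -
  obtain B where B: "B \<subseteq> W" "fun_space.independent B" "W \<subseteq> fun_space.span B"
    using fun_space.basis_exists by metis
  have fin: "finite B" using finite_independent(1)[OF finite_carrier B(2)] B W by auto
  obtain b where b: "bij_betw b {..<card B} B"
    using ex_bij_betw_nat_finite[OF fin] by (auto simp: lessThan_atLeast0)
  define crd where "crd w i = (if i < card B then fun_space.representation B w (b i) else 0)" for w i
  have bB: "b i \<in> B" if "i < card B" for i using b that by (auto simp: bij_betw_def)
  show ?thesis
  proof (rule that[of "card B" b crd])
    show "b i \<in> W" if "i < card B" for i using bB[OF that] B by auto
    show "(\<Sum>i<card B. smul (crd w i) (b i)) = w" if w: "w \<in> W" for w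
    proof -
      have "w = (\<Sum>x\<in>B. smul (fun_space.representation B w x) x)"
        using fun_space.sum_representation_eq[OF B(2) _ fin order_refl, of w] B w by auto
      also have "\<dots> = (\<Sum>i<card B. smul (fun_space.representation B w (b i)) (b i))"
        by (rule sum.reindex_bij_betw[OF b, symmetric])
      finally show ?thesis by (simp add: crd_def)
    qed
    show "crd (\<Sum>i<card B. smul (u i) (b i)) = u" if u: "\<forall>j\<ge>card B. u j = 0" for u
    proof
      fix j
      show "crd (\<Sum>i<card B. smul (u i) (b i)) j = u j"
      proof (cases "j < card B")
        case True
        have s: "b i \<in> fun_space.span B" if "i < card B" for i using bB[OF that] by (rule fun_space.span_base)
        have "fun_space.representation B (\<Sum>i<card B. smul (u i) (b i)) (b j) =
              (\<Sum>i<card B. fun_space.representation B (smul (u i) (b i)) (b j))"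
          using s by (subst fun_space.representation_sum[OF B(2)]) (auto intro: fun_space.span_scale)
        also have "\<dots> = (\<Sum>i<card B. if i = j then u i else 0)"
        proof (rule sum.cong[OF refl])
          fix i assume i: "i \<in> {..<card B}"
          have "b j = b i \<longleftrightarrow> i = j" using b i True by (auto simp: bij_betw_def inj_on_def)
          then show "fun_space.representation B (smul (u i) (b i)) (b j) = (if i = j then u i else 0)"
            using i by (simp add: fun_space.representation_scale[OF B(2) s] fun_space.representation_basis[OF B(2) bB])
        qed
        also have "\<dots> = u j" using True by simp
        finally show ?thesis using True by (simp add: crd_def)
      qed (use u in \<open>simp add: crd_def\<close>)
    qed
  qed
qed

text \<open>
  In a basis of \<open>W\<close>, left multiplication by group elements is an irreducible matrix representation, to
  which \<open>rep_ext_center\<close> applies. \<open>E\<close> is the linear isomorphism from coordinate vectors to \<open>W\<close>.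
\<close>
lemma minimal_left_ideal_character:
  fixes W :: "('a \<Rightarrow> 'K::field_char_0) set"
  assumes split: "splitting_field TYPE('K) G"
    and W: "left_ideal W" "W \<noteq> {0}" and min: "\<And>V. left_ideal V \<Longrightarrow> V \<subseteq> W \<Longrightarrow> V = {0} \<or> V = W"
  shows "\<exists>\<chi>\<in>Irr G. \<forall>z\<in>ga_center G. \<forall>w\<in>W. z \<star> w = smul (omega \<chi> z) w"
proof -
  have sub: "fun_space.subspace W" and sup: "W \<subseteq> supported (carrier G)"
    and cl: "\<And>g w. g \<in> carrier G \<Longrightarrow> w \<in> W \<Longrightarrow> sum_of {g} \<star> w \<in> W"
    using W by (auto simp: left_ideal_def)
  obtain n :: nat and b :: "nat \<Rightarrow> 'a \<Rightarrow> 'K" and crd where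
    bW: "\<And>i. i < n \<Longrightarrow> b i \<in> W" and
    crd: "\<And>w. w \<in> W \<Longrightarrow> (\<Sum>i<n. smul (crd w i) (b i)) = w" and
    crd_u: "\<And>u. \<forall>j\<ge>n. u j = 0 \<Longrightarrow> crd (\<Sum>i<n. smul (u i) (b i)) = u"
    by (rule subspace_coordinates[OF sub sup]) (rule that)
  define E where "E u = (\<Sum>i<n. smul (u $ i) (b i))" for u :: "'K vec"
  define \<rho> where "\<rho> g = mat n n (\<lambda>(i,j). crd (sum_of {g} \<star> b j) i)" for g
  have E_W: "E u \<in> W" for u
    unfolding E_def using bW by (intro fun_space.subspace_sum[OF sub] fun_space.subspace_scale[OF sub]) auto
  have E_crd: "E (vec n (crd w)) = w" if "w \<in> W" for w
    using crd[OF that] by (simp add: E_def)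
  have uniq: "u = u'" if "u \<in> carrier_vec n" "u' \<in> carrier_vec n" "E u = E u'" for u u'
  proof -
    have c: "crd (E x) = (\<lambda>i. if i < n then x $ i else 0)" for x
    proof -
      have "E x = (\<Sum>i<n. smul (if i < n then x $ i else 0) (b i))" unfolding E_def by (intro sum.cong) auto
      then show ?thesis using crd_u[of "\<lambda>i. if i < n then x $ i else 0"] by simp
    qed
    have "(\<lambda>i. if i < n then u $ i else 0) = (\<lambda>i. if i < n then u' $ i else 0)" using c[of u] c[of u'] that by simp
    note eq = this
    have "u $ i = u' $ i" if "i < n" for i using fun_cong[OF eq, of i] that by simp
    then show ?thesis using that by (intro eq_vecI) auto
  qed
  have E_add: "E (u + w) = E u + E w" if "u \<in> carrier_vec n" "w \<in> carrier_vec n" for u w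
    using that by (simp add: E_def smul_add_left sum.distrib)
  have E_smul: "E (c \<cdot>\<^sub>v u) = smul c (E u)" if "u \<in> carrier_vec n" for c u
    using that by (simp add: E_def smul_sum)
  have E_unit: "E (unit_vec n j) = b j" if "j < n" for j
  proof -
    have "E (unit_vec n j) = (\<Sum>i<n. if i = j then b i else 0)"
      unfolding E_def using that by (intro sum.cong) auto
    then show ?thesis using that by simp
  qed
  have col: "(\<Sum>i<n. smul (\<rho> g $$ (i,j)) (b i)) = sum_of {g} \<star> b j" if "j < n" "g \<in> carrier G" for g j
    using crd[OF cl[OF that(2) bW[OF that(1)]]] that by (simp add: \<rho>_def)
  have E_\<rho>: "E (\<rho> g *\<^sub>v u) = sum_of {g} \<star> E u" if u: "u \<in> carrier_vec n" and g: "g \<in> carrier G" for g u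
  proof -
    have "E (\<rho> g *\<^sub>v u) = (\<Sum>i<n. \<Sum>j<n. smul (u $ j) (smul (\<rho> g $$ (i,j)) (b i)))"
      unfolding E_def
    proof (rule sum.cong[OF refl])
      fix i assume "i \<in> {..<n}"
      then have "(\<rho> g *\<^sub>v u) $ i = (\<Sum>j<n. u $ j * \<rho> g $$ (i,j))"
        using u by (simp add: \<rho>_def scalar_prod_def lessThan_atLeast0 mult.commute)
      then show "smul ((\<rho> g *\<^sub>v u) $ i) (b i) = (\<Sum>j<n. smul (u $ j) (smul (\<rho> g $$ (i,j)) (b i)))"
        by (simp add: fun_space.scale_sum_left)
    qed
    also have "\<dots> = (\<Sum>j<n. \<Sum>i<n. smul (u $ j) (smul (\<rho> g $$ (i,j)) (b i)))" by (rule sum.swap)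
    also have "\<dots> = (\<Sum>j<n. smul (u $ j) (sum_of {g} \<star> b j))"
      using g by (intro sum.cong refl) (simp only: smul_sum[symmetric] col lessThan_iff)
    also have "\<dots> = sum_of {g} \<star> E u" by (simp add: E_def conv_sum_right)
    finally show ?thesis .
  qed
  have \<rho>c: "\<rho> g \<in> carrier_mat n n" for g by (simp add: \<rho>_def)
  have mat_eq: "A = A'" if A: "A \<in> carrier_mat n n" "A' \<in> carrier_mat n n"
    and e: "\<And>u. u \<in> carrier_vec n \<Longrightarrow> E (A *\<^sub>v u) = E (A' *\<^sub>v u)" for A A'
  proof -
    have "A *\<^sub>v u = A' *\<^sub>v u" if "u \<in> carrier_vec n" for u
      using A e[OF that] that by (intro uniq) auto
    note v = this
    have "A $$ (i,j) = A' $$ (i,j)" if ij: "i < n" "j < n" for i j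
    proof -
      have "A $$ (i,j) = (A *\<^sub>v unit_vec n j) $ i" "A' $$ (i,j) = (A' *\<^sub>v unit_vec n j) $ i"
        using A ij by (auto simp: scalar_prod_right_unit)
      then show ?thesis using v[of "unit_vec n j"] by simp
    qed
    then show ?thesis using A by (intro eq_matI) auto
  qed
  have rep: "representation G n \<rho>"
    unfolding representation_def
  proof (intro conjI ballI)
    show "\<rho> g \<in> carrier_mat n n" for g by (rule \<rho>c)
    have E_sup: "E u \<in> supported (carrier G)" for u using E_W sup by auto
    show "\<rho> \<one> = 1\<^sub>m n"
      by (rule mat_eq) (auto simp: \<rho>c E_\<rho> E_sup)
    fix g h assume g: "g \<in> carrier G" "h \<in> carrier G"
    have hv: "\<rho> h *\<^sub>v u \<in> carrier_vec n" if "u \<in> carrier_vec n" for u using that by (rule mult_mat_vec_carrier[OF \<rho>c])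
    show "\<rho> (g \<otimes> h) = \<rho> g * \<rho> h"
    proof (rule mat_eq)
      fix u :: "'K vec" assume u: "u \<in> carrier_vec n"
      have "E (\<rho> g * \<rho> h *\<^sub>v u) = E (\<rho> g *\<^sub>v (\<rho> h *\<^sub>v u))"
        using assoc_mult_mat_vec[OF \<rho>c \<rho>c u] by simp
      then show "E (\<rho> (g \<otimes> h) *\<^sub>v u) = E (\<rho> g * \<rho> h *\<^sub>v u)"
        using u g hv[OF u] by (simp add: E_\<rho> conv_assoc[symmetric] delta_delta)
    qed (auto intro: \<rho>c mult_carrier_mat)
  qed
  have irr: "irreducible_representation G n \<rho>"
    unfolding irreducible_representation_def
  proof (intro conjI allI impI rep)
    show "0 < n"
    proof (rule ccontr)
      assume "\<not> 0 < n"
      then have "w = 0" if "w \<in> W" for w using crd[OF that] by simp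
      then show False using W(2) fun_space.subspace_0[OF sub] by blast
    qed
    fix U assume U: "invariant_subspace G n \<rho> U"
    have Uc: "U \<subseteq> carrier_vec n" using U by (simp add: invariant_subspace_def)
    have "left_ideal (E ` U)"
      unfolding left_ideal_def fun_space.subspace_def
    proof (intro conjI ballI allI)
      have "E (0\<^sub>v n) = 0" by (simp add: E_def)
      then show "0 \<in> E ` U" using U by (auto simp: invariant_subspace_def intro: image_eqI[of _ _ "0\<^sub>v n"])
      show "E ` U \<subseteq> supported (carrier G)" using E_W sup by auto
    next
      fix x y assume "x \<in> E ` U" "y \<in> E ` U"
      then obtain u w where "u \<in> U" "w \<in> U" "x = E u" "y = E w" by auto
      then show "x + y \<in> E ` U" using U Uc
        by (intro image_eqI[of _ _ "u + w"]) (auto simp: E_add invariant_subspace_def subset_iff)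
    next
      fix c x assume "x \<in> E ` U"
      then obtain u where "u \<in> U" "x = E u" by auto
      then show "smul c x \<in> E ` U" using U Uc
        by (intro image_eqI[of _ _ "c \<cdot>\<^sub>v u"]) (auto simp: E_smul invariant_subspace_def subset_iff)
    next
      fix g x assume "g \<in> carrier G" "x \<in> E ` U"
      then obtain u where "u \<in> U" "x = E u" by auto
      then show "sum_of {g} \<star> x \<in> E ` U" using U Uc \<open>g \<in> carrier G\<close>
        by (intro image_eqI[of _ _ "\<rho> g *\<^sub>v u"]) (auto simp: E_\<rho> invariant_subspace_def subset_iff)
    qed
    moreover have "E ` U \<subseteq> W" using E_W by auto
    ultimately consider "E ` U = {0}" | "E ` U = W" using min by blast
    then show "U = {0\<^sub>v n} \<or> U = carrier_vec n"
    proof cases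
      case 1
      have "u = 0\<^sub>v n" if "u \<in> U" for u
        using that 1 Uc by (intro uniq) (auto simp: E_def)
      then show ?thesis using U by (auto simp: invariant_subspace_def)
    next
      case 2
      have "u \<in> U" if u: "u \<in> carrier_vec n" for u
      proof -
        have "E u \<in> E ` U" using 2 E_W by simp
        then obtain u' where "u' \<in> U" "E u = E u'" by auto
        then show ?thesis using uniq[OF u, of u'] Uc by auto
      qed
      then show ?thesis using Uc by auto
    qed
  qed
  define \<chi> where "\<chi> = character_of G n \<rho>"
  have "\<chi> \<in> Irr G" using irr by (auto simp: Irr_def \<chi>_def)
  moreover have "z \<star> w = smul (omega \<chi> z) w" if z: "z \<in> ga_center G" and w: "w \<in> W" for z w
  proof -
    have zb: "z \<star> b j = smul (omega \<chi> z) (b j)" if j: "j < n" for j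
    proof -
      have "z \<star> b j = (\<Sum>g\<in>carrier G. smul (z g) (sum_of {g} \<star> b j))"
        by (rule conv_expand[OF center_supported[OF z]]) simp
      also have "\<dots> = (\<Sum>g\<in>carrier G. \<Sum>i<n. smul (z g * \<rho> g $$ (i,j)) (b i))"
        using j by (intro sum.cong refl) (simp add: col[symmetric] smul_sum)
      also have "\<dots> = (\<Sum>i<n. \<Sum>g\<in>carrier G. smul (z g * \<rho> g $$ (i,j)) (b i))" by (rule sum.swap)
      also have "\<dots> = (\<Sum>i<n. smul (rep_ext n \<rho> z $$ (i,j)) (b i))"
        using j by (intro sum.cong refl) (simp add: rep_ext_def fun_space.scale_sum_left)
      also have "\<dots> = (\<Sum>i<n. if i = j then smul (omega \<chi> z) (b i) else 0)"
        unfolding rep_ext_center[OF irr split z] \<chi>_def using j by (intro sum.cong refl) auto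
      also have "\<dots> = smul (omega \<chi> z) (b j)" using j by simp
      finally show ?thesis .
    qed
    have "z \<star> (\<Sum>i<n. smul (crd w i) (b i)) = smul (omega \<chi> z) (\<Sum>i<n. smul (crd w i) (b i))"
      unfolding conv_sum_right smul_sum by (intro sum.cong refl) (simp add: zb mult.commute)
    then show ?thesis by (simp add: crd[OF w])
  qed
  ultimately show ?thesis by blast
qed

section \<open>Every block contains a character\<close>

context
  fixes v :: "'K::field_char_0 \<Rightarrow> int" and star :: "'K \<Rightarrow> 'k::field" and p :: nat
  assumes sys: "p_modular_system p v star" and split: "splitting_field TYPE('K) G"
begin

text \<open>
  Suppose that all central characters reduce to \<open>0\<close> on \<open>B\<close>, and let \<open>u\<close> lift \<open>B\<close>. Among the elements \<open>y\<close> of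
  \<open>Z(\<O>G)\<close> whose reduction acts as identity on \<open>B\<close>, take one with largest annihilator \<open>L y\<close>. It is
  nonzero, so the left ideal it generates contains a minimal one, on which \<open>u\<close> acts by a scalar \<open>c\<close> of
  the maximal ideal. Then \<open>(u - c) y\<close> still has the defining property, but a larger annihilator.
\<close>
lemma ex_character_in_block:
  assumes B: "B \<in> ga_center G" "B \<star> B = B" "B \<noteq> 0"
  shows "\<exists>\<chi>\<in>Irr G. modular_central_char G star \<chi> B = 1"
proof (rule ccontr)
  assume no: "\<not> ?thesis"
  have zero: "modular_central_char G star \<chi> B = 0" if "\<chi> \<in> Irr G" for \<chi>
    using hom_idem[OF modular_central_char_hom[OF sys split that] B(1,2)] no that by auto
  obtain u where u: "u \<in> ga_center G" "integral v u" "star \<circ> u = B" using ex_lift[OF sys split B(1)] by auto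
  define Y where "Y y \<longleftrightarrow> y \<in> ga_center G \<and> integral v y \<and> (star \<circ> y) \<star> B = B" for y
  define L where "L y = {x \<in> supported (carrier G). y \<star> x = 0}" for y :: "'a \<Rightarrow> 'K"
  have "star \<circ> \<epsilon> = \<epsilon>" by (auto simp: sum_of_def fun_eq_iff star_0[OF sys] star_1[OF sys])
  then have Y1: "Y \<epsilon>" using center_supported[OF B(1)] by (simp add: Y_def integral_sum_of[OF sys split])
  have subL: "fun_space.subspace (L y)" for y
    using subspace_supported[of "carrier G"] unfolding fun_space.subspace_def L_def by (auto simp: conv_add_right)
  have "L y \<subseteq> supported (carrier G)" for y by (auto simp: L_def)
  then have "\<forall>y. Y y \<longrightarrow> fun_space.dim (L y) < Suc (card (carrier G))"
    by (simp add: less_Suc_eq_le dim_supported_le)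
  then obtain y where y: "Y y" and max: "\<And>y'. Y y' \<Longrightarrow> fun_space.dim (L y') \<le> fun_space.dim (L y)"
    using ex_has_greatest_nat[of Y \<epsilon> "\<lambda>y. fun_space.dim (L y)" "Suc (card (carrier G))"] Y1 by blast
  have yc: "y \<in> ga_center G" using y by (simp add: Y_def)
  have "y \<noteq> 0"
  proof
    assume "y = 0"
    then have "star \<circ> y = 0" by (simp add: fun_eq_iff star_0[OF sys])
    then show False using y B by (simp add: Y_def)
  qed
  define W0 where "W0 = (\<star>) y ` supported (carrier G)"
  have "left_ideal W0"
    unfolding left_ideal_def
  proof (intro conjI ballI)
    show "fun_space.subspace W0" unfolding W0_def by (rule subspace_conv_image[OF subspace_supported])
    show "W0 \<subseteq> supported (carrier G)" by (auto simp: W0_def)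
    fix g a assume "g \<in> carrier G" "a \<in> W0"
    then obtain a' where a': "a = y \<star> a'" "a' \<in> supported (carrier G)" by (auto simp: W0_def)
    have "sum_of {g} \<star> (y \<star> a') = y \<star> (sum_of {g} \<star> a')"
      by (metis center_commute[OF yc] conv_assoc)
    with a' show "sum_of {g} \<star> a \<in> W0" unfolding W0_def by (intro image_eqI[of _ _ "sum_of {g} \<star> a'"]) auto
  qed
  moreover have "W0 \<noteq> {0}"
  proof -
    have "y \<star> \<epsilon> \<in> W0" unfolding W0_def using center_supported[OF center_unit] by (intro imageI)
    then show ?thesis using \<open>y \<noteq> 0\<close> center_supported[OF yc] by auto
  qed
  ultimately obtain W where W: "left_ideal W" "W \<noteq> {0}" "W \<subseteq> W0" "\<And>V. left_ideal V \<Longrightarrow> V \<subseteq> W \<Longrightarrow> V = {0} \<or> V = W"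
    by (rule ex_minimal_left_ideal[of W0]) (rule that)
  obtain \<chi> where \<chi>: "\<chi> \<in> Irr G" "\<And>z w. z \<in> ga_center G \<Longrightarrow> w \<in> W \<Longrightarrow> z \<star> w = smul (omega \<chi> z) w"
    using minimal_left_ideal_character[OF split W(1,2,4)] by blast
  obtain w where w: "w \<in> W" "w \<noteq> 0" using W(1,2) by (auto simp: left_ideal_def fun_space.subspace_def)
  then obtain x where x: "x \<in> supported (carrier G)" "w = y \<star> x" using W(3) by (auto simp: W0_def)
  define c where "c = omega \<chi> u"
  have c: "c \<in> valuation_ring v" "star c = 0"
    using omega_integral[OF sys split \<chi>(1) u(1,2)] zero[OF \<chi>(1)] u(3) by (auto simp: c_def)
  define y' where "y' = u \<star> y - smul c y"
  have "Y y'"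
  proof -
    have yi: "integral v y" using y by (simp add: Y_def)
    have uyi: "integral v (u \<star> y)" by (rule integral_conv[OF sys split u(2) yi])
    have m: "c * y x \<in> valuation_ring v" for x using c yi by (auto simp: integral_def intro: vr_mult[OF sys])
    have "integral v y'" unfolding integral_def
    proof
      fix x
      have "(u \<star> y) x + - (c * y x) \<in> valuation_ring v"
        by (rule vr_add[OF sys]) (use uyi m in \<open>auto simp: integral_def intro: vr_minus[OF sys]\<close>)
      then show "y' x \<in> valuation_ring v" by (simp add: y'_def smul_def)
    qed
    moreover have "star \<circ> y' = star \<circ> (u \<star> y)"
    proof
      fix x
      have "star (y' x) = star ((u \<star> y) x + - (c * y x))" by (simp add: y'_def smul_def)
      also have "\<dots> = star ((u \<star> y) x) + - star (c * y x)"
        using uyi m by (subst star_add[OF sys]) (auto simp: integral_def star_minus[OF sys] intro: vr_minus[OF sys])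
      also have "star (c * y x) = 0" using c yi by (simp add: star_mult[OF sys] integral_def)
      finally show "(star \<circ> y') x = (star \<circ> (u \<star> y)) x" by simp
    qed
    moreover have "(star \<circ> (u \<star> y)) \<star> B = B"
      using star_conv[OF sys split u(2) yi] u(3) y B(2) by (simp add: conv_assoc Y_def)
    ultimately show ?thesis using yc u(1) by (simp add: Y_def y'_def center_diff center_conv center_smul)
  qed
  have "L y \<subseteq> L y'" by (auto simp: L_def y'_def conv_diff_left conv_assoc)
  then have "L y = L y'"
    by (intro subspace_eq_if_dim_le[OF finite_carrier subL _ _ max[OF \<open>Y y'\<close>]]) (auto simp: L_def)
  moreover have "y' \<star> x = 0"
    using \<chi>(2)[OF u(1) w(1)] x by (simp add: y'_def conv_diff_left conv_assoc c_def)
  ultimately have "x \<in> L y" using x by (auto simp: L_def)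
  then show False using w x by (simp add: L_def)
qed

lemma block_char_hom:
  assumes B: "B \<in> blocks G"
  shows "center_alg_hom G (block_char G star B)" "block_char G star B B = 1"
proof -
  define \<chi> where "\<chi> = (SOME \<chi>. \<chi> \<in> Irr_block G star B)"
  have "\<exists>\<chi>. \<chi> \<in> Irr_block G star B" using ex_character_in_block[OF blockD(1-3)[OF B]] by (auto simp: Irr_block_def)
  from someI_ex[OF this] have \<chi>: "\<chi> \<in> Irr G" "modular_central_char G star \<chi> B = 1"
    by (auto simp: Irr_block_def \<chi>_def)
  then show "center_alg_hom G (block_char G star B)" "block_char G star B B = 1"
    using modular_central_char_hom[OF sys split \<chi>(1)] by (simp_all add: block_char_def \<chi>_def[symmetric])
qed

end


section \<open>Relative traces\<close>

lemma finite_rcosets [simp]: "finite (rcosets D)"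
  by (auto simp: RCOSETS_def)

lemma rcosets_rep:
  assumes D: "subgroup D G" and C: "C \<in> rcosets D"
  shows "(SOME t. t \<in> C) \<in> carrier G" "D #> (SOME t. t \<in> C) = C"
proof -
  obtain g where g: "g \<in> carrier G" "C = D #> g" using C by (auto simp: RCOSETS_def)
  have "g \<in> C" using g D by (simp add: rcos_self)
  then have s: "(SOME t. t \<in> C) \<in> D #> g" using g(2) by (metis someI)
  show "(SOME t. t \<in> C) \<in> carrier G"
    using s g r_coset_subset_G[OF subgroup.subset[OF D] g(1)] by blast
  show "D #> (SOME t. t \<in> C) = C" using repr_independence[OF s g(1) D] g(2) by simp
qed

lemma ga_conj_supported [simp]: "ga_conj G t a \<in> supported (carrier G)"
  by (simp add: ga_conj_def supported_def)

lemma ga_conj_add: "ga_conj G t (a + b) = ga_conj G t a + ga_conj G t b"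
  by (auto simp: ga_conj_def)

lemma ga_conj_sum: "ga_conj G t (\<Sum>i\<in>I. f i) = (\<Sum>i\<in>I. ga_conj G t (f i))"
  by (auto simp: ga_conj_def sum_fun_apply fun_eq_iff)

lemma ga_conj_conj:
  assumes "s \<in> carrier G" "t \<in> carrier G"
  shows "ga_conj G t (ga_conj G s a) = ga_conj G (s \<otimes> t) a"
  using assms by (auto simp: ga_conj_def inv_mult_group m_assoc)

lemma conv_cong:
  "(\<And>x. x \<in> carrier G \<Longrightarrow> a x = a' x) \<Longrightarrow> (\<And>x. x \<in> carrier G \<Longrightarrow> b x = b' x) \<Longrightarrow> a \<star> b = a' \<star> b'"
  by (auto simp: ga_mult_def fun_eq_iff intro!: sum.cong)

lemma ga_conj_conv:
  assumes t: "t \<in> carrier G"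
  shows "ga_conj G t (a \<star> b) = ga_conj G t a \<star> ga_conj G t b"
proof
  fix x
  have "((\<lambda>x. a (t \<otimes> x \<otimes> inv t)) \<star> (\<lambda>x. b (t \<otimes> x \<otimes> inv t))) = ga_conj G t a \<star> ga_conj G t b"
    by (rule conv_cong) (auto simp: ga_conj_def)
  then show "ga_conj G t (a \<star> b) x = (ga_conj G t a \<star> ga_conj G t b) x"
    using conj_conv[OF t, of x a b] by (auto simp: ga_conj_def ga_mult_def)
qed

lemma ga_conj_center: "z \<in> ga_center G \<Longrightarrow> t \<in> carrier G \<Longrightarrow> ga_conj G t z = z"
  by (auto simp: ga_conj_def ga_center_eq invariants_def supported_def fun_eq_iff)

text \<open>
  Why the choice of coset representatives in the relative trace does not matter.
\<close>
lemma ga_fixed_conj_cong: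
  assumes D: "subgroup D G" and a: "a \<in> ga_fixed G D" and s: "s \<in> carrier G" "t \<in> carrier G" "D #> s = D #> t"
  shows "ga_conj G s a = ga_conj G t a"
proof -
  have "s \<in> D #> t" using s D rcos_self by metis
  then obtain d where d: "d \<in> D" "s = d \<otimes> t" by (auto simp: r_coset_def)
  have "ga_conj G s a = ga_conj G t (ga_conj G d a)"
    using d s subgroup.mem_carrier[OF D] by (simp add: ga_conj_conj)
  then show ?thesis using a d by (simp add: ga_fixed_def)
qed

lemma rel_trace_eq: "rel_trace G D a = (\<Sum>C\<in>rcosets D. ga_conj G (SOME t. t \<in> C) a)"
  by (simp add: rel_trace_def fun_eq_iff sum_fun_apply)

lemma rel_trace_center:
  assumes D: "subgroup D G" and a: "a \<in> ga_fixed G D"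
  shows "rel_trace G D a \<in> ga_center G"
proof -
  have "ga_conj G s (rel_trace G D a) = rel_trace G D a" if s: "s \<in> carrier G" for s
  proof -
    have "ga_conj G s (rel_trace G D a) = (\<Sum>C\<in>rcosets D. ga_conj G s (ga_conj G (SOME t. t \<in> C) a))"
      by (simp add: rel_trace_eq ga_conj_sum)
    also have "\<dots> = (\<Sum>C\<in>rcosets D. ga_conj G (SOME t. t \<in> C #> s) a)"
    proof (rule sum.cong[OF refl])
      fix C assume C: "C \<in> rcosets D"
      note r = rcosets_rep[OF D C]
      have DG: "D \<subseteq> carrier G" by (rule subgroup.subset[OF D])
      have Cs: "C #> s = D #> ((SOME t. t \<in> C) \<otimes> s)"
        using coset_mult_assoc[OF DG r(1) s] r(2) by simp
      then have "C #> s \<in> rcosets D" using r s by (auto simp: RCOSETS_def)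
      note r' = rcosets_rep[OF D this]
      have "D #> (SOME t. t \<in> C #> s) = D #> ((SOME t. t \<in> C) \<otimes> s)" using r'(2) Cs by simp
      then have "ga_conj G (SOME t. t \<in> C #> s) a = ga_conj G ((SOME t. t \<in> C) \<otimes> s) a"
        using r r' s by (intro ga_fixed_conj_cong[OF D a]) auto
      then show "ga_conj G s (ga_conj G (SOME t. t \<in> C) a) = ga_conj G (SOME t. t \<in> C #> s) a"
        using r s by (simp add: ga_conj_conj)
    qed
    also have "\<dots> = (\<Sum>C\<in>rcosets D. ga_conj G (SOME t. t \<in> C) a)"
    proof (rule sum.reindex_bij_witness[of _ "\<lambda>C. C #> inv s" "\<lambda>C. C #> s"])
      have DG: "D \<subseteq> carrier G" by (rule subgroup.subset[OF D])
      fix C assume "C \<in> rcosets D"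
      then obtain g where g: "g \<in> carrier G" "C = D #> g" by (auto simp: RCOSETS_def)
      show "C #> s #> inv s = C" "C #> inv s #> s = C"
        using g s by (simp_all add: coset_mult_assoc[OF DG] m_assoc)
      show "C #> s \<in> rcosets D" "C #> inv s \<in> rcosets D"
        using g s by (auto simp: coset_mult_assoc[OF DG] RCOSETS_def)
    qed simp
    finally show ?thesis by (simp add: rel_trace_eq)
  qed
  then have "rel_trace G D a (s \<otimes> x \<otimes> inv s) = rel_trace G D a x" if "s \<in> carrier G" "x \<in> carrier G" for s x
    using that unfolding ga_conj_def fun_eq_iff by metis
  moreover have "rel_trace G D a \<in> supported (carrier G)"
    unfolding rel_trace_eq by (intro fun_space.subspace_sum[OF subspace_supported]) auto
  ultimately show ?thesis by (auto simp: ga_center_eq invariants_def)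
qed

lemma rel_trace_conv_left:
  assumes D: "subgroup D G" and z: "z \<in> ga_center G"
  shows "z \<star> rel_trace G D a = rel_trace G D (z \<star> a)"
  unfolding rel_trace_eq conv_sum_right
  by (intro sum.cong refl) (simp add: ga_conj_conv[OF rcosets_rep(1)[OF D]] ga_conj_center[OF z rcosets_rep(1)[OF D]])

lemma rel_trace_add: "rel_trace G D (a + b) = rel_trace G D a + rel_trace G D b"
  by (simp add: rel_trace_eq ga_conj_add sum.distrib)

lemma rel_trace_0 [simp]: "rel_trace G D (0 :: 'a \<Rightarrow> 'c::field) = 0"
proof -
  have "ga_conj G t (0 :: 'a \<Rightarrow> 'c::field) = 0" for t by (rule ext) (simp add: ga_conj_def)
  then show ?thesis by (simp add: rel_trace_eq)
qed

lemma ga_fixed_conv: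
  assumes "z \<in> ga_center G" "D \<subseteq> carrier G" "a \<in> ga_fixed G D" shows "z \<star> a \<in> ga_fixed G D"
  using assms ga_conj_center[OF assms(1)] by (auto simp: ga_fixed_def group_algebra_eq ga_conj_conv subset_iff)

lemma ga_fixed_add: "a \<in> ga_fixed G D \<Longrightarrow> b \<in> ga_fixed G D \<Longrightarrow> a + b \<in> ga_fixed G D"
  by (auto simp: ga_fixed_def group_algebra_eq ga_conj_add supported_def)

text \<open>
  The trace from \<open>D\<close> of an orbit sum is the trace from a point stabiliser \<open>Q\<close>. Both sides add up
  conjugates of \<open>F i0\<close>: a right coset of \<open>Q\<close> corresponds to a right coset of \<open>D\<close> together with a point of the
  orbit, the element \<open>d t\<close> with \<open>t\<close> the representative of the \<open>D\<close>-coset giving the point \<open>d\<^sup>-\<^sup>1 i0\<close>.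
\<close>
lemma rel_trace_orbit:
  fixes F :: "'i \<Rightarrow> 'a \<Rightarrow> 'c::field"
  assumes D: "subgroup D G"
    and act_one: "act \<one> i0 = i0"
    and act_mult: "\<And>d e. d \<in> D \<Longrightarrow> e \<in> D \<Longrightarrow> act (d \<otimes> e) i0 = act d (act e i0)"
    and F: "\<And>d. d \<in> D \<Longrightarrow> F (act d i0) = ga_conj G (inv d) (F i0)"
    and sup: "F i0 \<in> supported (carrier G)"
  shows "subgroup {d \<in> D. act d i0 = i0} G" (is "subgroup ?Q G")
    and "F i0 \<in> ga_fixed G {d \<in> D. act d i0 = i0}"
    and "rel_trace G D (\<Sum>i\<in>(\<lambda>d. act d i0) ` D. F i) = rel_trace G {d \<in> D. act d i0 = i0} (F i0)"
proof -
  have DG: "\<And>d. d \<in> D \<Longrightarrow> d \<in> carrier G" by (rule subgroup.mem_carrier[OF D])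
  have Dm: "\<And>d e. d \<in> D \<Longrightarrow> e \<in> D \<Longrightarrow> d \<otimes> e \<in> D" and Di: "\<And>d. d \<in> D \<Longrightarrow> inv d \<in> D" and D1: "\<one> \<in> D"
    using D by (auto intro: subgroup.m_closed subgroup.m_inv_closed subgroup.one_closed)
  have inv_stab: "act (inv d) i0 = i0" if "d \<in> D" "act d i0 = i0" for d
  proof -
    have "act (inv d) i0 = act (inv d) (act d i0)" using that by simp
    also have "\<dots> = act (inv d \<otimes> d) i0" using that Di by (simp add: act_mult)
    finally show ?thesis using that DG act_one by simp
  qed
  show Q: "subgroup ?Q G"
    by (rule subgroupI) (use DG Dm Di D1 act_one act_mult inv_stab in auto)
  have fixed: "ga_conj G d (F i0) = F i0" if "d \<in> ?Q" for d
    using F[of "inv d"] inv_stab[of d] that Di DG by auto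
  show Fx: "F i0 \<in> ga_fixed G ?Q"
    using fixed sup by (auto simp: ga_fixed_def group_algebra_eq)
  let ?O = "(\<lambda>d. act d i0) ` D"
  let ?r = "\<lambda>C. SOME t. t \<in> C"
  define f where "f C = (D #> ?r C, act (inv (?r C \<otimes> inv (?r (D #> ?r C)))) i0)" for C
  have fd: "\<exists>d\<in>D. ?r C = d \<otimes> ?r (D #> ?r C) \<and> ?r C \<otimes> inv (?r (D #> ?r C)) = d \<and>
              D #> ?r C \<in> rcosets D \<and> ?r (D #> ?r C) \<in> carrier G \<and> ?r C \<in> carrier G \<and> ?Q #> ?r C = C"
    if C: "C \<in> rcosets ?Q" for C
  proof -
    have r: "?r C \<in> carrier G" "?Q #> ?r C = C" using rcosets_rep[OF Q C] by auto
    have E: "D #> ?r C \<in> rcosets D" using r by (auto simp: RCOSETS_def)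
    note r' = rcosets_rep[OF D E]
    have "?r C \<in> D #> ?r (D #> ?r C)" using r'(2) rcos_self[OF r(1) D] by simp
    then obtain d where d: "d \<in> D" "?r C = d \<otimes> ?r (D #> ?r C)" by (auto simp: r_coset_def)
    then have "?r C \<otimes> inv (?r (D #> ?r C)) = d" using r' DG by (metis inv_solve_right' r(1))
    then show ?thesis using d r r' E by blast
  qed
  have inj: "inj_on f (rcosets ?Q)"
  proof (rule inj_onI)
    fix C C' assume C: "C \<in> rcosets ?Q" "C' \<in> rcosets ?Q" and eq: "f C = f C'"
    obtain d where d: "d \<in> D" "?r C = d \<otimes> ?r (D #> ?r C)" "?r C \<otimes> inv (?r (D #> ?r C)) = d" "?r (D #> ?r C) \<in> carrier G"
      "?r C \<in> carrier G" "?Q #> ?r C = C"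
      using fd[OF C(1)] by blast
    obtain d' where d': "d' \<in> D" "?r C' = d' \<otimes> ?r (D #> ?r C')" "?r C' \<otimes> inv (?r (D #> ?r C')) = d'" "?r C' \<in> carrier G" "?Q #> ?r C' = C'"
      using fd[OF C(2)] by blast
    have E: "D #> ?r C = D #> ?r C'" using eq by (simp add: f_def)
    have a: "act (inv d) i0 = act (inv d') i0" using eq unfolding f_def prod.inject d(3) d'(3) by blast
    have "act (d' \<otimes> inv d) i0 = act d' (act (inv d') i0)" using a d(1) d'(1) Di by (simp add: act_mult)
    also have "\<dots> = i0" using d'(1) Di DG act_one by (simp add: act_mult[symmetric])
    finally have "d' \<otimes> inv d \<in> ?Q" using d(1) d'(1) Di Dm by simp
    moreover have "?r C' = (d' \<otimes> inv d) \<otimes> ?r C"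
    proof -
      have "(d' \<otimes> inv d) \<otimes> ?r C = (d' \<otimes> inv d) \<otimes> (d \<otimes> ?r (D #> ?r C))" using d(2) by simp
      also have "\<dots> = d' \<otimes> ?r (D #> ?r C)" using d(1,4) d'(1) DG by (simp add: m_assoc)
      finally show ?thesis using E d'(2) by simp
    qed
    ultimately have "?r C' \<in> ?Q #> ?r C" by (auto simp: r_coset_def)
    then have "?Q #> ?r C = ?Q #> ?r C'" using repr_independence[OF _ d(5) Q] by blast
    then show "C = C'" using d(6) d'(5) by simp
  qed
  have img: "f ` (rcosets ?Q) = (rcosets D) \<times> ?O"
  proof (intro equalityI subsetI)
    fix q assume "q \<in> f ` (rcosets ?Q)"
    then obtain C where C: "C \<in> rcosets ?Q" "q = f C" by auto
    obtain d where d: "d \<in> D" "?r C \<otimes> inv (?r (D #> ?r C)) = d" "D #> ?r C \<in> rcosets D"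
      using fd[OF C(1)] by blast
    then show "q \<in> (rcosets D) \<times> ?O" using C(2) Di by (auto simp: f_def)
  next
    fix q assume "q \<in> (rcosets D) \<times> ?O"
    then obtain E e where q: "q = (E, act e i0)" "E \<in> rcosets D" "e \<in> D" by auto
    note rE = rcosets_rep[OF D q(2)]
    define C where "C = ?Q #> (inv e \<otimes> ?r E)"
    have eG: "inv e \<otimes> ?r E \<in> carrier G" using q DG rE by simp
    have C: "C \<in> rcosets ?Q" using eG by (auto simp: C_def RCOSETS_def)
    have "?r C \<in> C" using someI[of "\<lambda>t. t \<in> C", OF rcos_self[OF eG Q, folded C_def]] .
    then obtain u where u: "u \<in> ?Q" "?r C = u \<otimes> (inv e \<otimes> ?r E)" by (auto simp: C_def r_coset_def)
    have uD: "u \<otimes> inv e \<in> D" using u q Dm Di by auto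
    have rC: "?r C = (u \<otimes> inv e) \<otimes> ?r E" using u q DG rE by (simp add: m_assoc)
    then have "?r C \<in> D #> ?r E" using uD by (auto simp: r_coset_def)
    then have DE: "D #> ?r C = E" using repr_independence[OF _ rE(1) D] rE(2) by blast
    have "?r C \<otimes> inv (?r E) = u \<otimes> inv e" using rC rE uD DG by (simp add: m_assoc)
    then have "inv (?r C \<otimes> inv (?r (D #> ?r C))) = e \<otimes> inv u" using DE u q DG by (simp add: inv_mult_group)
    moreover have "act (e \<otimes> inv u) i0 = act e i0" using u q Di inv_stab by (simp add: act_mult)
    ultimately have "f C = q" using DE q by (simp add: f_def)
    then show "q \<in> f ` (rcosets ?Q)" using C by blast
  qed
  have "bij_betw f (rcosets ?Q) ((rcosets D) \<times> ?O)" using inj img by (simp add: bij_betw_def)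
  from sum.reindex_bij_betw[OF this, of "\<lambda>(E, i). ga_conj G (?r E) (F i)"]
  have "(\<Sum>(E, i)\<in>(rcosets D) \<times> ?O. ga_conj G (?r E) (F i)) = (\<Sum>C\<in>rcosets ?Q. case f C of (E, i) \<Rightarrow> ga_conj G (?r E) (F i))"
    by simp
  also have "\<dots> = (\<Sum>C\<in>rcosets ?Q. ga_conj G (?r C) (F i0))"
  proof (rule sum.cong[OF refl])
    fix C assume C: "C \<in> rcosets ?Q"
    obtain d where d: "d \<in> D" "?r C = d \<otimes> ?r (D #> ?r C)" "?r C \<otimes> inv (?r (D #> ?r C)) = d" "?r (D #> ?r C) \<in> carrier G"
      using fd[OF C] by blast
    have "f C = (D #> ?r C, act (inv d) i0)" unfolding f_def d(3) by (rule refl)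
    then have "(case f C of (E, i) \<Rightarrow> ga_conj G (?r E) (F i)) = ga_conj G (?r (D #> ?r C)) (F (act (inv d) i0))" by simp
    also have "\<dots> = ga_conj G (?r (D #> ?r C)) (ga_conj G d (F i0))" using F[OF Di[OF d(1)]] d(1) DG by simp
    also have "\<dots> = ga_conj G (?r C) (F i0)" using ga_conj_conj[OF DG[OF d(1)] d(4)] d(2) by simp
    finally show "(case f C of (E, i) \<Rightarrow> ga_conj G (?r E) (F i)) = ga_conj G (?r C) (F i0)" .
  qed
  also have "(\<Sum>(E, i)\<in>(rcosets D) \<times> ?O. ga_conj G (?r E) (F i)) = rel_trace G D (\<Sum>i\<in>?O. F i)"
    by (simp add: rel_trace_eq ga_conj_sum sum.cartesian_product)
  finally show "rel_trace G D (\<Sum>i\<in>?O. F i) = rel_trace G ?Q (F i0)" by (simp add: rel_trace_eq)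
qed

text \<open>
  The traces from \<open>Q\<close> form an ideal of the centre. If \<open>\<phi>\<close> did not vanish on it, it would contain an element that
  is invertible on \<open>B\<close>, hence \<open>B\<close> itself, against the minimality of \<open>D\<close>.
\<close>
lemma trace_from_smaller_vanishes:
  assumes B: "B \<in> blocks G" and D: "defect_group G B D" and \<phi>: "center_alg_hom G \<phi>" "\<phi> B = 1"
    and Q: "subgroup Q G" "Q \<subset> D" and a: "a \<in> ga_fixed G Q"
  shows "\<phi> (rel_trace G Q a) = 0"
proof (rule ccontr)
  assume "\<phi> (rel_trace G Q a) \<noteq> 0"
  from block_unit[OF B \<phi> rel_trace_center[OF Q(1) a] this] obtain y
    where y: "y \<in> ga_center G" "rel_trace G Q a \<star> y = B" by auto
  have "B = rel_trace G Q (y \<star> a)"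
    using y center_commute[OF y(1)] rel_trace_conv_left[OF Q(1) y(1)] by metis
  then have "rel_projective G B Q"
    using ga_fixed_conv[OF y(1) subgroup.subset[OF Q(1)] a] by (auto simp: rel_projective_def)
  then show False using D Q by (auto simp: defect_group_def)
qed

text \<open>
  Without fixed points all stabilisers are proper subgroups of \<open>D\<close>, so the previous two lemmas kill every
  orbit sum. The orbits are split off one at a time.
\<close>
lemma trace_fixed_point_free_vanishes:
  fixes F :: "'i \<Rightarrow> 'a \<Rightarrow> 'c::field"
  assumes B: "B \<in> blocks G" and D: "defect_group G B D" and \<phi>: "center_alg_hom G \<phi>" "\<phi> B = 1"
    and fin: "finite X"
    and act: "\<And>i. i \<in> X \<Longrightarrow> act \<one> i = i" "\<And>i d e. i \<in> X \<Longrightarrow> d \<in> D \<Longrightarrow> e \<in> D \<Longrightarrow> act (d \<otimes> e) i = act d (act e i)"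
      "\<And>i d. i \<in> X \<Longrightarrow> d \<in> D \<Longrightarrow> act d i \<in> X"
    and free: "\<And>i. i \<in> X \<Longrightarrow> \<exists>d\<in>D. act d i \<noteq> i"
    and F: "\<And>i d. i \<in> X \<Longrightarrow> d \<in> D \<Longrightarrow> F (act d i) = ga_conj G (inv d) (F i)"
    and sup: "\<And>i. i \<in> X \<Longrightarrow> F i \<in> supported (carrier G)"
  shows "(\<Sum>i\<in>X. F i) \<in> ga_fixed G D \<and> \<phi> (rel_trace G D (\<Sum>i\<in>X. F i)) = 0"
  using fin act free F sup
proof (induction "card X" arbitrary: X rule: less_induct)
  case less
  have D': "subgroup D G" using D by (simp add: defect_group_def)
  have DG: "\<And>d. d \<in> D \<Longrightarrow> d \<in> carrier G" by (rule subgroup.mem_carrier[OF D'])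
  have Dm: "\<And>d e. d \<in> D \<Longrightarrow> e \<in> D \<Longrightarrow> d \<otimes> e \<in> D" and Di: "\<And>d. d \<in> D \<Longrightarrow> inv d \<in> D" and D1: "\<one> \<in> D"
    using D' by (auto intro: subgroup.m_closed subgroup.m_inv_closed subgroup.one_closed)
  show ?case
  proof (cases "X = {}")
    case True
    have "0 \<in> ga_fixed G D" by (auto simp: ga_fixed_def group_algebra_eq supported_def ga_conj_def)
    then show ?thesis using True hom_0[OF \<phi>(1)] by simp
  next
    case False
    then obtain i0 where i0: "i0 \<in> X" by auto
    define O' where "O' = (\<lambda>d. act d i0) ` D"
    define Q where "Q = {d \<in> D. act d i0 = i0}"
    have OX: "O' \<subseteq> X" using less.prems(4) i0 by (auto simp: O'_def)
    have act_mult: "act (d \<otimes> e) i0 = act d (act e i0)" if "d \<in> D" "e \<in> D" for d e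
      using less.prems(3)[OF i0 that] .
    note orb = rel_trace_orbit[where act = act and F = F and ?i0.0 = i0, OF D' less.prems(2)[OF i0] act_mult
        less.prems(6)[OF i0] less.prems(7)[OF i0], folded O'_def Q_def]
    have QD: "Q \<subset> D" using less.prems(5)[OF i0] by (auto simp: Q_def)
    have zero: "\<phi> (rel_trace G D (\<Sum>i\<in>O'. F i)) = 0"
      using trace_from_smaller_vanishes[OF B D \<phi> orb(1) QD orb(2)] orb(3) by simp
    have Oclosed: "act d i \<in> O'" if "i \<in> O'" "d \<in> D" for i d
      using that Dm by (auto simp: O'_def act_mult[symmetric])
    have Ofix: "(\<Sum>i\<in>O'. F i) \<in> ga_fixed G D"
    proof -
      have "ga_conj G d (\<Sum>i\<in>O'. F i) = (\<Sum>i\<in>O'. F i)" if d: "d \<in> D" for d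
      proof -
        have "ga_conj G d (\<Sum>i\<in>O'. F i) = (\<Sum>i\<in>O'. F (act (inv d) i))"
          unfolding ga_conj_sum using d Di DG OX less.prems(6) by (intro sum.cong) auto
        also have "\<dots> = (\<Sum>i\<in>O'. F i)"
        proof (rule sum.reindex_bij_witness[of _ "act d" "act (inv d)"])
          fix i assume i: "i \<in> O'"
          then have iX: "i \<in> X" using OX by auto
          show "act (inv d) i \<in> O'" "act d i \<in> O'" using Oclosed i d Di by auto
          show "act d (act (inv d) i) = i" "act (inv d) (act d i) = i"
            using less.prems(2)[OF iX] less.prems(3)[OF iX d Di[OF d]] less.prems(3)[OF iX Di[OF d] d] DG[OF d] by simp_all
        qed simp
        finally show ?thesis .
      qed
      moreover have "(\<Sum>i\<in>O'. F i) \<in> supported (carrier G)"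
        using less.prems(7) OX by (intro fun_space.subspace_sum[OF subspace_supported]) auto
      ultimately show ?thesis by (auto simp: ga_fixed_def group_algebra_eq)
    qed
    have i0O: "i0 \<in> O'" using D1 less.prems(2)[OF i0] by (force simp: O'_def)
    have "card (X - O') < card X"
      using less.prems(1) i0 i0O by (intro psubset_card_mono) auto
    moreover have "act d i \<in> X - O'" if i: "i \<in> X - O'" and d: "d \<in> D" for i d
    proof -
      have iX: "i \<in> X" using i by simp
      have "act (inv d) (act d i) = i" using less.prems(2)[OF iX] less.prems(3)[OF iX Di[OF d] d] DG[OF d] by simp
      then have "act d i \<notin> O'" using Oclosed[OF _ Di[OF d], of "act d i"] i by auto
      then show ?thesis using less.prems(4)[OF iX d] by simp
    qed
    ultimately have IH: "(\<Sum>i\<in>X - O'. F i) \<in> ga_fixed G D \<and> \<phi> (rel_trace G D (\<Sum>i\<in>X - O'. F i)) = 0"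
      using less.prems by (intro less.hyps) auto
    have split: "(\<Sum>i\<in>X. F i) = (\<Sum>i\<in>X - O'. F i) + (\<Sum>i\<in>O'. F i)"
      using sum.subset_diff[OF OX less.prems(1)] .
    show ?thesis unfolding split rel_trace_add
      using IH Ofix zero hom_add[OF \<phi>(1) rel_trace_center[OF D'] rel_trace_center[OF D']] by (auto intro: ga_fixed_add)
  qed
qed

lemma block_char_fixed_point_free_sum:
  fixes F :: "'i \<Rightarrow> 'a \<Rightarrow> 'c::field"
  assumes B: "B \<in> blocks G" and D: "defect_group G B D" and \<phi>: "center_alg_hom G \<phi>" "\<phi> B = 1"
    and a: "B = rel_trace G D a" and P: "P \<in> ga_center G" "P \<star> a = (\<Sum>i\<in>X. F i)"
    and fin: "finite X"
    and act: "\<And>i. i \<in> X \<Longrightarrow> act \<one> i = i" "\<And>i d e. i \<in> X \<Longrightarrow> d \<in> D \<Longrightarrow> e \<in> D \<Longrightarrow> act (d \<otimes> e) i = act d (act e i)"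
      "\<And>i d. i \<in> X \<Longrightarrow> d \<in> D \<Longrightarrow> act d i \<in> X"
    and free: "\<And>i. i \<in> X \<Longrightarrow> \<exists>d\<in>D. act d i \<noteq> i"
    and F: "\<And>i d. i \<in> X \<Longrightarrow> d \<in> D \<Longrightarrow> F (act d i) = ga_conj G (inv d) (F i)"
    and sup: "\<And>i. i \<in> X \<Longrightarrow> F i \<in> supported (carrier G)"
  shows "\<phi> P = 0"
proof -
  have D': "subgroup D G" using D by (simp add: defect_group_def)
  have "\<phi> P = \<phi> (P \<star> B)" using hom_mult[OF \<phi>(1) P(1) blockD(1)[OF B]] \<phi>(2) by simp
  also have "P \<star> B = rel_trace G D (\<Sum>i\<in>X. F i)"
    using rel_trace_conv_left[OF D' P(1)] a P(2) by metis
  also have "\<phi> \<dots> = 0"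
    using trace_fixed_point_free_vanishes[where act = act, OF B D \<phi> fin act free F sup] by simp
  finally show ?thesis .
qed


section \<open>Group algebras of subgroups\<close>

abbreviation sub :: "'a set \<Rightarrow> ('a, 'b) monoid_scheme" where
  "sub S \<equiv> G\<lparr>carrier := S\<rparr>"

lemma sub_finite_group: "subgroup S G \<Longrightarrow> finite_group (sub S)"
  using subgroup_imp_group[of S] finite_subset[OF subgroup.subset finite_carrier, of S]
  by (simp add: finite_group_def finite_group_axioms_def)

text \<open>
  All computations for subgroups take place in the convolution algebra of \<open>G\<close>; this lemma and the next ones
  translate the notions for the group \<open>sub S\<close>.
\<close>
lemma sub_mult:
  assumes S: "subgroup S G" and ab: "a \<in> supported S" "b \<in> supported S"
  shows "ga_mult (sub S) a b = a \<star> b"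
proof
  fix x
  have SG: "S \<subseteq> carrier G" by (rule subgroup.subset[OF S])
  show "ga_mult (sub S) a b x = (a \<star> b) x"
  proof (cases "x \<in> S")
    case True
    have "(\<Sum>y\<in>S. a y * b (inv\<^bsub>sub S\<^esub> y \<otimes> x)) = (\<Sum>y\<in>carrier G. a y * b (inv y \<otimes> x))"
      using SG ab by (intro sum.mono_neutral_cong_left) (auto simp: m_inv_consistent[OF S] supported_def)
    then show ?thesis using True SG by (auto simp: ga_mult_def)
  next
    case False
    then have "(a \<star> b) x = 0" using conv_sub_supported[OF S ab] by (simp add: supported_def)
    then show ?thesis using False by (simp add: ga_mult_def)
  qed
qed

lemma conj_mem_subgroup:
  assumes S: "subgroup S G" and n: "n \<in> S" and x: "x \<in> carrier G"
  shows "n \<otimes> x \<otimes> inv n \<in> S \<longleftrightarrow> x \<in> S"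
proof
  have nG: "n \<in> carrier G" using n by (rule subgroup.mem_carrier[OF S])
  assume "n \<otimes> x \<otimes> inv n \<in> S"
  then have "inv n \<otimes> (n \<otimes> x \<otimes> inv n) \<otimes> n \<in> S"
    by (rule subgroup.m_closed[OF S subgroup.m_closed[OF S subgroup.m_inv_closed[OF S n]] n])
  then show "x \<in> S" using conj_cancel[OF nG x] by simp
qed (use n S in \<open>auto intro: subgroup.m_closed subgroup.m_inv_closed\<close>)

lemma sub_center:
  assumes S: "subgroup S G"
  shows "ga_center (sub S) = invariants S S"
proof -
  interpret S: finite_group "sub S" by (rule sub_finite_group[OF S])
  have SG: "S \<subseteq> carrier G" by (rule subgroup.subset[OF S])
  have "a (n \<otimes> x \<otimes> inv n) = a x"
    if "a \<in> supported S" "\<forall>n\<in>S. \<forall>x\<in>S. a (n \<otimes> x \<otimes> inv n) = a x" "n \<in> S" "x \<in> carrier G" for a :: "'a \<Rightarrow> 'c" and n x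
    using that conj_mem_subgroup[OF S, of n x] by (cases "x \<in> S") (auto simp: supported_def)
  then show ?thesis
    unfolding S.ga_center_eq S.invariants_def invariants_def using SG by (auto simp: m_inv_consistent[OF S])
qed

lemma sub_pow:
  assumes S: "subgroup S G" and a: "a \<in> supported S"
  shows "finite_group.ga_pow (sub S) a n = ga_pow a n" "ga_pow a n \<in> supported S"
proof -
  interpret S: finite_group "sub S" by (rule sub_finite_group[OF S])
  have "S.ga_pow a n = ga_pow a n \<and> ga_pow a n \<in> supported S"
    by (induction n) (auto simp: unit_supported[OF S] sub_mult[OF S _ a] conv_sub_supported[OF S _ a])
  then show "finite_group.ga_pow (sub S) a n = ga_pow a n" "ga_pow a n \<in> supported S" by auto
qed

lemma restr_conv_left:
  assumes S: "subgroup S G" and a: "a \<in> supported S"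
  shows "restr S (a \<star> b) = a \<star> restr S b"
proof
  fix x
  have SG: "S \<subseteq> carrier G" by (rule subgroup.subset[OF S])
  show "restr S (a \<star> b) x = (a \<star> restr S b) x"
  proof (cases "x \<in> S")
    case True
    have "a y * b (inv y \<otimes> x) = a y * restr S b (inv y \<otimes> x)" for y
      using True a subgroup.m_closed[OF S subgroup.m_inv_closed[OF S], of y x]
      by (cases "y \<in> S") (auto simp: restr_def supported_def)
    then have "(\<Sum>y\<in>carrier G. a y * b (inv y \<otimes> x)) = (\<Sum>y\<in>carrier G. a y * restr S b (inv y \<otimes> x))"
      by (intro sum.cong refl)
    then show ?thesis using True SG by (auto simp: restr_def[of S "a \<star> b"] ga_mult_def)
  next
    case False
    have "a \<star> restr S b \<in> supported S" by (rule conv_sub_supported[OF S a restr_supported])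
    then show ?thesis using False by (simp add: restr_def[of S "a \<star> b"] supported_def)
  qed
qed

lemma restr_conv_right:
  assumes S: "subgroup S G" and b: "b \<in> supported S"
  shows "restr S (a \<star> b) = restr S a \<star> b"
proof
  fix x
  have SG: "S \<subseteq> carrier G" by (rule subgroup.subset[OF S])
  show "restr S (a \<star> b) x = (restr S a \<star> b) x"
  proof (cases "x \<in> S")
    case True
    have "a y * b (inv y \<otimes> x) = restr S a y * b (inv y \<otimes> x)" if y: "y \<in> carrier G" for y
    proof (cases "y \<in> S")
      case False
      have "inv y \<otimes> x \<notin> S"
      proof
        assume "inv y \<otimes> x \<in> S"
        then have "x \<otimes> inv (inv y \<otimes> x) \<in> S" using True S by (auto intro: subgroup.m_closed subgroup.m_inv_closed)
        moreover have "x \<otimes> inv (inv y \<otimes> x) = y" using y True SG by (auto simp: inv_mult_group)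
        ultimately show False using False by simp
      qed
      then show ?thesis using b by (simp add: supported_def)
    qed (simp add: restr_def)
    then have "(\<Sum>y\<in>carrier G. a y * b (inv y \<otimes> x)) = (\<Sum>y\<in>carrier G. restr S a y * b (inv y \<otimes> x))"
      by (intro sum.cong refl)
    then show ?thesis using True SG by (auto simp: restr_def[of S "a \<star> b"] ga_mult_def)
  next
    case False
    have "restr S a \<star> b \<in> supported S" by (rule conv_sub_supported[OF S restr_supported b])
    then show ?thesis using False by (simp add: restr_def[of S "a \<star> b"] supported_def)
  qed
qed

lemma restr_invariants:
  assumes a: "a \<in> invariants S X" and Y: "\<And>n x. n \<in> X \<Longrightarrow> x \<in> carrier G \<Longrightarrow> n \<otimes> x \<otimes> inv n \<in> T \<longleftrightarrow> x \<in> T"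
  shows "restr T a \<in> invariants S X"
  using assms by (auto simp: invariants_def restr_def supported_def)

lemma invariants_support: "a \<in> invariants S X \<Longrightarrow> a \<in> supported T \<Longrightarrow> a \<in> invariants T X"
  by (auto simp: invariants_def)

lemma restr_to_invariants:
  assumes X: "subgroup X G" and a: "a \<in> invariants S X"
  shows "restr X a \<in> invariants X X"
proof -
  have "restr X a \<in> invariants S X" using conj_mem_subgroup[OF X] by (intro restr_invariants[OF a])
  then show ?thesis by (rule invariants_support) simp
qed

section \<open>The radical of the trace form\<close>

text \<open>
  The radical of the form \<open>(u, y) \<mapsto> \<phi>(\<pi>\<^sub>X(u y))\<close> on \<open>(kS)\<^sup>X\<close>, where \<open>\<phi>\<close> will be the central character
  of a block of \<open>X\<close>. Placing the radical element on the left makes it a right ideal.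
\<close>
definition trace_radical :: "'a set \<Rightarrow> 'a set \<Rightarrow> (('a \<Rightarrow> 'c::field) \<Rightarrow> 'c) \<Rightarrow> ('a \<Rightarrow> 'c) set" where
  "trace_radical S X \<phi> = {u \<in> invariants S X. \<forall>y\<in>invariants S X. \<phi> (restr X (u \<star> y)) = 0}"

lemma trace_radical_conv:
  assumes "subgroup S G" "X \<subseteq> carrier G" "u \<in> trace_radical S X \<phi>" "y \<in> invariants S X"
  shows "u \<star> y \<in> trace_radical S X \<phi>"
  using assms invariants_conv[OF assms(1,2)] by (auto simp: trace_radical_def conv_assoc)

lemma trace_radical_zero:
  assumes "subgroup S G" "X \<subseteq> carrier G" "u \<in> trace_radical S X \<phi>"
  shows "\<phi> (restr X u) = 0"
proof -
  have "u \<in> supported S" using assms by (auto simp: trace_radical_def invariants_def)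
  then have "u \<star> \<epsilon> = u" using subgroup.subset[OF assms(1)] by (intro conv_unit') (rule supported_mono)
  then show ?thesis using assms invariants_unit[OF assms(1,2)] by (auto simp: trace_radical_def)
qed

context
  fixes S X :: "'a set" and c :: "'a \<Rightarrow> 'c::field" and \<phi> :: "('a \<Rightarrow> 'c) \<Rightarrow> 'c"
  assumes S: "subgroup S G" and X: "subgroup X G" and XS: "X \<subseteq> S"
    and normal: "\<And>s x. s \<in> S \<Longrightarrow> x \<in> X \<Longrightarrow> s \<otimes> x \<otimes> inv s \<in> X"
    and c: "c \<in> invariants X X" "c \<star> c = c"
    and nil: "\<And>w. w \<in> invariants X X \<Longrightarrow> \<phi> w = 0 \<Longrightarrow> \<exists>n. ga_pow w n \<star> c = 0"
begin

lemma SG: "S \<subseteq> carrier G" and XG: "X \<subseteq> carrier G"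
  by (rule subgroup.subset[OF S]) (rule subgroup.subset[OF X])

lemma normal': "s \<in> S \<Longrightarrow> x \<in> X \<Longrightarrow> inv s \<otimes> x \<otimes> s \<in> X"
  using normal[of "inv s" x] subgroup.m_inv_closed[OF S, of s] SG by auto

lemma coset_eqI: "g \<in> carrier G \<Longrightarrow> h \<in> X #> g \<Longrightarrow> X #> h = X #> g"
  using repr_independence[of h X g] X by auto

text \<open>
  The components of an element of \<open>(kS)\<^sup>X\<close> for the grading by \<open>S/X\<close> are its restrictions to cosets of
  \<open>X\<close>; by normality they are again invariant, and coset supports multiply.
\<close>
lemma coset_restr_invariants:
  assumes e: "e \<in> invariants S X" and g: "g \<in> S"
  shows "restr (X #> g) e \<in> invariants S X"
proof (rule restr_invariants[OF e])
  fix n x assume n: "n \<in> X" and x: "x \<in> carrier G"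
  have gG: "g \<in> carrier G" and nG: "n \<in> carrier G" using g SG n XG by auto
  have fwd: "n \<otimes> x \<otimes> inv n \<in> X #> g" if nx: "n \<in> X" "x \<in> X #> g" for n x
  proof -
    have nG: "n \<in> carrier G" using nx XG by auto
    obtain y where y: "y \<in> X" "x = y \<otimes> g" using nx by (auto simp: r_coset_def)
    have "g \<otimes> inv n \<otimes> inv g \<in> X" using normal[OF g subgroup.m_inv_closed[OF X nx(1)]] .
    then have "n \<otimes> y \<otimes> (g \<otimes> inv n \<otimes> inv g) \<in> X" using y nx X by (auto intro: subgroup.m_closed)
    moreover have "n \<otimes> x \<otimes> inv n = n \<otimes> y \<otimes> (g \<otimes> inv n \<otimes> inv g) \<otimes> g"
      using y gG nG XG by (auto simp: m_assoc subset_iff)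
    ultimately show ?thesis by (auto simp: r_coset_def)
  qed
  show "(n \<otimes> x \<otimes> inv n \<in> X #> g) = (x \<in> X #> g)"
  proof
    assume "n \<otimes> x \<otimes> inv n \<in> X #> g"
    from fwd[OF subgroup.m_inv_closed[OF X n] this] show "x \<in> X #> g" using conj_cancel[OF nG x] nG by simp
  qed (rule fwd[OF n])
qed

lemma coset_conv_supported:
  assumes g: "g \<in> S" "h \<in> S" and a: "a \<in> supported (X #> g)" and b: "b \<in> supported (X #> h)"
  shows "a \<star> b \<in> supported (X #> (g \<otimes> h))"
  unfolding supported_def
proof safe
  fix x assume x: "x \<notin> X #> (g \<otimes> h)"
  have gG: "g \<in> carrier G" "h \<in> carrier G" using g SG by auto
  show "(a \<star> b) x = 0"
  proof (cases "x \<in> carrier G")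
    case True
    have "a y * b (inv y \<otimes> x) = 0" if y: "y \<in> carrier G" for y
    proof (rule ccontr)
      assume "a y * b (inv y \<otimes> x) \<noteq> 0"
      then have "y \<in> X #> g" "inv y \<otimes> x \<in> X #> h" using a b by (auto simp: supported_def)
      then obtain u w where u: "u \<in> X" "y = u \<otimes> g" and w: "w \<in> X" "inv y \<otimes> x = w \<otimes> h" by (auto simp: r_coset_def)
      have uw: "u \<in> carrier G" "w \<in> carrier G" using u w XG by auto
      have "x = y \<otimes> (inv y \<otimes> x)" using y True by simp
      also have "\<dots> = (u \<otimes> (g \<otimes> w \<otimes> inv g)) \<otimes> (g \<otimes> h)"
        unfolding w(2) unfolding u(2) using gG uw by (simp add: m_assoc)
      finally have "x = (u \<otimes> (g \<otimes> w \<otimes> inv g)) \<otimes> (g \<otimes> h)" .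
      moreover have "u \<otimes> (g \<otimes> w \<otimes> inv g) \<in> X" using u w normal g X by (auto intro: subgroup.m_closed)
      ultimately show False using x by (auto simp: r_coset_def)
    qed
    then show ?thesis unfolding conv_apply[OF True] by (intro sum.neutral) simp
  qed (simp add: ga_mult_def)
qed

text \<open>
  The form only pairs components of inverse degrees, so a component of \<open>e\<close> paired with \<open>y\<close> gives the
  same value as \<open>e\<close> paired with the component of \<open>y\<close> of inverse degree.
\<close>
lemma coset_component_radical:
  assumes e: "e \<in> trace_radical S X \<phi>" and g: "g \<in> S"
  shows "restr (X #> g) e \<in> trace_radical S X \<phi>"
proof -
  have eS: "e \<in> invariants S X" using e by (simp add: trace_radical_def)
  have gG: "g \<in> carrier G" and gi: "inv g \<in> S" using g SG S by (auto intro: subgroup.m_inv_closed)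
  have "\<phi> (restr X (restr (X #> g) e \<star> y)) = 0" if y: "y \<in> invariants S X" for y
  proof -
    have iff: "u \<in> X #> g \<longleftrightarrow> inv u \<otimes> x \<in> X #> inv g" if x: "x \<in> X" and u: "u \<in> carrier G" for x u
    proof
      have xG: "x \<in> carrier G" using x XG by auto
      assume "u \<in> X #> g"
      then obtain w where w: "w \<in> X" "u = w \<otimes> g" by (auto simp: r_coset_def)
      have wG: "w \<in> carrier G" using w XG by auto
      have "inv w \<otimes> x \<in> X" using w x X by (auto intro: subgroup.m_closed subgroup.m_inv_closed)
      from normal'[OF g this] have "inv g \<otimes> (inv w \<otimes> x) \<otimes> g \<in> X" .
      moreover have "inv u \<otimes> x = (inv g \<otimes> (inv w \<otimes> x) \<otimes> g) \<otimes> inv g"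
        using w(2) wG gG xG by (simp add: inv_mult_group m_assoc)
      ultimately show "inv u \<otimes> x \<in> X #> inv g" by (auto simp: r_coset_def)
    next
      have xG: "x \<in> carrier G" using x XG by auto
      assume "inv u \<otimes> x \<in> X #> inv g"
      then obtain w where w: "w \<in> X" "inv u \<otimes> x = w \<otimes> inv g" by (auto simp: r_coset_def)
      have wG: "w \<in> carrier G" using w XG by auto
      have "u = x \<otimes> inv (inv u \<otimes> x)" using u xG by (simp add: inv_mult_group)
      also have "\<dots> = (x \<otimes> (g \<otimes> inv w \<otimes> inv g)) \<otimes> g" unfolding w(2) using wG gG xG by (simp add: inv_mult_group m_assoc)
      finally have "u = (x \<otimes> (g \<otimes> inv w \<otimes> inv g)) \<otimes> g" .
      moreover have "x \<otimes> (g \<otimes> inv w \<otimes> inv g) \<in> X"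
        using x normal[OF g subgroup.m_inv_closed[OF X w(1)]] X by (auto intro: subgroup.m_closed)
      ultimately show "u \<in> X #> g" by (auto simp: r_coset_def)
    qed
    have "restr X (restr (X #> g) e \<star> y) = restr X (e \<star> restr (X #> inv g) y)"
    proof
      fix x
      show "restr X (restr (X #> g) e \<star> y) x = restr X (e \<star> restr (X #> inv g) y) x"
      proof (cases "x \<in> X")
        case True
        then have xG: "x \<in> carrier G" using XG by auto
        have "(\<Sum>u\<in>carrier G. restr (X #> g) e u * y (inv u \<otimes> x)) = (\<Sum>u\<in>carrier G. e u * restr (X #> inv g) y (inv u \<otimes> x))"
          using iff[OF True] by (intro sum.cong) (auto simp: restr_def)
        then show ?thesis using True xG by (simp add: restr_def[of X] conv_apply)
      qed (simp add: restr_def[of X])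
    qed
    moreover have "restr (X #> inv g) y \<in> invariants S X" by (rule coset_restr_invariants[OF y gi])
    ultimately show ?thesis using e by (simp add: trace_radical_def)
  qed
  then show ?thesis using coset_restr_invariants[OF eS g] by (simp add: trace_radical_def)
qed

lemma sum_coset_components:
  assumes "e \<in> supported S"
  shows "e = (\<Sum>C\<in>(\<lambda>g. X #> g) ` S. restr C e)"
proof
  have fin: "finite S" using SG finite_carrier finite_subset by blast
  fix x
  show "e x = (\<Sum>C\<in>(\<lambda>g. X #> g) ` S. restr C e) x"
  proof (cases "x \<in> S")
    case True
    have "x \<in> C \<longleftrightarrow> C = X #> x" if "C \<in> (\<lambda>g. X #> g) ` S" for C
      using that coset_eqI SG rcos_self[OF _ X, of x] True by auto
    then have "(\<Sum>C\<in>(\<lambda>g. X #> g) ` S. restr C e x) = (\<Sum>C\<in>(\<lambda>g. X #> g) ` S. if C = X #> x then e x else 0)"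
      by (intro sum.cong) (auto simp: restr_def)
    also have "\<dots> = e x" using True fin by (simp add: sum.delta)
    finally show ?thesis by (simp add: sum_fun_apply)
  next
    case False
    then have "e x = 0" using assms by (simp add: supported_def)
    then show ?thesis by (auto simp: sum_fun_apply restr_def intro!: sum.neutral)
  qed
qed

text \<open>
  If \<open>c e \<noteq> 0\<close>, start with \<open>a = c\<close> and use \<open>a e = a e e\<close>: some component \<open>e\<^sub>C\<close> of \<open>e\<close> satisfies
  \<open>a e\<^sub>C e \<noteq> 0\<close>, and \<open>a\<close> is replaced by \<open>a e\<^sub>C\<close>. This walk goes on forever, and all its members are
  homogeneous. One of the finitely many degrees occurs infinitely often; among the members \<open>a\<^sub>i\<close> of that
  degree pick one with \<open>a\<^sub>i Z(kX)\<close> of smallest dimension. At the next visit \<open>a\<^sub>i\<close> has been multiplied by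
  some \<open>w\<close> in the radical of degree \<open>1\<close>. By minimality \<open>a\<^sub>i = a\<^sub>i w z\<close> with \<open>z\<close> in \<open>Z(kX)\<close>, but
  \<open>w z\<close> is nilpotent on \<open>c\<close>, so \<open>a\<^sub>i = 0\<close>, a contradiction.
\<close>
lemma radical_idempotent_zero:
  assumes e: "e \<in> trace_radical S X \<phi>" "e \<star> e = e"
  shows "c \<star> e = 0"
proof (rule ccontr)
  assume ne: "c \<star> e \<noteq> 0"
  have eI: "e \<in> invariants S X" using e by (simp add: trace_radical_def)
  have cI: "c \<in> invariants S X" using invariants_mono[OF c(1) XS order_refl] .
  note conv_inv = invariants_conv[OF S XG]
  define good where "good a g \<longleftrightarrow> a \<in> invariants S X \<and> a \<in> supported (X #> g) \<and> g \<in> S \<and> a \<star> c = a \<and> a \<star> e \<noteq> 0" for a g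
  have start: "good c \<one>"
    using cI c ne subgroup.one_closed[OF S] XG
    by (auto simp: good_def coset_mult_one invariants_supported)
  have step: "\<exists>h\<in>S. good (a \<star> restr (X #> h) e) (g \<otimes> h)" if good: "good a g" for a g
  proof -
    have "a \<star> e = (\<Sum>C\<in>(\<lambda>g. X #> g) ` S. a \<star> restr C e \<star> e)"
    proof -
      have "a \<star> e = a \<star> e \<star> e" using e(2) by (simp add: conv_assoc)
      also have "\<dots> = a \<star> (\<Sum>C\<in>(\<lambda>g. X #> g) ` S. restr C e) \<star> e"
        using sum_coset_components[OF invariants_supported[OF eI]] by simp
      finally show ?thesis by (simp add: conv_sum_left conv_sum_right)
    qed
    moreover have "a \<star> e \<noteq> 0" using good by (simp add: good_def)
    ultimately obtain C where "C \<in> (\<lambda>g. X #> g) ` S" "a \<star> restr C e \<star> e \<noteq> 0"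
      by (metis (no_types, lifting) sum.neutral)
    then obtain h where h: "h \<in> S" "a \<star> restr (X #> h) e \<star> e \<noteq> 0" by auto
    have eh: "restr (X #> h) e \<in> invariants S X" by (rule coset_restr_invariants[OF eI h(1)])
    have "a \<star> restr (X #> h) e \<star> c = a \<star> c \<star> restr (X #> h) e"
      using invariants_commute[OF XG SG eh invariants_supported[OF c(1)]] by (simp add: conv_assoc)
    then have "a \<star> restr (X #> h) e \<star> c = a \<star> restr (X #> h) e" using good by (simp add: good_def)
    then show ?thesis using h good eh conv_inv subgroup.m_closed[OF S]
      by (intro bexI[of _ h]) (auto simp: good_def intro!: coset_conv_supported)
  qed
  define R where "R p q \<longleftrightarrow> (\<exists>h\<in>S. q = (fst p \<star> restr (X #> h) e, snd p \<otimes> h))" for p q :: "('a \<Rightarrow> 'c) \<times> 'a"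
  have "\<exists>s. \<forall>n::nat. good (fst (s n)) (snd (s n)) \<and> R (s n) (s (Suc n))"
  proof (rule dependent_nat_choice)
    show "\<exists>q. good (fst q) (snd q)" using start by (intro exI[of _ "(c, \<one>)"]) simp
    fix q :: "('a \<Rightarrow> 'c) \<times> 'a" and n :: nat assume "good (fst q) (snd q)"
    then obtain h where "h \<in> S" "good (fst q \<star> restr (X #> h) e) (snd q \<otimes> h)" using step by blast
    then show "\<exists>q'. good (fst q') (snd q') \<and> R q q'"
      by (intro exI[of _ "(fst q \<star> restr (X #> h) e, snd q \<otimes> h)"]) (auto simp: R_def)
  qed
  then obtain s where s: "\<And>n. good (fst (s n)) (snd (s n))" "\<And>n. R (s n) (s (Suc n))" by blast
  define a g where "a n = fst (s n)" and "g n = snd (s n)" for n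
  have good: "good (a n) (g n)" for n using s(1) by (simp add: a_def g_def)
  have nxt: "\<exists>h\<in>S. a (Suc n) = a n \<star> restr (X #> h) e \<and> g (Suc n) = g n \<otimes> h" for n
    using s(2)[of n] by (auto simp: R_def a_def g_def)
  have path: "\<exists>w h. w \<in> trace_radical S X \<phi> \<and> h \<in> S \<and> w \<in> supported (X #> h) \<and> a (Suc (i + d)) = a i \<star> w \<and> g (Suc (i + d)) = g i \<otimes> h" for i d
  proof (induction d)
    case 0
    obtain h where "h \<in> S" "a (Suc i) = a i \<star> restr (X #> h) e" "g (Suc i) = g i \<otimes> h" using nxt by blast
    then show ?case using coset_component_radical[OF e(1)]
      by (intro exI[of _ "restr (X #> h) e"] exI[of _ h]) auto
  next
    case (Suc d)
    then obtain w h where w: "w \<in> trace_radical S X \<phi>" "h \<in> S" "w \<in> supported (X #> h)" "a (Suc (i + d)) = a i \<star> w" "g (Suc (i + d)) = g i \<otimes> h" by blast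
    obtain k where k: "k \<in> S" "a (Suc (Suc (i + d))) = a (Suc (i + d)) \<star> restr (X #> k) e" "g (Suc (Suc (i + d))) = g (Suc (i + d)) \<otimes> k" using nxt by blast
    have gi: "g i \<in> S" using good by (simp add: good_def)
    have "g (Suc (Suc (i + d))) = g i \<otimes> (h \<otimes> k)"
      unfolding k(3) w(5) using gi w(2) k(1) SG by (intro m_assoc) auto
    moreover have "w \<star> restr (X #> k) e \<in> trace_radical S X \<phi>"
      using trace_radical_conv[OF S XG w(1) coset_restr_invariants[OF eI k(1)]] .
    moreover have "w \<star> restr (X #> k) e \<in> supported (X #> (h \<otimes> k))"
      using coset_conv_supported[OF w(2) k(1) w(3)] by simp
    ultimately show ?case using k w subgroup.m_closed[OF S w(2) k(1)]
      by (intro exI[of _ "w \<star> restr (X #> k) e"] exI[of _ "h \<otimes> k"]) (auto simp: conv_assoc)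
  qed
  have "finite (range (\<lambda>n. X #> g n))"
  proof (rule finite_subset)
    show "range (\<lambda>n. X #> g n) \<subseteq> (\<lambda>h. X #> h) ` S" using good by (auto simp: good_def)
    show "finite ((\<lambda>h. X #> h) ` S)" using SG finite_carrier finite_subset by blast
  qed
  then obtain n0 where inf: "infinite {n. X #> g n = X #> g n0}"
    using pigeonhole_infinite[of "UNIV :: nat set" "\<lambda>n. X #> g n"] by auto
  define T where "T = {n. X #> g n = X #> g n0}"
  define U where "U n = (\<star>) (a n) ` invariants X X" for n
  obtain i where i: "i \<in> T" and min: "\<And>j. j \<in> T \<Longrightarrow> fun_space.dim (U i) \<le> fun_space.dim (U j)"
    using ex_has_least_nat[of "\<lambda>n. n \<in> T" n0 "\<lambda>n. fun_space.dim (U n)"] by (auto simp: T_def)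
  have "infinite T" using inf by (simp add: T_def)
  then obtain j where j: "j \<in> T" "i < j" using infinite_nat_iff_unbounded by blast
  define d where "d = j - Suc i"
  have jd: "j = Suc (i + d)" using j by (simp add: d_def)
  obtain w h where w: "w \<in> trace_radical S X \<phi>" "h \<in> S" "w \<in> supported (X #> h)" "a j = a i \<star> w" "g j = g i \<otimes> h"
    using path[of i d] unfolding jd by blast
  have gi: "g i \<in> S" "g i \<in> carrier G" using good[of i] SG by (auto simp: good_def)
  have hG: "h \<in> carrier G" using w SG by auto
  have "h \<in> X"
  proof -
    have "X #> g j = X #> g i" using i j by (simp add: T_def)
    then have "g j \<in> X #> g i" using rcos_self[OF _ X, of "g j"] gi hG w(5) by auto
    then obtain x where x: "x \<in> X" "g i \<otimes> h = x \<otimes> g i" using w(5) by (auto simp: r_coset_def)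
    have "h = inv (g i) \<otimes> (g i \<otimes> h)" using gi hG by simp
    also have "\<dots> = inv (g i) \<otimes> x \<otimes> g i" unfolding x(2) using gi x XG by (auto simp: m_assoc)
    finally show ?thesis using normal'[OF gi(1) x(1)] by simp
  qed
  then have "X #> h = X" using coset_join2[OF hG X] by simp
  then have wX: "w \<in> invariants X X" using w by (auto simp: trace_radical_def intro: invariants_support)
  have subU: "fun_space.subspace (U n)" for n
    unfolding U_def by (rule subspace_conv_image[OF subspace_invariants])
  have "U j \<subseteq> U i" unfolding U_def w(4) using invariants_conv[OF X XG wX] by (auto simp: conv_assoc)
  then have "U j = U i"
    by (intro subspace_eq_if_dim_le[OF finite_carrier subU _ _ min[OF j(1)]]) (auto simp: U_def)
  moreover have ai: "a i \<in> supported (carrier G)" using good[of i] SG by (auto simp: good_def intro: supported_mono[OF invariants_supported])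
  then have "a i \<in> U i" unfolding U_def by (intro image_eqI[of _ _ \<epsilon>] invariants_unit[OF X XG]) simp
  ultimately obtain z where z: "z \<in> invariants X X" "a i = a i \<star> w \<star> z" by (auto simp: U_def w(4))
  define q where "q = w \<star> z"
  have q: "q \<in> invariants X X" "a i \<star> q = a i"
    using invariants_conv[OF X XG wX z(1)] z(2) by (simp_all add: q_def conv_assoc)
  have "q \<in> trace_radical S X \<phi>"
    unfolding q_def using trace_radical_conv[OF S XG w(1)] invariants_mono[OF z(1) XS order_refl] by blast
  then have "\<phi> q = 0" using trace_radical_zero[OF S XG, of q \<phi>] restr_id[OF invariants_supported[OF q(1)]] by simp
  then obtain n where n: "ga_pow q n \<star> c = 0" using nil q(1) by blast
  have "a i \<star> ga_pow q m = a i" for m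
  proof (induction m)
    case 0 then show ?case using ai by simp
  next
    case (Suc m)
    have "a i \<star> ga_pow q (Suc m) = (a i \<star> ga_pow q m) \<star> q" by (simp add: conv_assoc)
    then show ?case using Suc q(2) by simp
  qed
  then have "a i \<star> c = a i \<star> (ga_pow q n \<star> c)" by (simp add: conv_assoc[symmetric])
  then have "a i = 0" using n good[of i] by (simp add: good_def)
  then show False using good[of i] by (simp add: good_def)
qed

end


section \<open>Blocks of subgroups\<close>

context
  fixes S :: "'a set"
  assumes S: "subgroup S G"
begin

lemma sub_blockD:
  assumes B: "B \<in> blocks (sub S)"
  shows "B \<in> invariants S S" "B \<star> B = B" "B \<noteq> 0"
proof -
  interpret S: finite_group "sub S" by (rule sub_finite_group[OF S])
  show *: "B \<in> invariants S S" using S.blockD(1)[OF B] by (simp add: sub_center[OF S])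
  then have "B \<in> supported S" by (rule invariants_supported)
  then show "B \<star> B = B" "B \<noteq> 0" using S.blockD(2,3)[OF B] by (simp_all add: sub_mult[OF S])
qed

lemma sub_hom:
  assumes \<phi>: "center_alg_hom (sub S) \<phi>" and z: "z \<in> invariants S S" and w: "w \<in> invariants S S"
  shows "\<phi> (z + w) = \<phi> z + \<phi> w" "\<phi> (z - w) = \<phi> z - \<phi> w" "\<phi> (smul k z) = k * \<phi> z" "\<phi> (z \<star> w) = \<phi> z * \<phi> w"
proof -
  interpret S: finite_group "sub S" by (rule sub_finite_group[OF S])
  note zw = z[folded sub_center[OF S]] w[folded sub_center[OF S]]
  have m: "ga_mult (sub S) z w = z \<star> w" using z w by (simp add: sub_mult[OF S] invariants_supported)
  show "\<phi> (z + w) = \<phi> z + \<phi> w" "\<phi> (z - w) = \<phi> z - \<phi> w" "\<phi> (smul k z) = k * \<phi> z" "\<phi> (z \<star> w) = \<phi> z * \<phi> w"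
    using S.hom_add[OF \<phi> zw] S.hom_diff[OF \<phi> zw] S.hom_smul[OF \<phi> zw(1)] S.hom_mult[OF \<phi> zw] m by simp_all
qed

lemma sub_hom_0: "center_alg_hom (sub S) \<phi> \<Longrightarrow> \<phi> 0 = 0"
  by (rule finite_group.hom_0[OF sub_finite_group[OF S]])

lemma sub_block_unit:
  assumes B: "B \<in> blocks (sub S)" and \<phi>: "center_alg_hom (sub S) \<phi>" "\<phi> B = 1"
    and z: "z \<in> invariants S S" "\<phi> z \<noteq> 0"
  shows "\<exists>y\<in>invariants S S. z \<star> y = B"
  using finite_group.block_unit[OF sub_finite_group[OF S] B \<phi>, of z] z
  by (auto simp: sub_center[OF S] sub_mult[OF S] invariants_supported)

lemma sub_block_nilpotent:
  assumes B: "B \<in> blocks (sub S)" and \<phi>: "center_alg_hom (sub S) \<phi>" "\<phi> B = 1"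
    and z: "z \<in> invariants S S" "\<phi> z = 0"
  shows "\<exists>n. ga_pow z n \<star> B = 0"
proof -
  have "B \<in> supported S" "z \<in> supported S" using sub_blockD[OF B] z by (auto simp: invariants_supported)
  then show ?thesis
    using finite_group.block_kernel_nilpotent[OF sub_finite_group[OF S] B \<phi>, of z] z
    by (simp add: sub_center[OF S] sub_mult[OF S] sub_pow[OF S])
qed

lemma restr_center:
  assumes z: "z \<in> ga_center G" shows "restr S z \<in> invariants S S"
proof (rule restr_to_invariants[OF S])
  show "z \<in> invariants (carrier G) S"
    using z subgroup.subset[OF S] by (auto simp: ga_center_eq intro: invariants_mono)
qed

end

lemma trace_radical_add:
  assumes S: "subgroup S G" and X: "subgroup X G" and \<phi>: "center_alg_hom (sub X) \<phi>"
    and uw: "u \<in> trace_radical S X \<phi>" "w \<in> trace_radical S X \<phi>"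
  shows "u + w \<in> trace_radical S X \<phi>"
proof -
  note XG = subgroup.subset[OF X]
  have "\<phi> (restr X ((u + w) \<star> v)) = 0" if v: "v \<in> invariants S X" for v
  proof -
    have r: "restr X (t \<star> v) \<in> invariants X X" if "t \<in> invariants S X" for t
      by (rule restr_to_invariants[OF X invariants_conv[OF S XG that v]])
    show ?thesis using uw v sub_hom(1)[OF X \<phi> r r, of u w]
      by (simp add: trace_radical_def conv_add_left restr_add)
  qed
  then show ?thesis using uw by (simp add: trace_radical_def invariants_add)
qed

text \<open>
  The form in which \<open>radical_idempotent_zero\<close> is applied, both to the blocks of \<open>H\<close> and to those of \<open>G\<close>.
\<close>
lemma covering_component_not_radical:
  assumes S: "subgroup S G" and X: "subgroup X G" "X \<subseteq> S" "\<And>s x. s \<in> S \<Longrightarrow> x \<in> X \<Longrightarrow> s \<otimes> x \<otimes> inv s \<in> X"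
    and c: "c \<in> blocks (sub X)" and \<phi>: "center_alg_hom (sub X) \<phi>" "\<phi> c = 1"
    and B: "B \<in> invariants S S" "B \<star> B = B" and rad: "B \<star> c \<in> trace_radical S X \<phi>"
  shows "B \<star> c = 0"
proof -
  note c' = sub_blockD[OF X(1) c]
  have comm: "c \<star> B = B \<star> c"
    using invariants_commute[OF subgroup.subset[OF X(1)] subgroup.subset[OF S]
       invariants_mono[OF B(1) order_refl X(2)] invariants_supported[OF c'(1)]] by simp
  have idem: "B \<star> c \<star> (B \<star> c) = B \<star> c" using comm B(2) c'(2) by (metis conv_assoc)
  have "c \<star> (B \<star> c) = 0"
    by (rule radical_idempotent_zero[OF S X c'(1,2) sub_block_nilpotent[OF X(1) c \<phi>] rad idem])
  then show ?thesis using comm c'(2) by (metis conv_assoc)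
qed

section \<open>Induced blocks as restriction of functions\<close>

lemma center_class_expansion:
  assumes z: "z \<in> ga_center G"
  shows "z = (\<Sum>K\<in>conj_classes G. smul (z (SOME x. x \<in> K)) (sum_of K))"
proof
  fix x
  show "z x = (\<Sum>K\<in>conj_classes G. smul (z (SOME x. x \<in> K)) (sum_of K)) x"
  proof (cases "x \<in> carrier G")
    case True
    let ?C = "conj_class G x"
    have C: "?C \<in> conj_classes G" using True by (auto simp: conj_classes_def)
    have "(\<Sum>K\<in>conj_classes G. z (SOME x. x \<in> K) * sum_of K x) = (\<Sum>K\<in>conj_classes G. if K = ?C then z (SOME x. x \<in> K) else 0)"
    proof (rule sum.cong[OF refl])
      fix K assume K: "K \<in> conj_classes G"
      have "x \<in> K \<longleftrightarrow> K = ?C"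
      proof
        assume "x \<in> K" then show "K = ?C" by (rule conj_classesD(4)[OF K])
      next
        assume "K = ?C" then show "x \<in> K" using conj_class_self[OF True] by simp
      qed
      then show "z (SOME x. x \<in> K) * sum_of K x = (if K = ?C then z (SOME x. x \<in> K) else 0)" by (simp add: sum_of_def)
    qed
    also have "\<dots> = z (SOME y. y \<in> ?C)" using C finite_conj_classes by simp
    also have "\<dots> = z x" using class_fun_rep[OF class_fun_center[OF z] C conj_class_self[OF True]] by simp
    finally show ?thesis by (simp add: sum_fun_apply smul_def)
  next
    case False
    then have "sum_of K x = (0 :: 'c)" if "K \<in> conj_classes G" for K
      using conj_classesD(1)[OF that] by (auto simp: sum_of_def)
    then show ?thesis using False center_supported[OF z] by (simp add: sum_fun_apply smul_def supported_def)
  qed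
qed

lemma induced_map_restr:
  fixes z :: "'a \<Rightarrow> 'c::field"
  assumes H: "subgroup H G" and hom: "center_alg_hom (sub H) (block_char (sub H) star B')" and z: "z \<in> ga_center G"
  shows "induced_map G star H B' z = block_char (sub H) star B' (restr H z)"
proof -
  interpret H: finite_group "sub H" by (rule sub_finite_group[OF H])
  let ?\<phi> = "block_char (sub H) star B'"
  have s: "sum_of (K \<inter> H) = restr H (sum_of K)" for K by (auto simp: sum_of_def restr_def)
  have c: "smul k (restr H (sum_of K)) \<in> ga_center (sub H)" "restr H (sum_of K :: 'a \<Rightarrow> 'c) \<in> ga_center (sub H)"
    if "K \<in> conj_classes G" for K and k :: 'c
    using restr_center[OF H sum_of_class_center[OF that]] by (auto simp: sub_center[OF H] intro: invariants_smul)
  have "restr H z = (\<Sum>K\<in>conj_classes G. smul (z (SOME x. x \<in> K)) (restr H (sum_of K)))"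
    by (subst center_class_expansion[OF z]) (simp add: restr_sum restr_smul)
  then have "?\<phi> (restr H z) = (\<Sum>K\<in>conj_classes G. ?\<phi> (smul (z (SOME x. x \<in> K)) (restr H (sum_of K))))"
    using c by (simp add: H.hom_sum[OF hom])
  also have "\<dots> = (\<Sum>K\<in>conj_classes G. z (SOME x. x \<in> K) * ?\<phi> (restr H (sum_of K)))"
    using c by (intro sum.cong refl) (simp add: H.hom_smul[OF hom])
  finally show ?thesis by (simp add: induced_map_def class_ext_def s)
qed

lemma induced_map_hom:
  assumes H: "subgroup H G" and hom: "center_alg_hom (sub H) (block_char (sub H) star B')"
    and mult: "\<And>z w. z \<in> ga_center G \<Longrightarrow> w \<in> ga_center G \<Longrightarrow>
      block_char (sub H) star B' (restr H (z \<star> w)) = block_char (sub H) star B' (restr H z \<star> restr H w)"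
  shows "center_alg_hom G (induced_map G star H B')"
proof -
  let ?\<phi> = "block_char (sub H) star B'"
  note ind = induced_map_restr[OF H hom]
  note r = restr_center[OF H]
  have "induced_map G star H B' (z \<star> w) = induced_map G star H B' z * induced_map G star H B' w"
    if "z \<in> ga_center G" "w \<in> ga_center G" for z w
    using that by (simp add: ind center_conv mult sub_hom(4)[OF H hom r r])
  moreover have "induced_map G star H B' (z + w) = induced_map G star H B' z + induced_map G star H B' w"
    if "z \<in> ga_center G" "w \<in> ga_center G" for z w
    using that by (simp add: ind center_add restr_add sub_hom(1)[OF H hom r r])
  moreover have "induced_map G star H B' (smul c z) = c * induced_map G star H B' z"
    if "z \<in> ga_center G" for z c
    using that by (simp add: ind center_smul restr_smul sub_hom(3)[OF H hom r r])
  moreover have "induced_map G star H B' \<epsilon> = 1"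
    using finite_group.hom_unit[OF sub_finite_group[OF H] hom]
    by (simp add: ind restr_id[OF unit_supported[OF H]])
  ultimately show ?thesis by (simp add: center_alg_hom_def plus_fun_def smul_def)
qed

text \<open>
  An induced map that is a homomorphism is the central character of a unique block, which is
  recognised by a nonzero value on its idempotent.
\<close>
lemma induced_blockD:
  fixes star :: "'K::field_char_0 \<Rightarrow> 'k::field"
  assumes sys: "p_modular_system p v star" and split: "splitting_field TYPE('K) G"
    and ind: "center_alg_hom G (induced_map G star H B')"
  shows "induced_block G star H B' \<in> blocks G" (is ?A)
    and "\<And>z. z \<in> ga_center G \<Longrightarrow> block_char G star (induced_block G star H B') z = induced_map G star H B' z"
    and "\<And>C. C \<in> blocks G \<Longrightarrow> induced_map G star H B' C \<noteq> 0 \<Longrightarrow> induced_block G star H B' = C"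
proof -
  let ?\<mu> = "induced_map G star H B'"
  let ?P = "\<lambda>B. B \<in> blocks G \<and> (\<forall>z\<in>ga_center G. block_char G star B z = ?\<mu> z)"
  have ex1: "\<exists>!B. B \<in> blocks G \<and> ?\<mu> B = 1" by (rule ex_block_of_hom[OF ind])
  have iff: "?P B \<longleftrightarrow> B \<in> blocks G \<and> ?\<mu> B = 1" for B
  proof
    assume P: "?P B"
    then show "B \<in> blocks G \<and> ?\<mu> B = 1" using block_char_hom(2)[OF sys split, of B] blockD(1)[of B] by auto
  next
    assume "B \<in> blocks G \<and> ?\<mu> B = 1"
    then show "?P B" using block_char_unique[OF _ block_char_hom[OF sys split] ind] by auto
  qed
  have P: "?P (induced_block G star H B')"
    unfolding induced_block_def by (rule theI'[of ?P]) (simp only: iff ex1)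
  then show ?A "\<And>z. z \<in> ga_center G \<Longrightarrow> block_char G star (induced_block G star H B') z = ?\<mu> z" by auto
  fix C assume C: "C \<in> blocks G" "?\<mu> C \<noteq> 0"
  then have "?\<mu> C = 1" using hom_idem[OF ind blockD(1,2)[OF C(1)]] by auto
  then show "induced_block G star H B' = C" using ex1 P C(1) iff by blast
qed

section \<open>Covering blocks under induction\<close>

context
  fixes N H M D :: "'a set" and b' :: "'a \<Rightarrow> 'c::field" and \<phi> :: "('a \<Rightarrow> 'c) \<Rightarrow> 'c"
  assumes N: "N \<lhd> G" and H: "subgroup H G" and M: "M = N \<inter> H"
    and b': "b' \<in> blocks (sub M)" and D: "defect_group (sub M) b' D" and cent: "centralizer G D \<subseteq> H"
    and \<phi>: "center_alg_hom (sub M) \<phi>" "\<phi> b' = 1"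
begin

lemma N_sub: "subgroup N G" using N by (rule normal_imp_subgroup)
lemma M_sub: "subgroup M G" unfolding M by (rule subgroups_Inter_pair[OF N_sub H])
lemma M_H: "M \<subseteq> H" and M_N: "M \<subseteq> N" using M by auto
lemma N_normal: "s \<in> carrier G \<Longrightarrow> x \<in> N \<Longrightarrow> s \<otimes> x \<otimes> inv s \<in> N"
  by (rule normal.inv_op_closed2[OF N])
lemma M_normal: "s \<in> H \<Longrightarrow> x \<in> M \<Longrightarrow> s \<otimes> x \<otimes> inv s \<in> M"
  using N_normal[of s x] H subgroup.mem_carrier[OF H, of s] unfolding M
  by (auto intro: subgroup.m_closed subgroup.m_inv_closed)
lemma D_M: "D \<subseteq> M"
  using D subgroup.subset[of D "sub M"] by (auto simp: defect_group_def)

lemma restr_H_invariants: "x \<in> invariants (carrier G) N \<Longrightarrow> restr H x \<in> invariants H M"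
  by (rule invariants_support[OF restr_invariants[OF invariants_mono[OF _ order_refl M_N]]])
     (use conj_mem_subgroup[OF H] M_H in auto)

text \<open>
  Let \<open>x'\<close> be the part of \<open>x\<close> outside \<open>H\<close>. The error \<open>\<Delta>\<close> is \<open>\<pi>\<^sub>H(x' y)\<close>, so for \<open>v\<close> in \<open>(kH)\<^sup>M\<close> and
  \<open>b' = Tr\<^sub>D\<^sup>M(a)\<close> the element \<open>\<pi>\<^sub>M(\<Delta> v) a\<close> is the sum over \<open>g\<close> outside \<open>H\<close> of
  \<open>F g = x(g) \<pi>\<^sub>M(g y v) a\<close>. All ingredients are \<open>D\<close>-invariant, so \<open>F\<close> is compatible with conjugation by
  \<open>D\<close>. A fixed point would centralise \<open>D\<close> and hence lie in \<open>H\<close>.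
\<close>
lemma restriction_defect_in_radical:
  assumes x: "x \<in> invariants (carrier G) N" and y: "y \<in> invariants (carrier G) N"
  shows "restr H (x \<star> y) - restr H x \<star> restr H y \<in> trace_radical H M \<phi>"
proof -
  interpret MG: finite_group "sub M" by (rule sub_finite_group[OF M_sub])
  have HG: "H \<subseteq> carrier G" and NG: "N \<subseteq> carrier G" and MG: "M \<subseteq> carrier G"
    by (rule subgroup.subset[OF H] subgroup.subset[OF N_sub] subgroup.subset[OF M_sub])+
  have DG: "D \<subseteq> carrier G" using D_M MG by auto
  define \<Delta> where "\<Delta> = restr H (x \<star> y) - restr H x \<star> restr H y"
  define x' where "x' = restr (carrier G - H) x"
  have xy: "x \<star> y \<in> invariants (carrier G) N"
    using invariants_conv[OF subgroup_self NG x y] .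
  have \<Delta>I: "\<Delta> \<in> invariants H M"
    unfolding \<Delta>_def by (intro invariants_diff invariants_conv[OF H MG] restr_H_invariants x y xy)
  have x_split: "x - restr H x = x'"
    using invariants_supported[OF x] by (auto simp: x'_def restr_def supported_def fun_eq_iff)
  have \<Delta>: "\<Delta> = restr H (x' \<star> y)"
    using restr_conv_left[OF H restr_supported, of x y]
    by (simp add: \<Delta>_def x_split[symmetric] conv_diff_left restr_diff)
  have "\<phi> (restr M (\<Delta> \<star> v)) = 0" if v: "v \<in> invariants H M" for v
  proof -
    define w where "w = y \<star> v"
    have vs: "v \<in> supported H" using v by (rule invariants_supported)
    have "\<Delta> \<star> v = restr H (x' \<star> w)"
      unfolding \<Delta> w_def using restr_conv_right[OF H vs, of "x' \<star> y"] by (simp add: conv_assoc)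
    then have Peq: "restr M (\<Delta> \<star> v) = restr M (x' \<star> w)"
      using M_H by (simp add: restr_restr Int_absorb2)
    have wI: "w \<in> invariants (carrier G) M"
      unfolding w_def by (intro invariants_conv[OF subgroup_self MG] invariants_mono[OF y order_refl M_N] invariants_mono[OF v HG order_refl])
    have Pc: "restr M (\<Delta> \<star> v) \<in> invariants M M"
      by (rule restr_to_invariants[OF M_sub invariants_conv[OF H MG \<Delta>I v]])
    obtain a where a: "a \<in> ga_fixed (sub M) D" "b' = rel_trace (sub M) D a"
      using D by (auto simp: defect_group_def rel_projective_def)
    have aM: "a \<in> supported M" using a(1) by (simp add: ga_fixed_def MG.group_algebra_eq)
    have a_inv: "a (d \<otimes> t \<otimes> inv d) = a t" if d: "d \<in> D" and t: "t \<in> carrier G" for d t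
    proof (cases "t \<in> M")
      case True
      have "ga_conj (sub M) d a t = a t" using a(1) d by (simp add: ga_fixed_def)
      then show ?thesis using True d D_M by (auto simp: ga_conj_def m_inv_consistent[OF M_sub])
    next
      case False
      then have "d \<otimes> t \<otimes> inv d \<notin> M" using conj_mem_subgroup[OF M_sub, of d t] d t D_M by auto
      then show ?thesis using False aM by (simp add: supported_def)
    qed
    define F where "F g = smul (x g) (restr M (sum_of {g} \<star> w) \<star> a)" for g
    define X where "X = carrier G - H"
    have FM: "F g \<in> supported M" for g
      unfolding F_def using conv_sub_supported[OF M_sub restr_supported aM]
      by (intro fun_space.subspace_scale[OF subspace_supported])
    have "restr M (\<Delta> \<star> v) \<star> a = restr M (x' \<star> w) \<star> a" by (simp add: Peq)
    also have "x' \<star> w = (\<Sum>g\<in>X. smul (x' g) (sum_of {g} \<star> w))"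
      unfolding x'_def X_def by (intro conv_expand restr_supported) auto
    also have "\<dots> = (\<Sum>g\<in>X. smul (x g) (sum_of {g} \<star> w))"
      by (intro sum.cong) (auto simp: x'_def restr_def X_def)
    finally have sumF: "ga_mult (sub M) (restr M (\<Delta> \<star> v)) a = (\<Sum>g\<in>X. F g)"
      by (simp add: sub_mult[OF M_sub restr_supported aM] restr_sum restr_smul conv_sum_left F_def)
    define act where "act d g = d \<otimes> g \<otimes> inv d" for d g
    have act_X: "act d g \<in> X" if "g \<in> X" "d \<in> D" for d g
      using that conj_mem_subgroup[OF H, of d g] D_M M_H DG by (auto simp: X_def act_def)
    have free: "\<exists>d\<in>D. act d g \<noteq> g" if g: "g \<in> X" for g
    proof (rule ccontr)
      assume "\<not> ?thesis"
      then have fixed: "d \<otimes> g \<otimes> inv d = g" if "d \<in> D" for d using that by (auto simp: act_def)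
      have gG: "g \<in> carrier G" using g by (simp add: X_def)
      have "g \<otimes> d = d \<otimes> g" if d: "d \<in> D" for d
      proof -
        have dG: "d \<in> carrier G" using d DG by auto
        have "g \<otimes> d = (d \<otimes> g \<otimes> inv d) \<otimes> d" using fixed[OF d] by simp
        also have "\<dots> = d \<otimes> g" using dG gG by (simp add: m_assoc)
        finally show ?thesis .
      qed
      then have "g \<in> centralizer G D" using gG by (auto simp: centralizer_def)
      then show False using cent g by (auto simp: X_def)
    qed
    have F_eq: "F (act d g) = ga_conj (sub M) (inv\<^bsub>sub M\<^esub> d) (F g)" if g: "g \<in> X" and d: "d \<in> D" for g d
    proof
      fix m
      have gG: "g \<in> carrier G" and dG: "d \<in> carrier G" and dM: "d \<in> M" using g d DG D_M by (auto simp: X_def)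
      have D': "subgroup D (sub M)" using D by (simp add: defect_group_def)
      have di: "inv d \<in> D" "inv d \<in> M"
        using subgroup.m_inv_closed[OF D' d] m_inv_consistent[OF M_sub dM] D_M by auto
      show "F (act d g) m = ga_conj (sub M) (inv\<^bsub>sub M\<^esub> d) (F g) m"
      proof (cases "m \<in> M")
        case True
        then have mG: "m \<in> carrier G" using MG by auto
        have i: "inv\<^bsub>sub M\<^esub> d = inv d" "inv\<^bsub>sub M\<^esub> (inv d) = d"
          using m_inv_consistent[OF M_sub dM] m_inv_consistent[OF M_sub di(2)] dG by auto
        have xg: "x (d \<otimes> g \<otimes> inv d) = x g" using x gG dM M_N by (auto simp: invariants_def)
        have w_inv: "w (d \<otimes> t \<otimes> inv d) = w t" if "t \<in> carrier G" for t using wI that dM by (auto simp: invariants_def)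
        have eq: "restr M (sum_of {g} \<star> w) (inv d \<otimes> t \<otimes> inv (inv d)) = restr M (sum_of {d \<otimes> g \<otimes> inv d} \<star> w) t" if t: "t \<in> carrier G" for t
        proof -
          have "inv (d \<otimes> g \<otimes> inv d) \<otimes> t = d \<otimes> (inv g \<otimes> (inv d \<otimes> t \<otimes> d)) \<otimes> inv d"
            using gG dG t by (simp add: inv_mult_group m_assoc)
          then have "w (inv (d \<otimes> g \<otimes> inv d) \<otimes> t) = w (inv g \<otimes> (inv d \<otimes> t \<otimes> d))"
            using w_inv[of "inv g \<otimes> (inv d \<otimes> t \<otimes> d)"] gG dG t by simp
          moreover have "inv d \<otimes> t \<otimes> inv (inv d) \<in> M \<longleftrightarrow> t \<in> M" by (rule conj_mem_subgroup[OF M_sub di(2) t])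
          ultimately show ?thesis using gG dG t by (simp add: restr_def delta_conv)
        qed
        have "(restr M (sum_of {g} \<star> w) \<star> a) (inv d \<otimes> m \<otimes> inv (inv d)) = (restr M (sum_of {d \<otimes> g \<otimes> inv d} \<star> w) \<star> a) m"
          unfolding conj_conv[OF inv_closed[OF dG] mG]
          by (rule fun_cong[OF conv_cong]) (auto simp: eq simp del: inv_inv intro: a_inv[OF di(1)])
        then show ?thesis using True dG by (simp add: F_def act_def ga_conj_def i smul_def xg)
      next
        case False
        then show ?thesis using FM[of "act d g"] by (simp add: ga_conj_def supported_def)
      qed
    qed
    have act_mult: "act (d \<otimes> e) g = act d (act e g)" if "g \<in> X" "d \<in> D" "e \<in> D" for d e g
      using that DG by (auto simp: act_def X_def inv_mult_group m_assoc subset_iff)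
    show ?thesis
    proof (rule MG.block_char_fixed_point_free_sum[where act = act and X = X and F = F, OF b' D \<phi> a(2) _ sumF])
      show "restr M (\<Delta> \<star> v) \<in> ga_center (sub M)" using Pc by (simp add: sub_center[OF M_sub])
      show "finite X" by (simp add: X_def)
      show "act \<one>\<^bsub>sub M\<^esub> g = g" if "g \<in> X" for g using that by (simp add: act_def X_def)
      show "act (d \<otimes>\<^bsub>sub M\<^esub> e) g = act d (act e g)" if "g \<in> X" "d \<in> D" "e \<in> D" for d e g
        using act_mult[OF that] by simp
      show "F g \<in> supported (carrier (sub M))" for g using FM by simp
    qed (fact act_X free F_eq)+
  qed
  then show ?thesis using \<Delta>I by (simp add: trace_radical_def \<Delta>_def)
qed

text \<open>
  If \<open>\<psi> z \<noteq> 0\<close>, then \<open>B'\<close> is a multiple of \<open>z\<close>, so \<open>B' b'\<close> is a multiple of \<open>z b'\<close> and would be a nonzero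
  idempotent of the radical.
\<close>
lemma covering_block_vanishes_on_radical:
  assumes B': "B' \<in> blocks (sub H)" "B' \<star> b' \<noteq> 0" and \<psi>: "center_alg_hom (sub H) \<psi>" "\<psi> B' = 1"
    and z: "z \<in> invariants H H" "z \<star> b' \<in> trace_radical H M \<phi>"
  shows "\<psi> z = 0"
proof (rule ccontr)
  assume "\<psi> z \<noteq> 0"
  then obtain y where y: "y \<in> invariants H H" "z \<star> y = B'" using sub_block_unit[OF H B'(1) \<psi> z(1)] by blast
  have MG: "M \<subseteq> carrier G" and HG: "H \<subseteq> carrier G" by (rule subgroup.subset[OF M_sub] subgroup.subset[OF H])+
  have yM: "y \<in> invariants H M" by (rule invariants_mono[OF y(1) order_refl M_H])
  have bM: "b' \<in> supported M" using sub_blockD(1)[OF M_sub b'] by (rule invariants_supported)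
  have "y \<star> b' = b' \<star> y" by (rule invariants_commute[OF MG HG yM bM])
  then have "B' \<star> b' = z \<star> b' \<star> y" using y(2) by (metis conv_assoc)
  then have "B' \<star> b' \<in> trace_radical H M \<phi>" using trace_radical_conv[OF H MG z(2) yM] by simp
  then show False
    using covering_component_not_radical[OF H M_sub M_H M_normal b' \<phi> sub_blockD(1,2)[OF H B'(1)]] B'(2) by blast
qed

lemma block_in_invariants: "b' \<in> invariants H M"
  using sub_blockD(1)[OF M_sub b'] by (rule invariants_mono[OF _ M_H order_refl])

lemma covering_induced_hom:
  assumes B': "B' \<in> blocks (sub H)" "B' \<star> b' \<noteq> 0" and \<psi>: "center_alg_hom (sub H) \<psi>" "\<psi> B' = 1"
    and z: "z \<in> ga_center G" and w: "w \<in> ga_center G"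
  shows "\<psi> (restr H (z \<star> w)) = \<psi> (restr H z \<star> restr H w)"
proof -
  have MG: "M \<subseteq> carrier G" by (rule subgroup.subset[OF M_sub])
  have NG: "N \<subseteq> carrier G" by (rule subgroup.subset[OF N_sub])
  have zN: "z \<in> invariants (carrier G) N" "w \<in> invariants (carrier G) N"
    using z w NG by (auto simp: ga_center_eq intro: invariants_mono)
  let ?\<Delta> = "restr H (z \<star> w) - restr H z \<star> restr H w"
  have I: "restr H (z \<star> w) \<in> invariants H H" "restr H z \<star> restr H w \<in> invariants H H"
    using restr_center[OF H] z w center_conv[OF z w] invariants_conv[OF H subgroup.subset[OF H]] by auto
  have "?\<Delta> \<star> b' \<in> trace_radical H M \<phi>"
    by (rule trace_radical_conv[OF H MG restriction_defect_in_radical[OF zN] block_in_invariants])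
  then have "\<psi> ?\<Delta> = 0"
    using covering_block_vanishes_on_radical[OF B' \<psi>] I by (simp add: invariants_diff)
  then show ?thesis using sub_hom(2)[OF H \<psi>(1) I] by simp
qed

text \<open>
  The case of elements of \<open>kN\<close>, on which restriction to \<open>H\<close> is restriction to \<open>M\<close>. It makes
  \<open>(b')\<^sup>N\<close> defined.
\<close>
lemma block_char_restr_mult:
  assumes z: "z \<in> invariants N N" and w: "w \<in> invariants N N"
  shows "\<phi> (restr M (z \<star> w)) = \<phi> (restr M z \<star> restr M w)"
proof -
  have MG: "M \<subseteq> carrier G" by (rule subgroup.subset[OF M_sub])
  have NG: "N \<subseteq> carrier G" by (rule subgroup.subset[OF N_sub])
  have rN: "restr H a = restr M a" if "a \<in> supported N" for a :: "'a \<Rightarrow> 'c"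
    using that by (auto simp: restr_def M supported_def fun_eq_iff)
  have zw: "z \<star> w \<in> supported N"
    using invariants_conv[OF N_sub NG z w] by (rule invariants_supported)
  have "restr H (z \<star> w) - restr H z \<star> restr H w \<in> trace_radical H M \<phi>"
    using z w NG by (intro restriction_defect_in_radical) (auto intro: invariants_mono)
  then have "restr M (z \<star> w) - restr M z \<star> restr M w \<in> trace_radical H M \<phi>"
    using zw z w by (simp add: rN invariants_supported)
  from trace_radical_zero[OF H MG this]
  have 0: "\<phi> (restr M (z \<star> w) - restr M z \<star> restr M w) = 0"
    using conv_sub_supported[OF M_sub restr_supported restr_supported, of z w]
    by (simp add: restr_diff restr_restr restr_id)
  have r: "restr M a \<in> invariants M M" if "a \<in> invariants N N" for a
    by (rule restr_to_invariants[OF M_sub invariants_mono[OF that order_refl M_N]])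
  show ?thesis using 0 sub_hom(2)[OF M_sub \<phi>(1) r[OF invariants_conv[OF N_sub NG z w]] invariants_conv[OF M_sub MG r[OF z] r[OF w]]] by simp
qed

context
  fixes b :: "'a \<Rightarrow> 'c" and \<beta> :: "('a \<Rightarrow> 'c) \<Rightarrow> 'c"
  assumes b: "b \<in> blocks (sub N)" and \<beta>: "center_alg_hom (sub N) \<beta>" "\<beta> b = 1"
    and \<beta>_eq: "\<And>z. z \<in> invariants N N \<Longrightarrow> \<beta> z = \<phi> (restr M z)"
begin

text \<open>
  If \<open>B b = 0\<close>, then \<open>\<pi>\<^sub>H(B) \<pi>\<^sub>M(b)\<close> is in the radical. As \<open>\<phi>(\<pi>\<^sub>M(b)) = \<beta>(b) = 1\<close>, the element \<open>b'\<close> is a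
  multiple of \<open>\<pi>\<^sub>M(b)\<close>, so \<open>\<pi>\<^sub>H(B) b'\<close> is in the radical too, and \<open>\<psi>\<close> would vanish on \<open>\<pi>\<^sub>H(B)\<close>.
\<close>
lemma induced_block_covers:
  assumes B': "B' \<in> blocks (sub H)" "B' \<star> b' \<noteq> 0" and \<psi>: "center_alg_hom (sub H) \<psi>" "\<psi> B' = 1"
    and B: "B \<in> ga_center G" "\<psi> (restr H B) \<noteq> 0"
  shows "B \<star> b \<noteq> 0"
proof
  assume Bb: "B \<star> b = 0"
  have MG: "M \<subseteq> carrier G" and NG: "N \<subseteq> carrier G" by (rule subgroup.subset[OF M_sub] subgroup.subset[OF N_sub])+
  have bN: "b \<in> invariants N N" by (rule sub_blockD(1)[OF N_sub b])
  have BN: "B \<in> invariants (carrier G) N" using B NG by (auto simp: ga_center_eq intro: invariants_mono)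
  have bG: "b \<in> invariants (carrier G) N" by (rule invariants_mono[OF bN NG order_refl])
  let ?z = "restr H B"
  let ?t = "restr M b"
  have zI: "?z \<in> invariants H H" by (rule restr_center[OF H B(1)])
  have t: "restr H b = ?t" using invariants_supported[OF bN] by (auto simp: restr_def M supported_def fun_eq_iff)
  have tI: "?t \<in> invariants M M"
    using restr_H_invariants[OF bG] unfolding t by (rule invariants_support) simp
  have "\<phi> ?t = 1" using \<beta>_eq[OF bN] \<beta>(2) by simp
  then obtain y where y: "y \<in> invariants M M" "?t \<star> y = b'" using sub_block_unit[OF M_sub b' \<phi> tI] by auto
  have "0 - ?z \<star> ?t \<in> trace_radical H M \<phi>"
    using restriction_defect_in_radical[OF BN bG] unfolding Bb t restr_0 .
  then have "(0 - ?z \<star> ?t) \<star> smul (-1) y \<in> trace_radical H M \<phi>"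
    by (rule trace_radical_conv[OF H MG _ invariants_smul[OF invariants_mono[OF y(1) M_H order_refl]]])
  moreover have "(0 - ?z \<star> ?t) \<star> smul (-1) y = ?z \<star> b'"
    unfolding conv_smul_right conv_diff_left conv_0 conv_assoc y(2) by (auto simp: smul_def fun_eq_iff)
  ultimately have "?z \<star> b' \<in> trace_radical H M \<phi>" by simp
  then show False using covering_block_vanishes_on_radical[OF B' \<psi> zI] B(2) by simp
qed

text \<open>
  Let \<open>z = \<pi>\<^sub>H(B)\<close> and let \<open>f\<close> be its Fitting idempotent. If \<open>f b' \<noteq> 0\<close>, a block below \<open>f\<close> that covers \<open>b'\<close>
  does not vanish on \<open>z\<close>. Otherwise \<open>z\<^sup>n b' = 0\<close>, so \<open>z\<^sup>n\<close> is in the radical; as \<open>B\<close> is idempotent, \<open>z\<close> and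
  \<open>z\<^sup>n\<close> are congruent modulo the radical, so \<open>z\<close> is in the radical for \<open>b'\<close>, and then \<open>B\<close> is in the radical for
  \<open>b\<close>.
\<close>
lemma ex_covering_block:
  assumes B: "B \<in> blocks G" "B \<star> b \<noteq> 0"
    and \<psi>: "\<And>B'. B' \<in> blocks (sub H) \<Longrightarrow> center_alg_hom (sub H) (\<psi> B') \<and> \<psi> B' B' = 1"
  shows "\<exists>B'\<in>blocks (sub H). B' \<star> b' \<noteq> 0 \<and> \<psi> B' (restr H B) \<noteq> 0"
proof (rule ccontr)
  assume no: "\<not> ?thesis"
  interpret HG: finite_group "sub H" by (rule sub_finite_group[OF H])
  have MG: "M \<subseteq> carrier G" and NG: "N \<subseteq> carrier G" and HG: "H \<subseteq> carrier G"
    by (rule subgroup.subset[OF M_sub] subgroup.subset[OF N_sub] subgroup.subset[OF H])+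
  let ?z = "restr H B"
  have zI: "?z \<in> invariants H H" by (rule restr_center[OF H blockD(1)[OF B(1)]])
  have zM: "?z \<in> invariants H M" by (rule invariants_mono[OF zI order_refl M_H])
  have BN: "B \<in> invariants (carrier G) N" using blockD(1)[OF B(1)] NG by (auto simp: ga_center_eq intro: invariants_mono)
  have bM: "b' \<in> invariants M M" by (rule sub_blockD(1)[OF M_sub b'])
  have bs: "b' \<in> supported H" using invariants_supported[OF bM] M_H by (rule supported_mono)
  obtain n y f where f: "n > 0" "y \<in> ga_center (sub H)" "f = ga_mult (sub H) (HG.ga_pow ?z n) y"
    "f \<in> ga_center (sub H)" "ga_mult (sub H) f f = f" "ga_mult (sub H) (HG.ga_pow ?z n) f = HG.ga_pow ?z n"
    using HG.fitting_idempotent[of ?z] zI by (auto simp: sub_center[OF H])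
  have zc: "?z \<in> ga_center (sub H)" using zI by (simp add: sub_center[OF H])
  have fs: "f \<in> supported H" using HG.center_supported[OF f(4)] by simp
  have "f \<star> b' = 0"
  proof (rule ccontr)
    assume "f \<star> b' \<noteq> 0"
    then have "\<exists>B'\<in>blocks (sub H). ga_mult (sub H) B' f = B' \<and> B' \<star> b' \<noteq> 0"
      using f(4,5) by (intro HG.primitive_refinement) (auto simp: conv_add_left)
    then obtain B' where B': "B' \<in> blocks (sub H)" "ga_mult (sub H) B' f = B'" "B' \<star> b' \<noteq> 0" by blast
    note h = \<psi>[OF B'(1)]
    have "\<psi> B' f = 1"
      using HG.hom_mult[OF conjunct1[OF h] HG.blockD(1)[OF B'(1)] f(4)] h B'(2) by simp
    moreover have "\<psi> B' f = \<psi> B' ?z ^ n * \<psi> B' y"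
      unfolding f(3) using HG.hom_mult[OF conjunct1[OF h] HG.ga_pow_center[OF zc] f(2)] HG.hom_pow[OF conjunct1[OF h] zc] by simp
    ultimately have "\<psi> B' ?z \<noteq> 0" using f(1) by (metis mult_zero_left power_eq_0_iff zero_neq_one)
    then show False using no B' by blast
  qed
  have zs: "?z \<in> supported H" by simp
  have zn: "ga_pow ?z n \<in> supported H" by (rule sub_pow(2)[OF H zs])
  have "ga_pow ?z n \<star> f = ga_pow ?z n"
    using f(6) by (simp add: sub_pow[OF H zs] sub_mult[OF H zn fs])
  then have nil: "ga_pow ?z n \<star> b' = 0" using \<open>f \<star> b' = 0\<close> by (metis conv_assoc conv_0(2))
  have powI: "ga_pow ?z m \<in> invariants H M" for m by (rule ga_pow_invariants[OF H MG zM])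
  have pow_rad: "ga_pow ?z n \<in> trace_radical H M \<phi>"
  proof -
    have "\<phi> (restr M (ga_pow ?z n \<star> v)) = 0" if v: "v \<in> invariants H M" for v
    proof -
      let ?P = "restr M (ga_pow ?z n \<star> v)"
      have P: "?P \<in> invariants M M" by (rule restr_to_invariants[OF M_sub invariants_conv[OF H MG powI v]])
      have "?P \<star> b' = restr M (ga_pow ?z n \<star> v \<star> b')"
        using restr_conv_right[OF M_sub invariants_supported[OF bM]] by simp
      also have "ga_pow ?z n \<star> v \<star> b' = ga_pow ?z n \<star> b' \<star> v"
        using invariants_commute[OF MG HG v invariants_supported[OF bM]] by (simp add: conv_assoc)
      finally have "?P \<star> b' = 0" unfolding nil conv_0 restr_0 .
      then show ?thesis using sub_hom(4)[OF M_sub \<phi>(1) P bM] \<phi>(2) sub_hom_0[OF M_sub \<phi>(1)] by simp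
    qed
    then show ?thesis using powI by (simp add: trace_radical_def)
  qed
  note rad_add = trace_radical_add[OF H M_sub \<phi>(1)]
  have diff: "?z - ga_pow ?z (Suc m) \<in> trace_radical H M \<phi>" for m
  proof (induction m)
    case 0
    have "0 \<in> trace_radical H M \<phi>"
      by (simp add: trace_radical_def sub_hom_0[OF M_sub \<phi>(1)])
    moreover have "?z - ga_pow ?z (Suc 0) = 0" using supported_mono[OF zs HG] by simp
    ultimately show ?case by (simp only:)
  next
    case (Suc m)
    have d: "?z - ?z \<star> ?z \<in> trace_radical H M \<phi>"
      using restriction_defect_in_radical[OF BN BN] blockD(2)[OF B(1)] by simp
    have "(?z - ga_pow ?z (Suc m)) \<star> ?z \<in> trace_radical H M \<phi>"
      by (rule trace_radical_conv[OF H MG Suc zM])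
    from rad_add[OF d this] have "(?z - ?z \<star> ?z) + (?z - ga_pow ?z (Suc m)) \<star> ?z \<in> trace_radical H M \<phi>" .
    moreover have "(?z - ?z \<star> ?z) + (?z - ga_pow ?z (Suc m)) \<star> ?z = ?z - ga_pow ?z (Suc (Suc m))"
      unfolding conv_diff_left ga_pow.simps(2) by (rule ext) simp
    ultimately show ?case by (simp only:)
  qed
  obtain m where m: "n = Suc m" using f(1) gr0_implies_Suc by blast
  have "(?z - ga_pow ?z n) + ga_pow ?z n \<in> trace_radical H M \<phi>"
    by (rule rad_add[OF diff[of m, folded m] pow_rad])
  then have zrad: "?z \<in> trace_radical H M \<phi>" by simp
  (* On (kG)^N the form for b is the form for b' composed with the restriction to H, because
     lambda_b is lambda_b' composed with the restriction to M. *)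
  have "B \<in> trace_radical (carrier G) N \<beta>"
  proof -
    have "\<beta> (restr N (B \<star> v)) = 0" if v: "v \<in> invariants (carrier G) N" for v
    proof -
      have Bv: "B \<star> v \<in> invariants (carrier G) N" by (rule invariants_conv[OF subgroup_self NG BN v])
      have "restr N (B \<star> v) \<in> invariants N N" by (rule restr_to_invariants[OF N_sub Bv])
      then have "\<beta> (restr N (B \<star> v)) = \<phi> (restr M (restr N (B \<star> v)))" by (rule \<beta>_eq)
      also have "restr M (restr N (B \<star> v)) = restr M (restr H (B \<star> v))"
        using M by (simp add: restr_restr) (metis Int_absorb2 M_H M_N)
      also have "restr H (B \<star> v) \<in> trace_radical H M \<phi>"
        using rad_add[OF restriction_defect_in_radical[OF BN v] trace_radical_conv[OF H MG zrad restr_H_invariants[OF v]]] by simp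
      then have "\<phi> (restr M (restr H (B \<star> v))) = 0" by (rule trace_radical_zero[OF H MG])
      finally show ?thesis .
    qed
    then show ?thesis using BN by (simp add: trace_radical_def)
  qed
  then have "B \<star> b \<in> trace_radical (carrier G) N \<beta>"
    by (rule trace_radical_conv[OF subgroup_self NG]) (rule invariants_mono[OF sub_blockD(1)[OF N_sub b] NG order_refl])
  then have "B \<star> b = 0"
    using blockD(1,2)[OF B(1)]
    by (intro covering_component_not_radical[OF subgroup_self N_sub NG N_normal b \<beta>]) (auto simp: ga_center_eq)
  then show False using B(2) by simp
qed

end

end

end

theorem theorem2:
  fixes G :: "('g, 'm) monoid_scheme"
    and N H M D :: "'g set"
    and p :: nat
    and v :: "'K::field_char_0 \<Rightarrow> int"
    and star :: "'K \<Rightarrow> 'k::field"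
    and b' b :: "'g \<Rightarrow> 'k"
  assumes "prime p"
    and "p_modular_system p v star"
    and "group G" and "finite (carrier G)"
    and "N \<lhd> G" and "subgroup H G" and "M = N \<inter> H"
    and "\<forall>L\<in>{carrier G, N, H, M}.
           splitting_field TYPE('K) (G\<lparr>carrier := L\<rparr>) \<and>
           splitting_field TYPE('k) (G\<lparr>carrier := L\<rparr>)"
    and "b' \<in> blocks (G\<lparr>carrier := M\<rparr>)"
    and "defect_group (G\<lparr>carrier := M\<rparr>) b' D"
    and "centralizer G D \<subseteq> H"
    and "b = induced_block (G\<lparr>carrier := N\<rparr>) star M b'"
  shows "induced_block_defined (G\<lparr>carrier := N\<rparr>) star M b' \<and> b \<in> blocks (G\<lparr>carrier := N\<rparr>) \<and>
    (\<forall>B'\<in>blocks_covering (G\<lparr>carrier := H\<rparr>) b'.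
       induced_block_defined G star H B' \<and> induced_block G star H B' \<in> blocks_covering G b) \<and>
    induced_block G star H ` blocks_covering (G\<lparr>carrier := H\<rparr>) b' = blocks_covering G b"
proof -
  note sys = assms(2) and N = assms(5) and H = assms(6) and M = assms(7) and b' = assms(9) and D = assms(10) and cent = assms(11)
  interpret finite_group G using assms(3,4) by (simp add: finite_group_def finite_group_axioms_def)
  have N_sub: "subgroup N G" using N by (rule normal_imp_subgroup)
  have M_sub: "subgroup M G" unfolding M by (rule subgroups_Inter_pair[OF N_sub H])
  interpret NG: finite_group "sub N" by (rule sub_finite_group[OF N_sub])
  have split: "splitting_field TYPE('K) G" "splitting_field TYPE('K) (sub N)" "splitting_field TYPE('K) (sub H)" "splitting_field TYPE('K) (sub M)"
    using assms(8) by simp_all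
  let ?\<phi> = "block_char (sub M) star b'"
  note \<phi> = finite_group.block_char_hom[OF sub_finite_group[OF M_sub] sys split(4) b']
  note \<psi> = finite_group.block_char_hom[OF sub_finite_group[OF H] sys split(3)]
  note hyps = N H M b' D cent \<phi>
  have MN: "subgroup M (sub N)" using M by (intro subgroup_incl[OF M_sub N_sub]) auto
  have defN: "center_alg_hom (sub N) (induced_map (sub N) star M b')"
  proof (rule NG.induced_map_hom[OF MN])
    show "center_alg_hom (NG.sub M) (block_char (NG.sub M) star b')" using \<phi>(1) by simp
    fix z w :: "'g \<Rightarrow> 'k" assume zw: "z \<in> ga_center (sub N)" "w \<in> ga_center (sub N)"
    have I: "z \<in> invariants N N" "w \<in> invariants N N" using zw by (simp_all add: sub_center[OF N_sub])
    have s: "restr M z \<in> supported N" "restr M w \<in> supported N" using M by (auto intro: supported_mono[OF restr_supported])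
    show "block_char (NG.sub M) star b' (restr M (ga_mult (sub N) z w)) = block_char (NG.sub M) star b' (ga_mult (sub N) (restr M z) (restr M w))"
      using block_char_restr_mult[OF hyps I] sub_mult[OF N_sub s] sub_mult[OF N_sub invariants_supported[OF I(1)] invariants_supported[OF I(2)]] by simp
  qed
  note bD = NG.induced_blockD[OF sys split(2) defN, folded assms(12)]
  note \<beta> = NG.block_char_hom[OF sys split(2) bD(1)]
  have \<beta>_eq: "block_char (sub N) star b z = ?\<phi> (restr M z)" if z: "z \<in> invariants N N" for z
  proof -
    have z': "z \<in> ga_center (sub N)" using z by (simp add: sub_center[OF N_sub])
    have "center_alg_hom (NG.sub M) (block_char (NG.sub M) star b')" using \<phi>(1) by simp
    from NG.induced_map_restr[OF MN this z'] show ?thesis using bD(2)[OF z'] by simp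
  qed
  note hyps2 = hyps bD(1) \<beta> \<beta>_eq
  have cov_H: "B' \<in> blocks_covering (sub H) b' \<longleftrightarrow> B' \<in> blocks (sub H) \<and> B' \<star> b' \<noteq> 0" for B' :: "'g \<Rightarrow> 'k"
  proof -
    have "b' \<in> supported H" using sub_blockD(1)[OF M_sub b'] M by (auto simp: invariants_def supported_def)
    then have "B' \<in> blocks (sub H) \<Longrightarrow> ga_mult (sub H) B' b' = B' \<star> b'"
      using sub_blockD(1)[OF H, of B'] by (intro sub_mult[OF H]) (auto dest: invariants_supported)
    then show ?thesis by (auto simp: blocks_covering_def zero_fun_eq)
  qed
  have cov_G: "B \<in> blocks_covering G b \<longleftrightarrow> B \<in> blocks G \<and> B \<star> b \<noteq> 0" for B :: "'g \<Rightarrow> 'k"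
    by (simp add: blocks_covering_def zero_fun_eq)
  have defG: "center_alg_hom G (induced_map G star H B')" if B': "B' \<in> blocks (sub H)" "B' \<star> b' \<noteq> 0" for B'
    by (rule induced_map_hom[OF H \<psi>(1)[OF B'(1)]]) (rule covering_induced_hom[OF hyps B' \<psi>[OF B'(1)]])
  have covers: "induced_block G star H B' \<in> blocks_covering G b" if B': "B' \<in> blocks (sub H)" "B' \<star> b' \<noteq> 0" for B'
  proof -
    let ?B = "induced_block G star H B'"
    note iD = induced_blockD[OF sys split(1) defG[OF B']]
    have "block_char G star ?B ?B = 1" by (rule block_char_hom(2)[OF sys split(1) iD(1)])
    then have "block_char (sub H) star B' (restr H ?B) \<noteq> 0"
      using iD(2)[OF blockD(1)[OF iD(1)]] induced_map_restr[OF H \<psi>(1)[OF B'(1)] blockD(1)[OF iD(1)]] by simp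
    from induced_block_covers[OF hyps2 B' \<psi>[OF B'(1)] blockD(1)[OF iD(1)] this]
    show ?thesis using iD(1) by (simp add: cov_G)
  qed
  have onto: "B \<in> induced_block G star H ` blocks_covering (sub H) b'" if "B \<in> blocks_covering G b" for B
  proof -
    have B: "B \<in> blocks G" "B \<star> b \<noteq> 0" using that by (simp_all add: cov_G)
    have "\<exists>B'\<in>blocks (sub H). B' \<star> b' \<noteq> 0 \<and> block_char (sub H) star B' (restr H B) \<noteq> 0"
      by (rule ex_covering_block[OF hyps2 B]) (use \<psi> in auto)
    then obtain B' where B': "B' \<in> blocks (sub H)" "B' \<star> b' \<noteq> 0" "block_char (sub H) star B' (restr H B) \<noteq> 0" by blast
    have "induced_map G star H B' B \<noteq> 0"
      using induced_map_restr[OF H \<psi>(1)[OF B'(1)] blockD(1)[OF B(1)]] B'(3) by simp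
    then have "induced_block G star H B' = B"
      using induced_blockD(3)[OF sys split(1) defG[OF B'(1,2)] B(1)] by simp
    then show ?thesis using B' cov_H by blast
  qed
  show ?thesis
    unfolding induced_block_defined_def
    using defN bD(1) defG covers onto cov_H by blast
qed

end
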